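(* Let $n,d$ be integers with $2 \leq d \leq n-1$. Among all trees of order $n$ with diameter $d$, the maximum of the best meeting time $T_{\mathrm{bestmeet}}(G)$ is attained by the balanced double broom $D_{n,d}$, and by no other tree (up to isomorphism). Moreover, $$ T_{\mathrm{bestmeet}}(D_{n,d}) = \begin{cases} \frac{1}{2} \left((d-2) n -d^2 +3 d-2 \right) +\frac{d^3-6 d^2+11 d-6}{6 (n-1)} & \text{if $n$ odd and $d$ odd,} \\ \frac{1}{2} \left( (d-2) n -d^2 +3 d - 1 \right) +\frac{d^3-6 d^2+8 d}{6(n-1)} & \text{if $n$ odd and $d$ even,} \\ \frac{1}{2} \left( (d-2) n - d^2 + 3 d \right) +\frac{d^3-6 d^2+8 d}{6 (n-1)} & \text{if $n$ even and $d$ odd,} \\ \frac{1}{2}\left( (d-2) n- d^2 + 3 d - 1 \right) +\frac{d^3-6 d^2+11 d-6}{6 (n-1)} & \text{if $n$ even and $d$ even.} \\ \end{cases} $$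
   Context: For a connected graph $G=(V,E)$, the simple random walk moves from a vertex $u$ to a uniformly random neighbor of $u$ at each step. The hitting time $H(u,v)$ is the expected number of steps for the walk started at $u$ to reach $v$, with $H(u,u)=0$. The stationary distribution is $\pi_v = \deg(v)/2|E|$. The meeting time at $v$ is $H(\pi,v)=\sum_{u\in V}\pi_u H(u,v)$, and the best meeting time of $G$ is $T_{\mathrm{bestmeet}}(G)=\min_{v\in V} H(\pi,v)$. A double broom of order $n$ and diameter $d\ge 2$ is a tree consisting of a path $v_1,\ldots,v_{d-1}$ together with $\ell\ge 1$ leaves adjacent to $v_1$ and $r \geq 1$ leaves adjacent to $v_{d-1}$, where $\ell + r = n-d+1$ (so the tree has $n$ vertices; when $d=2$, $v_1=v_{d-1}$ and the tree is the star). The balanced double broom $D_{n,d}$ is the double broom with $\ell=\lfloor (n-d+1)/2\rfloor$ and $r=\lceil (n-d+1)/2\rceil$. *)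

theory Defs
  imports "HOL-Probability.Probability" "Graph_Theory.Graph_Theory"
begin

text \<open>
  Finite simple undirected graphs are the symmetric loop-free pair digraphs
  (locale \<^locale>\<open>pair_graph\<close>), every edge being represented by its two orientations.
\<close>

definition edges :: "'a pair_pre_digraph \<Rightarrow> 'a set set" where
  "edges G = (\<lambda>(u, v). {u, v}) ` parcs G"

text \<open>
  \<^const>\<open>Digraph_Component.tree\<close> cannot be used here: in a symmetric digraph, traversing an
  edge back and forth is a directed cycle of length 2.  The cycles of the undirected
  graph are the directed cycles of length at least 3.
\<close>

definition is_tree :: "'a pair_pre_digraph \<Rightarrow> bool" where
  "is_tree G \<longleftrightarrow> pair_graph G \<and> Digraph_Component.connected (with_proj G) \<and>
     \<not> (\<exists>p. pre_digraph.cycle (with_proj G) p \<and> 3 \<le> length p)"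

definition distance :: "'a pair_pre_digraph \<Rightarrow> 'a \<Rightarrow> 'a \<Rightarrow> nat" where
  "distance G u v = (LEAST k. \<exists>p. pre_digraph.awalk (with_proj G) u p v \<and> length p = k)"

definition diam :: "'a pair_pre_digraph \<Rightarrow> nat" where
  "diam G = Max ((\<lambda>(u, v). distance G u v) ` (pverts G \<times> pverts G))"

definition isomorphic :: "'a pair_pre_digraph \<Rightarrow> 'b pair_pre_digraph \<Rightarrow> bool" where
  "isomorphic G H \<longleftrightarrow> digraph_iso (with_proj G) (with_proj H)"

text \<open>
  The law of the simple random walk from \<open>u\<close>, as a measure on trajectories
  \<open>\<omega> :: nat \<Rightarrow> 'a\<close>: the Ionescu-Tulcea extension of the kernels giving the law of the
  position at time \<open>t\<close> conditional on the positions before \<open>t\<close>.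
\<close>

definition srw_kernel :: "'a pair_pre_digraph \<Rightarrow> 'a \<Rightarrow> nat \<Rightarrow> (nat \<Rightarrow> 'a) \<Rightarrow> 'a measure" where
  "srw_kernel G u t \<omega> =
     (case t of 0 \<Rightarrow> measure_pmf (return_pmf u)
              | Suc s \<Rightarrow> measure_pmf (pmf_of_set {w. (\<omega> s, w) \<in> parcs G}))"

definition srw :: "'a pair_pre_digraph \<Rightarrow> 'a \<Rightarrow> (nat \<Rightarrow> 'a) measure" where
  "srw G u = projective_family.lim UNIV
     (Ionescu_Tulcea.CI (srw_kernel G u) (\<lambda>_. count_space UNIV)) (\<lambda>_. count_space UNIV)"

lemma Ionescu_Tulcea_srw: "Ionescu_Tulcea (srw_kernel G u) (\<lambda>_. count_space UNIV)"
proof (rule Ionescu_Tulcea.intro)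
  fix t
  show "srw_kernel G u t \<in> measurable (PiM {0..<t} (\<lambda>_. count_space UNIV))
      (subprob_algebra (count_space UNIV))"
  proof (cases t)
    case 0
    then show ?thesis
      by (simp add: srw_kernel_def[abs_def] measure_pmf_in_subprob_algebra)
  next
    case (Suc s)
    have "(\<lambda>x. measure_pmf (pmf_of_set {w. (x, w) \<in> parcs G}))
        \<in> measurable (count_space UNIV) (subprob_algebra (count_space UNIV))"
      by (simp add: measure_pmf_in_subprob_algebra)
    moreover have "(\<lambda>\<omega>. \<omega> s) \<in> measurable (PiM {0..<t} (\<lambda>_. count_space UNIV)) (count_space UNIV)"
      using Suc by (intro measurable_component_singleton) simp
    ultimately show ?thesis
      using Suc by (auto simp: srw_kernel_def[abs_def] intro: measurable_compose)
  qed
next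
  fix t \<omega>
  show "prob_space (srw_kernel G u t \<omega>)"
    by (auto simp: srw_kernel_def measure_pmf.prob_space_axioms split: nat.split)
qed

lemma emeasure_srw_cylinder:
  "emeasure (srw G u) {\<omega>. \<forall>t\<le>k. \<omega> t = x t} =
     (if x 0 = u then \<Prod>t<k. ennreal (pmf (pmf_of_set {w. (x t, w) \<in> parcs G}) (x (Suc t))) else 0)"
proof -
  interpret IT: Ionescu_Tulcea "srw_kernel G u" "\<lambda>_. count_space UNIV"
    by (rule Ionescu_Tulcea_srw)
  let ?P = "\<lambda>n. PiM {0..<n} (\<lambda>_. count_space UNIV) :: (nat \<Rightarrow> 'a) measure"
  let ?x = "\<lambda>n. restrict x {0..<n}"
  have x_sets [measurable]: "{?x n} \<in> sets (?P n)" for n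
  proof -
    have "{?x n} = (\<Pi>\<^sub>E t\<in>{0..<n}. {x t})"
      by (auto simp: PiE_iff extensional_def restrict_def fun_eq_iff)
    also have "\<dots> \<in> sets (?P n)"
      by (intro sets_PiM_I_finite) auto
    finally show ?thesis .
  qed
  have u0: "(\<lambda>_. undefined) \<in> space (?P 0)"
    by (simp add: space_PiM)
  have eP: "emeasure (IT.eP n \<omega>) {?x (Suc n)} =
      emeasure (srw_kernel G u n (?x n)) {x n} * indicator {?x n} \<omega>"
    if \<omega>: "\<omega> \<in> space (?P n)" for n \<omega>
  proof -
    have upd: "fun_upd \<omega> n y = ?x (Suc n) \<longleftrightarrow> \<omega> = ?x n \<and> y = x n" for y
    proof (intro iffI conjI)
      assume *: "fun_upd \<omega> n y = ?x (Suc n)"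
      have "\<omega> t = ?x n t" for t
        using fun_cong[OF *, of t] \<omega>
        by (cases "t = n") (auto simp: space_PiM PiE_iff extensional_def split: if_splits)
      then show "\<omega> = ?x n" by (rule ext)
      show "y = x n"
        using fun_cong[OF *, of n] by simp
    qed (auto simp: fun_eq_iff)
    have "fun_upd \<omega> n -` {?x (Suc n)} = {y. \<omega> = ?x n \<and> y = x n}"
      using upd by blast
    moreover have "emeasure (IT.eP n \<omega>) {?x (Suc n)} =
        emeasure (srw_kernel G u n \<omega>) (fun_upd \<omega> n -` {?x (Suc n)} \<inter> space (count_space UNIV))"
      using \<omega> by (rule IT.emeasure_eP) (rule x_sets)
    ultimately have "emeasure (IT.eP n \<omega>) {?x (Suc n)} =
        emeasure (srw_kernel G u n \<omega>) {y. \<omega> = ?x n \<and> y = x n}"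
      by simp
    then show ?thesis
      by (cases "\<omega> = ?x n") simp_all
  qed
  have C: "emeasure (IT.C 0 n (\<lambda>_. undefined)) {?x n} =
      (\<Prod>t<n. emeasure (srw_kernel G u t (?x t)) {x t})" for n
  proof (induction n)
    case 0
    show ?case
      using x_sets[of 0] by (simp add: emeasure_return restrict_def)
  next
    case (Suc n)
    have "emeasure (IT.C 0 (Suc n) (\<lambda>_. undefined)) {?x (Suc n)} =
        (\<integral>\<^sup>+ \<omega>. emeasure (IT.eP n \<omega>) {?x (Suc n)} \<partial>IT.C 0 n (\<lambda>_. undefined))"
      unfolding IT.C.simps add_0
    proof (rule emeasure_bind)
      show "space (IT.C 0 n (\<lambda>_. undefined)) \<noteq> {}"
        by (rule prob_space.not_empty[OF IT.prob_space_C[OF u0]])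
      show "IT.eP n \<in> measurable (IT.C 0 n (\<lambda>_. undefined)) (subprob_algebra (?P (Suc n)))"
        using IT.measurable_eP[of n] IT.sets_C[OF u0, of n] by (simp cong: measurable_cong_sets)
    qed (rule x_sets)
    also have "\<dots> = (\<integral>\<^sup>+ \<omega>. emeasure (srw_kernel G u n (?x n)) {x n} * indicator {?x n} \<omega>
        \<partial>IT.C 0 n (\<lambda>_. undefined))"
      by (intro nn_integral_cong eP) (simp add: IT.space_C[OF u0])
    also have "\<dots> = emeasure (srw_kernel G u n (?x n)) {x n} *
        emeasure (IT.C 0 n (\<lambda>_. undefined)) {?x n}"
      by (rule nn_integral_cmult_indicator) (simp add: IT.sets_C[OF u0] x_sets)
    finally show ?case
      by (simp only: Suc prod.lessThan_Suc mult.commute)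
  qed
  have "{\<omega>. \<forall>t\<le>k. \<omega> t = x t} = IT.PF.emb UNIV {0..<Suc k} {?x (Suc k)}"
    by (auto simp: prod_emb_def fun_eq_iff restrict_def less_Suc_eq_le split: if_splits)
  then have "emeasure (srw G u) {\<omega>. \<forall>t\<le>k. \<omega> t = x t} = emeasure (IT.CI {0..<Suc k}) {?x (Suc k)}"
    using IT.lim[of "{0..<Suc k}" "{?x (Suc k)}"] x_sets[of "Suc k"] by (simp only: srw_def finite_atLeastLessThan)
  also have "\<dots> = emeasure (IT.C 0 (Suc k) (\<lambda>_. undefined)) {?x (Suc k)}"
    using x_sets[of "Suc k"] by (subst IT.emeasure_CI[of _ "Suc k"]) (auto simp: prod_emb_id space_PiM PiE_def simp del: IT.C.simps)
  also have "\<dots> = (\<Prod>t<Suc k. emeasure (srw_kernel G u t (?x t)) {x t})"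
    by (rule C)
  also have "\<dots> = emeasure (srw_kernel G u 0 (?x 0)) {x 0} *
      (\<Prod>t<k. emeasure (srw_kernel G u (Suc t) (?x (Suc t))) {x (Suc t)})"
    by (rule prod.lessThan_Suc_shift)
  finally show ?thesis
    by (auto simp: srw_kernel_def emeasure_pmf_single indicator_def)
qed

text \<open>The infimum is \<open>\<infinity>\<close> on trajectories that never visit \<open>v\<close>.\<close>

definition first_hit :: "'a \<Rightarrow> (nat \<Rightarrow> 'a) \<Rightarrow> ennreal" where
  "first_hit v \<omega> = (INF t \<in> {t. \<omega> t = v}. of_nat t)"

definition hitting_time :: "'a pair_pre_digraph \<Rightarrow> 'a \<Rightarrow> 'a \<Rightarrow> ennreal" where
  "hitting_time G u v = (\<integral>\<^sup>+ \<omega>. first_hit v \<omega> \<partial>srw G u)"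

definition stationary :: "'a pair_pre_digraph \<Rightarrow> 'a \<Rightarrow> real" where
  "stationary G v = real (out_degree (with_proj G) v) / (2 * real (card (edges G)))"

definition meeting_time :: "'a pair_pre_digraph \<Rightarrow> 'a \<Rightarrow> ennreal" where
  "meeting_time G v = (\<Sum>u \<in> pverts G. ennreal (stationary G u) * hitting_time G u v)"

definition bestmeet :: "'a pair_pre_digraph \<Rightarrow> ennreal" where
  "bestmeet G = Min (meeting_time G ` pverts G)"

datatype broom_vertex = Spine nat | Left_Leaf nat | Right_Leaf nat

definition double_broom :: "nat \<Rightarrow> nat \<Rightarrow> nat \<Rightarrow> broom_vertex pair_pre_digraph" where
  "double_broom d l r =
     (let E = {(Spine i, Spine (i + 1)) | i. 1 \<le> i \<and> i + 1 \<le> d - 1}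
            \<union> {(Spine 1, Left_Leaf j) | j. j \<in> {1..l}}
            \<union> {(Spine (d - 1), Right_Leaf j) | j. j \<in> {1..r}}
      in \<lparr> pverts = Spine ` {1..d - 1} \<union> Left_Leaf ` {1..l} \<union> Right_Leaf ` {1..r},
           parcs = E \<union> E\<inverse> \<rparr>)"

definition balanced_double_broom :: "nat \<Rightarrow> nat \<Rightarrow> broom_vertex pair_pre_digraph" where
  "balanced_double_broom n d =
     double_broom d (nat \<lfloor>real (n - d + 1) / 2\<rfloor>) (nat \<lceil>real (n - d + 1) / 2\<rceil>)"

end

theory Submission
  imports Defs
begin

text \<open>
  Root a tree on \<open>n\<close> vertices at \<open>c\<close> and let \<open>s x\<close> be the size of the subtree at \<open>x\<close>. The walk needs
  \<open>2 s x - 1\<close> steps on average to pass from \<open>x\<close> to its parent, which leads to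
  \<open>H(\<pi>, c) = 1/2 + 2/(n - 1) \<Sum> s x (s x - 1)\<close>, the sum ranging over \<open>x \<noteq> c\<close>; it is minimal at a centroid,
  where \<open>s x \<le> n/2\<close> for all \<open>x \<noteq> c\<close>.

  At a centroid the sum is estimated level by level. Let \<open>k\<close> be the depth of the deepest vertex and \<open>m\<close>
  the depth of the deepest vertex in any other branch, so that \<open>k + m \<le> d\<close>. By convexity, level \<open>j\<close>
  contributes most if it contains only two vertices with children (one if \<open>m \<le> j\<close>) and all levels above
  it are as small as possible. Writing \<open>y\<close> for the number of vertices on one fixed side of an edge,
  the resulting bound is the sum of \<open>f(min y (n - y))\<close>, \<open>f(t) = t (t - 1)\<close>, over \<open>k + m - 2\<close> consecutive
  values of \<open>y\<close>; it is largest for \<open>d - 2\<close> values centred at \<open>n/2\<close>, which are the cuts of the spine of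
  the balanced double broom. Equality on all levels forces the shape of a double broom. Conversely, each
  spine edge of that broom contributes at least \<open>f(min y (n - y))\<close> to the sum for every choice of \<open>c\<close>.
\<close>

section \<open>Walks and trees\<close>

text \<open>The step count 2 s x - 1 is a return time: in the subtree at x enlarged by the edge to
  the parent, the parent is a leaf of a tree with s x edges, so its mean return time is 2 s x, and
  the first step of the excursion is forced. The degrees inside the subtree also add up to 2 s x -
  1, so the edge above x contributes (2 s x - 1)^2 / (2 (n - 1)) to H(\<pi>, c). Since (2 s - 1)^2 =
  1 + 4 s (s - 1), the n - 1 edges produce the constant 1/2. The sizes on level j add up to at most
  n + 1 - 2 j, because the root and the two arms occupy 2 j - 1 vertices above, and each is at most
  n div 2 + 1 - j. The extreme pair corresponds to the cuts n div 2 + 1 - j and n div 2 + j; this is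
  why consecutive values appear when j varies. The obstacle in the equality case is f(1) = 0: leaves
  are invisible in the sum. Their places are recovered from the same size budgets, which leave no
  room for a further vertex on a level that attains its bound. Moreover the best interval of cuts is
  unique only up to the reflection y to n - y, which exchanges the two ends of the broom.\<close>

lemma awalk_iff_relpow:
  assumes "pair_wf_digraph G"
  shows "(\<exists>p. pre_digraph.awalk (with_proj G) u p v \<and> length p = k) \<longleftrightarrow>
    u \<in> pverts G \<and> (u, v) \<in> parcs G ^^ k"
proof -
  interpret pair_wf_digraph G by fact
  show ?thesis
  proof (induction k arbitrary: u)
    case 0
    show ?case by (auto simp: awalk_Nil_iff)
  next
    case (Suc k)
    show ?case (is "?L \<longleftrightarrow> ?R")
    proof
      assume ?L
      then obtain e p where "awalk u (e # p) v" "length p = k"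
        by (auto simp: length_Suc_conv)
      then have "fst e = u" "e \<in> parcs G" "awalk (snd e) p v" "length p = k"
        by (simp_all add: awalk_Cons_iff)
      then have "(u, snd e) \<in> parcs G" "(snd e, v) \<in> parcs G ^^ k"
        using Suc[of "snd e"] by auto
      then show ?R
        using wellformed'(1) by (blast intro: relpow_Suc_I2)
    next
      assume R: ?R
      then obtain w where w: "(u, w) \<in> parcs G" "(w, v) \<in> parcs G ^^ k"
        by (blast elim: relpow_Suc_E2)
      then obtain p where "awalk w p v" "length p = k"
        using Suc[of w] wellformed'(2) by blast
      then have "awalk u ((u, w) # p) v \<and> length ((u, w) # p) = Suc k"
        using w R by (simp add: awalk_Cons_iff)
      then show ?L by blast
    qed
  qed
qed

lemma distance_eq_Least:
  assumes "pair_wf_digraph G" "u \<in> pverts G"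
  shows "distance G u v = (LEAST k. (u, v) \<in> parcs G ^^ k)"
  using assms by (simp add: distance_def awalk_iff_relpow)

lemma distance_le:
  assumes "pair_wf_digraph G" "u \<in> pverts G" "(u, v) \<in> parcs G ^^ k"
  shows "distance G u v \<le> k"
  using assms by (simp add: distance_eq_Least Least_le)

lemma relpow_distance:
  assumes "pair_wf_digraph G" "u \<in> pverts G" "(u, v) \<in> (parcs G)\<^sup>*"
  shows "(u, v) \<in> parcs G ^^ distance G u v"
  using assms rtrancl_imp_relpow[OF assms(3)] by (auto simp: distance_eq_Least intro: LeastI)

text \<open>Lower bounds on distances come from a potential that grows by at most 1 along every arc:
  signed depth in a rooted tree, position along the spine in a broom.\<close>

lemma relpow_Lipschitz:
  fixes f :: "'a \<Rightarrow> int"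
  assumes "\<And>x y. (x, y) \<in> E \<Longrightarrow> f y - f x \<le> 1" and "(u, v) \<in> E ^^ k"
  shows "f v - f u \<le> int k"
  using assms(2)
proof (induction k arbitrary: v)
  case (Suc k)
  then obtain w where "(u, w) \<in> E ^^ k" "(w, v) \<in> E"
    by auto
  then show ?case using Suc.IH[of w] assms(1)[of w v] by simp
qed simp

lemma connected_iff_rtrancl:
  assumes "pair_graph G"
  shows "Digraph_Component.connected (with_proj G) \<longleftrightarrow>
    pverts G \<noteq> {} \<and> (\<forall>u\<in>pverts G. \<forall>v\<in>pverts G. (u, v) \<in> (parcs G)\<^sup>*)"
proof -
  interpret pair_graph G by fact
  \<comment> \<open>The library defines connectedness through the symmetric closure, which changes
    nothing for a symmetric digraph.\<close>
  have "(\<Union>e\<in>parcs G. {(fst e, snd e), (snd e, fst e)}) = parcs G"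
    using arcs_symmetric by force
  then have "mk_symmetric (with_proj G) = G"
    by (simp add: mk_symmetric_def)
  moreover have "u \<rightarrow>\<^sup>*\<^bsub>with_proj G\<^esub> v \<longleftrightarrow> (u, v) \<in> (parcs G)\<^sup>*" if "u \<in> pverts G" for u v
    using that awalk_iff_relpow[OF pair_wf_digraph, of u v]
    by (auto simp: reachable_awalk rtrancl_is_UN_relpow)
  ultimately show ?thesis
    by (simp add: Digraph_Component.connected_def strongly_connected_def)
qed

text \<open>Closing a path that avoids an edge by this edge gives a cycle, and a cycle minus one
  edge is such a path. Both orientations are deleted, which keeps the remaining relation
  symmetric.\<close>

lemma no_cycle_iff_bridges:
  assumes "pair_graph G"
  shows "(\<exists>p. pre_digraph.cycle (with_proj G) p \<and> 3 \<le> length p) \<longleftrightarrow>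
    (\<exists>x y. (x, y) \<in> parcs G \<and> (x, y) \<in> (parcs G - {(x, y), (y, x)})\<^sup>*)"
proof -
  interpret pair_graph G by fact
  show ?thesis
  proof
    assume "\<exists>p. cycle p \<and> 3 \<le> length p"
    then obtain p u where p: "awalk u p u" "distinct (tl (pawalk_verts u p))" "3 \<le> length p"
      unfolding cycle_def by auto
    then obtain e p' where p': "p = e # p'"
      by (cases p) auto
    obtain w where e: "e = (u, w)" "(u, w) \<in> parcs G" and aw: "awalk w p' u"
      and dist: "distinct (pawalk_verts w p')"
      using p p' by (cases e) (auto simp: awalk_Cons_iff)
    \<comment> \<open>The rest \<open>p'\<close> of the cycle is a path from \<open>w\<close> to
      \<open>u\<close>. If it used the arc from \<open>w\<close> back to \<open>u\<close>, the
      pieces before and after that arc would be closed paths, hence empty, and the cycle would have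
      length 2.\<close>
    have "(w, u) \<notin> set p'"
    proof
      assume "(w, u) \<in> set p'"
      then obtain q r where qr: "p' = q @ (w, u) # r"
        using split_list[of "(w, u)" p'] by blast
      have aw': "awalk w q w" "awalk u r u"
        using aw qr by (auto simp: awalk_Cons_iff)
      have "apath w p' u" using aw dist by (simp add: apath_def)
      then have "apath w q w" "apath u r u"
        using qr by (auto simp: apath_append_iff apath_Cons_iff)
      then have "q = []" "r = []"
        by (auto dest: apath_nonempty_ends)
      then show False using qr p' p by simp
    qed
    moreover have "(u, w) \<notin> set p'"
    proof
      assume "(u, w) \<in> set p'"
      then obtain q r where qr: "p' = q @ (u, w) # r"
        using split_list[of "(u, w)" p'] by blast
      have "apath w p' u" using aw dist by (simp add: apath_def)
      then have "apath u ((u, w) # r) u"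
        using qr by (auto simp: apath_append_iff apath_Cons_iff)
      then show False
        by (auto dest: apath_nonempty_ends)
    qed
    ultimately have sub: "set p' \<subseteq> parcs G - {(u, w), (w, u)}"
      using aw by (auto simp: awalk_def)
    have "pcas a q b \<Longrightarrow> set q \<subseteq> R \<Longrightarrow> (a, b) \<in> R\<^sup>*" for a b q R
      by (induction q arbitrary: a) (auto intro: converse_rtrancl_into_rtrancl)
    then have "(w, u) \<in> (parcs G - {(u, w), (w, u)})\<^sup>*"
      using aw sub by (auto simp: awalk_def)
    then have "(w, u) \<in> (parcs G - {(w, u), (u, w)})\<^sup>*"
      by (simp add: insert_commute)
    then show "\<exists>x y. (x, y) \<in> parcs G \<and> (x, y) \<in> (parcs G - {(x, y), (y, x)})\<^sup>*"
      using e arcs_symmetric by blast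
  next
    assume "\<exists>x y. (x, y) \<in> parcs G \<and> (x, y) \<in> (parcs G - {(x, y), (y, x)})\<^sup>*"
    then obtain x y where xy: "(x, y) \<in> parcs G" "(x, y) \<in> (parcs G - {(x, y), (y, x)})\<^sup>*"
      by blast
    have "(a, b) \<in> R\<^sup>* \<Longrightarrow> R \<subseteq> parcs G \<Longrightarrow> a \<in> pverts G \<Longrightarrow> \<exists>p. awalk a p b \<and> set p \<subseteq> R" for a b R
    proof (induction rule: converse_rtrancl_induct)
      case base
      then show ?case by (auto intro!: exI[of _ "[]"] simp: awalk_Nil_iff)
    next
      case (step a a')
      then have "a' \<in> pverts G"
        using in_arcsD2[of a a'] by blast
      then obtain p where "awalk a' p b" "set p \<subseteq> R"
        using step by blast
      with step show ?case
        by (intro exI[of _ "(a, a') # p"]) (auto simp: awalk_Cons_iff)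
    qed
    then obtain p0 where "awalk x p0 y" "set p0 \<subseteq> parcs G - {(x, y), (y, x)}"
      using xy in_arcsD1[OF xy(1)] by blast
    then obtain p where p: "apath x p y" "set p \<subseteq> parcs G - {(x, y), (y, x)}"
      using awalk_to_apath_subset[of x p0 y] apath_awalk_to_apath[of x p0 y] by blast
    have "x \<noteq> y" using xy no_loops' by blast
    have "p \<noteq> []" using p \<open>x \<noteq> y\<close> by (auto simp: apath_Nil_iff)
    \<comment> \<open>A path of length 1 would be the deleted arc itself; so the cycle closed up
      below has length at least 3.\<close>
    moreover have "length p \<noteq> 1"
      using p by (auto simp: length_Suc_conv apath_Cons_iff apath_Nil_iff)
    ultimately have "2 \<le> length p"
      by (cases p) (auto simp: Suc_le_eq)
    moreover have "cycle ((y, x) # p)"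
      unfolding cycle_def using p xy arcs_symmetric
      by (auto simp: awalk_Cons_iff apath_def intro!: exI[of _ y])
    ultimately show "\<exists>p. cycle p \<and> 3 \<le> length p"
      by (intro exI[of _ "(y, x) # p"]) auto
  qed
qed

lemma is_tree_iff:
  "is_tree G \<longleftrightarrow> pair_graph G \<and> pverts G \<noteq> {} \<and>
     (\<forall>u\<in>pverts G. \<forall>v\<in>pverts G. (u, v) \<in> (parcs G)\<^sup>*) \<and>
     (\<forall>x y. (x, y) \<in> parcs G \<longrightarrow> (x, y) \<notin> (parcs G - {(x, y), (y, x)})\<^sup>*)"
  unfolding is_tree_def using connected_iff_rtrancl[of G] no_cycle_iff_bridges[of G] by blast

text \<open>In a pair digraph an arc is its pair of end points, so the arc part of a library
  isomorphism is determined by its vertex part.\<close>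

lemma isomorphic_iff:
  assumes "pair_graph G" "pair_graph H"
  shows "isomorphic G H \<longleftrightarrow> (\<exists>f. bij_betw f (pverts G) (pverts H) \<and>
    (\<forall>x\<in>pverts G. \<forall>y\<in>pverts G. (x, y) \<in> parcs G \<longleftrightarrow> (f x, f y) \<in> parcs H))"
proof -
  interpret G: pair_graph G by fact
  interpret H: pair_graph H by fact
  show ?thesis
  proof
    assume "isomorphic G H"
    then obtain h where h: "G.digraph_isomorphism h" and H: "with_proj H = app_iso h (with_proj G)"
      by (auto simp: isomorphic_def digraph_iso_def)
    define f where "f = iso_verts h"
    have inj: "inj_on f (pverts G)"
      using h by (simp add: G.digraph_isomorphism_def f_def)
    have V: "pverts H = f ` pverts G"
      using arg_cong[OF H, of verts] by (simp add: f_def)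
    have "iso_tail h = fst" "iso_head h = snd"
      using arg_cong[OF H, of tail] arg_cong[OF H, of head] by simp_all
    then have "iso_arcs h a = (f (fst a), f (snd a))" if "a \<in> parcs G" for a
      using h that by (simp add: G.digraph_isomorphism_def f_def prod_eq_iff)
    then have E: "parcs H = (\<lambda>a. (f (fst a), f (snd a))) ` parcs G"
      using arg_cong[OF H, of arcs] by (auto simp: image_iff)
    show "\<exists>f. bij_betw f (pverts G) (pverts H) \<and>
      (\<forall>x\<in>pverts G. \<forall>y\<in>pverts G. (x, y) \<in> parcs G \<longleftrightarrow> (f x, f y) \<in> parcs H)"
      using inj V E G.wellformed'
      by (intro exI[of _ f]) (auto simp: bij_betw_def inj_on_eq_iff image_iff Bex_def)
  next
    assume "\<exists>f. bij_betw f (pverts G) (pverts H) \<and>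
      (\<forall>x\<in>pverts G. \<forall>y\<in>pverts G. (x, y) \<in> parcs G \<longleftrightarrow> (f x, f y) \<in> parcs H)"
    then obtain f where f: "inj_on f (pverts G)" "f ` pverts G = pverts H"
      and E: "\<And>x y. x \<in> pverts G \<Longrightarrow> y \<in> pverts G \<Longrightarrow> (x, y) \<in> parcs G \<longleftrightarrow> (f x, f y) \<in> parcs H"
      by (auto simp: bij_betw_def)
    define h where "h = \<lparr>iso_verts = f, iso_arcs = map_prod f f, iso_head = snd, iso_tail = fst\<rparr>"
    have "inj_on (map_prod f f) (parcs G)"
      by (rule inj_on_subset[OF map_prod_inj_on[OF f(1) f(1)]]) (auto dest: G.wellformed')
    then have iso: "G.digraph_isomorphism h"
      using f by (auto simp: G.digraph_isomorphism_def h_def intro: G.wf_digraph_axioms)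
    have "parcs H \<subseteq> map_prod f f ` parcs G"
    proof
      fix e assume e: "e \<in> parcs H"
      then obtain x y where "x \<in> pverts G" "y \<in> pverts G" "e = (f x, f y)"
        using H.wellformed' f by (cases e) blast
      with e E show "e \<in> map_prod f f ` parcs G" by force
    qed
    moreover have "map_prod f f a \<in> parcs H" if "a \<in> parcs G" for a
      using E[of "fst a" "snd a"] that G.arc_fst_in_verts[OF that] G.arc_snd_in_verts[OF that]
      by (cases a) simp
    ultimately have "map_prod f f ` parcs G = parcs H"
      by (intro equalityI image_subsetI)
    then have "with_proj H = app_iso h (with_proj G)"
      using f by (simp add: with_proj_def app_iso_def h_def)
    then show "isomorphic G H"
      using iso by (auto simp: isomorphic_def digraph_iso_def)
  qed
qed

section \<open>Rooted trees\<close>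

text \<open>The arcs are exactly the parent links in both directions; connectedness and acyclicity
  follow. \<open>dep\<close> is what makes the iteration of \<open>par\<close> end at
  \<open>c\<close>, while \<open>par c\<close> and all values outside the vertices are left
  open.\<close>

locale rooted_tree =
  fixes T :: "'a pair_pre_digraph" and c :: 'a and par :: "'a \<Rightarrow> 'a" and dep :: "'a \<Rightarrow> nat"
  assumes finite_verts: "finite (pverts T)"
    and root_in: "c \<in> pverts T"
    and par_in: "\<And>x. x \<in> pverts T \<Longrightarrow> x \<noteq> c \<Longrightarrow> par x \<in> pverts T"
    and dep_par: "\<And>x. x \<in> pverts T \<Longrightarrow> x \<noteq> c \<Longrightarrow> dep x = Suc (dep (par x))"
    and dep_root: "dep c = 0"
    and arcs_iff: "\<And>x y. (x, y) \<in> parcs T \<longleftrightarrow>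
      x \<in> pverts T \<and> x \<noteq> c \<and> y = par x \<or> y \<in> pverts T \<and> y \<noteq> c \<and> x = par y"
begin

lemma dep_eq_0_iff: "x \<in> pverts T \<Longrightarrow> dep x = 0 \<longleftrightarrow> x = c"
  using dep_par dep_root by fastforce

text \<open>The depths fix how often \<open>par\<close> is iterated, so being a descendant is an
  equation and not an existential statement. The comparison of depths guards against truncated
  subtraction.\<close>

definition desc :: "'a \<Rightarrow> 'a set" where
  "desc u = {z \<in> pverts T. dep u \<le> dep z \<and> (par ^^ (dep z - dep u)) z = u}"

definition sz :: "'a \<Rightarrow> nat" where
  "sz u = card (desc u)"

definition children :: "'a \<Rightarrow> 'a set" where
  "children u = {x \<in> pverts T. x \<noteq> c \<and> par x = u}"

lemma par_neq: "x \<in> pverts T \<Longrightarrow> x \<noteq> c \<Longrightarrow> par x \<noteq> x"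
  using dep_par by (metis n_not_Suc_n)

lemma funpow_par:
  assumes "x \<in> pverts T" "k \<le> dep x"
  shows "(par ^^ k) x \<in> pverts T" "dep ((par ^^ k) x) = dep x - k"
proof -
  have "(par ^^ k) x \<in> pverts T \<and> dep ((par ^^ k) x) = dep x - k"
    using assms(2)
  proof (induction k)
    case (Suc k)
    then have *: "(par ^^ k) x \<in> pverts T" "dep ((par ^^ k) x) = dep x - k"
      by simp_all
    then have "(par ^^ k) x \<noteq> c"
      using Suc dep_root by auto
    then show ?case
      using * par_in dep_par[of "(par ^^ k) x"] by simp
  qed (use assms in simp)
  then show "(par ^^ k) x \<in> pverts T" "dep ((par ^^ k) x) = dep x - k"
    by simp_all
qed

lemma desc_subset: "desc u \<subseteq> pverts T"
  by (auto simp: desc_def)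

lemma finite_desc [simp]: "finite (desc u)"
  using finite_subset[OF desc_subset finite_verts] .

lemma in_desc_self: "u \<in> pverts T \<Longrightarrow> u \<in> desc u"
  by (simp add: desc_def)

lemma desc_dep: "z \<in> desc u \<Longrightarrow> dep u \<le> dep z"
  by (simp add: desc_def)

lemma desc_same_dep: "z \<in> desc u \<Longrightarrow> dep z = dep u \<Longrightarrow> z = u"
  by (simp add: desc_def)

lemma in_desc_iff:
  assumes "z \<in> pverts T" "z \<noteq> c" "u \<in> pverts T"
  shows "z \<in> desc u \<longleftrightarrow> z = u \<or> par z \<in> desc u"
proof (cases "dep u < dep z")
  case True
  then have "dep z - dep u = Suc (dep (par z) - dep u)"
    using dep_par[OF assms(1,2)] by simp
  then have "(par ^^ (dep z - dep u)) z = (par ^^ (dep (par z) - dep u)) (par z)"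
    by (simp add: funpow_swap1)
  moreover have "dep u \<le> dep z" "dep u \<le> dep (par z)" "z \<noteq> u"
    using True dep_par[OF assms(1,2)] by auto
  ultimately show ?thesis
    using assms(1) par_in[OF assms(1,2)] by (simp only: desc_def mem_Collect_eq simp_thms)
next
  case False
  then have "\<not> dep u \<le> dep (par z)"
    using dep_par[OF assms(1,2)] by simp
  then show ?thesis
    using assms(1) False unfolding desc_def by auto
qed

lemma root_in_desc_iff: "u \<in> pverts T \<Longrightarrow> c \<in> desc u \<longleftrightarrow> u = c"
  using dep_eq_0_iff[of u] root_in by (auto simp: desc_def dep_root)

lemma desc_root: "desc c = pverts T"
proof -
  have "(par ^^ dep z) z = c" if "z \<in> pverts T" for z
    using funpow_par[OF that, of "dep z"] dep_eq_0_iff by simp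
  then show ?thesis
    by (auto simp: desc_def dep_root)
qed

lemma sz_root: "sz c = card (pverts T)"
  by (simp add: sz_def desc_root)

lemma sz_pos: "u \<in> pverts T \<Longrightarrow> 0 < sz u"
  using in_desc_self by (auto simp: sz_def card_gt_0_iff)

lemma desc_disjoint:
  assumes "dep x = dep y" "x \<noteq> y"
  shows "desc x \<inter> desc y = {}"
  using assms by (auto simp: desc_def)

lemma desc_trans:
  assumes "y \<in> desc x" "x \<in> pverts T"
  shows "desc y \<subseteq> desc x"
proof
  fix z assume "z \<in> desc y"
  then show "z \<in> desc x"
  proof (induction "dep z" arbitrary: z rule: less_induct)
    case less
    have y: "y \<in> pverts T" using assms desc_subset by blast
    have z: "z \<in> pverts T" using less desc_subset by blast
    show ?case
    proof (cases "z = y")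
      case False
      then have "z \<noteq> c"
        using less root_in_desc_iff y by blast
      then have "par z \<in> desc y"
        using less False in_desc_iff z y by blast
      then have "par z \<in> desc x"
        using less dep_par[OF z \<open>z \<noteq> c\<close>] by simp
      then show ?thesis
        using in_desc_iff z \<open>z \<noteq> c\<close> assms by blast
    qed (use assms in simp)
  qed
qed

lemma finite_children [simp]: "finite (children u)"
  using finite_verts by (simp add: children_def)

lemma children_in: "w \<in> children u \<Longrightarrow> w \<in> pverts T \<and> w \<noteq> c \<and> par w = u \<and> dep w = Suc (dep u)"
  using dep_par by (auto simp: children_def)

lemma parent_in: "w \<in> children u \<Longrightarrow> u \<in> pverts T"
  using par_in by (auto simp: children_def)

lemma desc_eq:
  assumes "u \<in> pverts T"
  shows "desc u = insert u (\<Union>w\<in>children u. desc w)"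
proof (intro equalityI subsetI)
  fix z assume z: "z \<in> desc u"
  show "z \<in> insert u (\<Union>w\<in>children u. desc w)"
  proof (cases "z = u")
    case False
    have zV: "z \<in> pverts T" using z desc_subset by blast
    have lt: "dep u < dep z"
      using z False desc_dep desc_same_dep by (metis le_neq_implies_less)
    \<comment> \<open>\<open>w\<close> will be the ancestor of \<open>z\<close> one level below
      \<open>u\<close>, hence the child whose subtree contains \<open>z\<close>.\<close>
    define k where "k = dep z - dep u - 1"
    define w where "w = (par ^^ k) z"
    have k: "dep z - dep u = Suc k" "k \<le> dep z"
      using lt by (auto simp: k_def)
    have w: "w \<in> pverts T" "dep w = Suc (dep u)"
      using funpow_par[OF zV k(2)] lt k by (auto simp: w_def)
    have "par w = u"
      using z k by (simp add: desc_def w_def)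
    then have "w \<in> children u"
      using w dep_root by (auto simp: children_def)
    moreover have "z \<in> desc w"
      using zV lt w by (auto simp: desc_def k_def w_def)
    ultimately show ?thesis by blast
  qed simp
next
  fix z assume "z \<in> insert u (\<Union>w\<in>children u. desc w)"
  then show "z \<in> desc u"
  proof
    assume "z \<in> (\<Union>w\<in>children u. desc w)"
    then obtain w where w: "w \<in> children u" "z \<in> desc w" by blast
    then have "w \<in> desc u"
      using children_in in_desc_iff assms in_desc_self by blast
    then show ?thesis
      using desc_trans[OF _ assms] w by blast
  qed (use in_desc_self assms in simp)
qed

lemma sz_eq:
  assumes "u \<in> pverts T"
  shows "sz u = Suc (\<Sum>w\<in>children u. sz w)"
proof -
  have "u \<notin> (\<Union>w\<in>children u. desc w)"
  proof
    assume "u \<in> (\<Union>w\<in>children u. desc w)"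
    then obtain w where "w \<in> children u" "u \<in> desc w" by blast
    then show False using desc_dep[of u w] children_in[of w u] by simp
  qed
  moreover have "card (\<Union>w\<in>children u. desc w) = (\<Sum>w\<in>children u. sz w)"
    unfolding sz_def
  proof (rule card_UN_disjoint)
    show "\<forall>i\<in>children u. \<forall>j\<in>children u. i \<noteq> j \<longrightarrow> desc i \<inter> desc j = {}"
      using desc_disjoint children_in by metis
  qed auto
  ultimately show ?thesis
    by (simp add: sz_def desc_eq[OF assms] card_insert_disjoint del: card_insert_if)
qed

lemma sz_par_less:
  assumes "x \<in> pverts T" "x \<noteq> c"
  shows "sz x < sz (par x)"
proof -
  have "x \<in> children (par x)"
    using assms by (simp add: children_def)
  then have "sz x \<le> (\<Sum>w\<in>children (par x). sz w)"
    by (intro member_le_sum) auto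
  then show ?thesis
    using sz_eq[OF par_in[OF assms]] by simp
qed

lemma children_empty_iff:
  assumes "u \<in> pverts T"
  shows "children u = {} \<longleftrightarrow> sz u = 1"
proof -
  have "w \<in> children u \<Longrightarrow> sz w \<noteq> 0" for w
    using sz_pos children_in by fastforce
  then show ?thesis
    using sz_eq[OF assms] by auto
qed

lemma nbrs_eq:
  assumes "u \<in> pverts T"
  shows "{w. (u, w) \<in> parcs T} = (if u = c then children u else insert (par u) (children u))"
  using assms by (auto simp: arcs_iff children_def)

lemma par_notin_children: "u \<in> pverts T \<Longrightarrow> u \<noteq> c \<Longrightarrow> par u \<notin> children u"
  using children_in dep_par by fastforce

lemma pair_graph: "pair_graph T"
proof -
  have fin: "finite (parcs T)"
    by (rule finite_subset[of _ "pverts T \<times> pverts T"])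
      (use par_in in \<open>auto simp: arcs_iff finite_verts\<close>)
  show ?thesis
  proof
    fix e assume e: "e \<in> parcs T"
    obtain x y where [simp]: "e = (x, y)" by (cases e)
    show "fst e \<in> pverts T" "snd e \<in> pverts T" "fst e \<noteq> snd e"
      using e arcs_iff[of x y] par_in[of x] par_in[of y] par_neq[of x] par_neq[of y] by auto
  next
    show "symmetric (with_proj T)"
      unfolding symmetric_def by (auto simp: arcs_iff sym_def)
  qed (use fin finite_verts in auto)
qed

lemma rtrancl_root:
  assumes "x \<in> pverts T"
  shows "(x, c) \<in> {(y, par y) | y. y \<in> pverts T \<and> y \<noteq> c}\<^sup>*"
  using assms
proof (induction "dep x" arbitrary: x rule: less_induct)
  case less
  show ?case
  proof (cases "x = c")
    case False
    then have "(par x, c) \<in> {(y, par y) | y. y \<in> pverts T \<and> y \<noteq> c}\<^sup>*"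
      using less dep_par par_in by simp
    then show ?thesis
      using False less by (auto intro: converse_rtrancl_into_rtrancl)
  qed simp
qed

text \<open>This describes subtrees in a way that depends on the root only through the orientation
  of one edge. It allows subtrees to be compared under two rootings and to be bounded in a broom
  rooted anywhere.\<close>

lemma desc_eq_component:
  assumes x: "x \<in> pverts T" "x \<noteq> c"
  shows "desc x = {z. (x, z) \<in> (parcs T - {(x, par x), (par x, x)})\<^sup>*}" (is "_ = ?C")
proof (intro equalityI subsetI)
  fix z assume "z \<in> desc x"
  then show "z \<in> ?C"
  proof (induction "dep z" arbitrary: z rule: less_induct)
    case less
    have z: "z \<in> pverts T" using less desc_subset by blast
    show ?case
    proof (cases "z = x")
      case False
      then have "z \<noteq> c"
        using less root_in_desc_iff x by blast
      then have pz: "par z \<in> desc x"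
        using less False in_desc_iff z x by blast
      then have "(x, par z) \<in> (parcs T - {(x, par x), (par x, x)})\<^sup>*"
        using less dep_par[OF z \<open>z \<noteq> c\<close>] by simp
      moreover have "(par z, z) \<in> parcs T"
        using z \<open>z \<noteq> c\<close> arcs_iff by blast
      moreover have "par z \<noteq> x \<or> z \<noteq> par x"
        using par_notin_children[OF x] z \<open>z \<noteq> c\<close> by (auto simp: children_def)
      ultimately show ?thesis
        using False by (auto intro: rtrancl_into_rtrancl)
    qed simp
  qed
next
  fix z assume "z \<in> ?C"
  then have "(x, z) \<in> (parcs T - {(x, par x), (par x, x)})\<^sup>*" by simp
  then show "z \<in> desc x"
  proof (induction rule: rtrancl_induct)
    case base
    show ?case using in_desc_self x by simp
  next
    case (step y z)
    have y: "y \<in> pverts T" using step desc_subset by blast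
    from step consider "y \<noteq> c" "z = par y" | "z \<in> pverts T" "z \<noteq> c" "y = par z"
      using arcs_iff by blast
    then show ?case
    proof cases
      case 1
      then show ?thesis using step in_desc_iff[OF y _ x(1)] by blast
    next
      case 2
      then show ?thesis using step in_desc_iff[of z x] x by blast
    qed
  qed
qed

text \<open>Every arc is a parent link, and the component left below it after its deletion is a
  subtree, which does not contain the parent. With an explicit rooting this is how brooms are seen
  to be trees.\<close>

lemma is_tree: "is_tree T"
  unfolding is_tree_iff
proof (intro conjI ballI allI impI)
  show "pair_graph T" by (rule pair_graph)
  show "pverts T \<noteq> {}" using root_in by blast
next
  fix u v assume uv: "u \<in> pverts T" "v \<in> pverts T"
  have sub: "{(y, par y) | y. y \<in> pverts T \<and> y \<noteq> c} \<subseteq> parcs T"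
    by (auto simp: arcs_iff)
  have "(u, c) \<in> (parcs T)\<^sup>*" "(v, c) \<in> (parcs T)\<^sup>*"
    using rtrancl_root uv rtrancl_mono[OF sub] by blast+
  moreover have "sym (parcs T)"
    by (auto simp: sym_def arcs_iff)
  ultimately show "(u, v) \<in> (parcs T)\<^sup>*"
    by (meson rtrancl_trans sym_rtrancl symE)
next
  fix x y assume xy: "(x, y) \<in> parcs T"
  have neg: "(u, par u) \<notin> (parcs T - {(u, par u), (par u, u)})\<^sup>*" if "u \<in> pverts T" "u \<noteq> c" for u
    using desc_eq_component[OF that] desc_dep[of "par u" u] dep_par[OF that] by auto
  have s: "sym (parcs T - {(x, y), (y, x)})"
    by (auto simp: sym_def arcs_iff)
  show "(x, y) \<notin> (parcs T - {(x, y), (y, x)})\<^sup>*"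
  proof
    assume *: "(x, y) \<in> (parcs T - {(x, y), (y, x)})\<^sup>*"
    then have **: "(y, x) \<in> (parcs T - {(y, x), (x, y)})\<^sup>*"
      using sym_rtrancl[OF s] by (auto simp: sym_def insert_commute)
    show False
      using xy * ** neg[of x] neg[of y] by (auto simp: arcs_iff)
  qed
qed

end

text \<open>Depth is the distance to \<open>c\<close>, and the parent is a neighbour that is closer
  by one.\<close>

lemma rooting_exists:
  assumes tree: "is_tree T" and c: "c \<in> pverts T"
  obtains par dep where "rooted_tree T c par dep"
proof -
  interpret pair_graph T using tree by (simp add: is_tree_iff)
  have conn: "(u, v) \<in> (parcs T)\<^sup>*" if "u \<in> pverts T" "v \<in> pverts T" for u v
    using tree that by (simp add: is_tree_iff)
  have bridge: "(x, y) \<notin> (parcs T - {(x, y), (y, x)})\<^sup>*" if "(x, y) \<in> parcs T" for x y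
    using tree that by (simp add: is_tree_iff)
  define dep where "dep x = distance T x c" for x
  have ex: "\<exists>y. (x, y) \<in> parcs T \<and> dep x = Suc (dep y)" if x: "x \<in> pverts T" "x \<noteq> c" for x
  proof -
    have pw: "(x, c) \<in> parcs T ^^ dep x"
      unfolding dep_def using relpow_distance[OF pair_wf_digraph x(1) conn[OF x(1) c]] .
    with x obtain k where k: "dep x = Suc k"
      by (cases "dep x") auto
    then obtain y where y: "(x, y) \<in> parcs T" "(y, c) \<in> parcs T ^^ k"
      using pw relpow_Suc_D2 by metis
    have yV: "y \<in> pverts T" using y wellformed' by blast
    have "dep y \<le> k"
      unfolding dep_def using distance_le[OF pair_wf_digraph yV y(2)] .
    moreover have "dep x \<le> Suc (dep y)"
      unfolding dep_def
      by (intro distance_le[OF pair_wf_digraph x(1)] relpow_Suc_I2[OF y(1)]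
          relpow_distance[OF pair_wf_digraph yV conn[OF yV c]])
    ultimately show ?thesis using k y by auto
  qed
  define par where "par x = (SOME y. (x, y) \<in> parcs T \<and> dep x = Suc (dep y))" for x
  have par: "(x, par x) \<in> parcs T" "dep x = Suc (dep (par x))" if "x \<in> pverts T" "x \<noteq> c" for x
    using someI_ex[OF ex[OF that]] by (simp_all add: par_def)
  have dep_c: "dep c = 0"
    using distance_le[OF pair_wf_digraph c, of c 0] by (simp add: dep_def)
  \<comment> \<open>If an arc were no parent link, all paths along parents would avoid it. Both its
    ends would then still reach \<open>c\<close> after its deletion, and it would not be a
    bridge.\<close>
  have "x \<noteq> c \<and> y = par x \<or> y \<noteq> c \<and> x = par y" if xy: "(x, y) \<in> parcs T" for x y
  proof (rule ccontr)
    assume neg: "\<not> (x \<noteq> c \<and> y = par x \<or> y \<noteq> c \<and> x = par y)"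
    define R where "R = parcs T - {(x, y), (y, x)}"
    have "(z, c) \<in> R\<^sup>*" if "z \<in> pverts T" for z
      using that
    proof (induction "dep z" arbitrary: z rule: less_induct)
      case less
      show ?case
      proof (cases "z = c")
        case False
        then have "(par z, c) \<in> R\<^sup>*"
          using less par[of z] wellformed' by auto
        moreover have "(z, par z) \<in> R"
          using neg False par[of z] less by (auto simp: R_def)
        ultimately show ?thesis by (rule converse_rtrancl_into_rtrancl[rotated])
      qed simp
    qed
    then have "(x, c) \<in> R\<^sup>*" "(y, c) \<in> R\<^sup>*"
      using xy wellformed' by blast+
    moreover have "sym R"
      using arcs_symmetric by (auto simp: R_def sym_def)
    ultimately have "(x, y) \<in> R\<^sup>*"
      by (meson rtrancl_trans sym_rtrancl symE)
    then show False using bridge[OF xy] by (simp add: R_def)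
  qed
  then have arcs: "(x, y) \<in> parcs T \<longleftrightarrow>
      x \<in> pverts T \<and> x \<noteq> c \<and> y = par x \<or> y \<in> pverts T \<and> y \<noteq> c \<and> x = par y" for x y
    using par(1) arcs_symmetric wellformed' by blast
  have "rooted_tree T c par dep"
  proof
    show "finite (pverts T)" by (rule pair_finite_verts)
    show "c \<in> pverts T" "dep c = 0" by fact+
    show "par x \<in> pverts T" if "x \<in> pverts T" "x \<noteq> c" for x
      using par(1)[OF that] by (rule in_arcsD2)
    show "dep x = Suc (dep (par x))" if "x \<in> pverts T" "x \<noteq> c" for x
      using par(2)[OF that] .
  qed (rule arcs)
  then show ?thesis by (rule that)
qed

section \<open>Hitting times of the random walk\<close>

definition step_prob :: "'a pair_pre_digraph \<Rightarrow> 'a \<Rightarrow> 'a \<Rightarrow> real" where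
  "step_prob G x y = pmf (pmf_of_set {w. (x, w) \<in> parcs G}) y"

text \<open>The transition operator of the walk killed outside \<open>S\<close>: for a start in
  \<open>S\<close>, its k-th iterate applied to the constant 1 is the probability of being in
  \<open>S\<close> at all times up to k.\<close>

definition step_on :: "'a pair_pre_digraph \<Rightarrow> 'a set \<Rightarrow> ('a \<Rightarrow> real) \<Rightarrow> 'a \<Rightarrow> real" where
  "step_on G S f x = (\<Sum>y\<in>S. step_prob G x y * f y)"

lemma step_prob_nonneg: "0 \<le> step_prob G x y"
  by (simp add: step_prob_def)

lemma step_on_mono: "(\<And>y. y \<in> S \<Longrightarrow> f y \<le> g y) \<Longrightarrow> step_on G S f x \<le> step_on G S g x"
  unfolding step_on_def by (intro sum_mono mult_left_mono step_prob_nonneg)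

lemma step_on_cong: "(\<And>y. y \<in> S \<Longrightarrow> f y = g y) \<Longrightarrow> step_on G S f x = step_on G S g x"
  unfolding step_on_def by (intro sum.cong) auto

lemma step_on_iter_cong:
  "(\<And>y. y \<in> S \<Longrightarrow> f y = g y) \<Longrightarrow> x \<in> S \<Longrightarrow> (step_on G S ^^ k) f x = (step_on G S ^^ k) g x"
proof (induction k arbitrary: x)
  case (Suc k)
  then show ?case by (auto intro: step_on_cong)
qed simp

lemma step_on_iter_mono:
  "(\<And>y. y \<in> S \<Longrightarrow> f y \<le> g y) \<Longrightarrow> x \<in> S \<Longrightarrow> (step_on G S ^^ k) f x \<le> (step_on G S ^^ k) g x"
proof (induction k arbitrary: x)
  case (Suc k)
  then show ?case by (auto intro: step_on_mono)
qed simp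

lemma step_on_add: "step_on G S (\<lambda>y. f y + g y) x = step_on G S f x + step_on G S g x"
  by (simp add: step_on_def algebra_simps sum.distrib)

lemma step_on_iter_add:
  "(step_on G S ^^ k) (\<lambda>y. f y + g y) = (\<lambda>x. (step_on G S ^^ k) f x + (step_on G S ^^ k) g x)"
  by (induction k) (auto simp: step_on_add)

lemma step_on_iter_cmult:
  "(step_on G S ^^ k) (\<lambda>y. a * f y) = (\<lambda>x. a * (step_on G S ^^ k) f x)"
proof (induction k)
  case (Suc k)
  have "step_on G S (\<lambda>x. a * (step_on G S ^^ k) f x) = (\<lambda>x. a * step_on G S ((step_on G S ^^ k) f) x)"
    by (auto simp: step_on_def sum_distrib_left algebra_simps)
  then show ?case using Suc by simp
qed simp

lemma step_on_iter_nonneg: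
  assumes "\<And>y. y \<in> S \<Longrightarrow> 0 \<le> f y" "x \<in> S"
  shows "0 \<le> (step_on G S ^^ k) f x"
  using assms
proof (induction k arbitrary: x)
  case (Suc k)
  then show ?case
    by (auto simp: step_on_def intro!: sum_nonneg mult_nonneg_nonneg step_prob_nonneg)
qed simp

lemma sum_PiE_insert:
  assumes "i \<notin> I"
  shows "(\<Sum>x\<in>PiE (insert i I) (\<lambda>_. S). F x) = (\<Sum>x\<in>PiE I (\<lambda>_. S). \<Sum>y\<in>S. F (x(i := y)))"
proof -
  have "(\<Sum>x\<in>PiE (insert i I) (\<lambda>_. S). F x) = (\<Sum>(y, x)\<in>S \<times> PiE I (\<lambda>_. S). F (x(i := y)))"
    unfolding PiE_insert_eq
    by (subst sum.reindex[OF inj_combinator[OF assms]]) (simp add: case_prod_unfold)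
  also have "\<dots> = (\<Sum>y\<in>S. \<Sum>x\<in>PiE I (\<lambda>_. S). F (x(i := y)))"
    by (rule sum.cartesian_product[symmetric])
  finally show ?thesis by (simp add: sum.swap[of _ S])
qed

text \<open>Summing out the last position turns the weight \<open>f\<close> into
  \<open>step_on G S f\<close> one time unit earlier; therefore \<open>f\<close> is general in the
  induction.\<close>

lemma sum_trajectories:
  assumes "finite S"
  shows "(\<Sum>x\<in>PiE {..k} (\<lambda>_. S). (if x 0 = u then \<Prod>t<k. step_prob G (x t) (x (Suc t)) else 0) * f (x k)) =
    (if u \<in> S then (step_on G S ^^ k) f u else 0)"
proof (induction k arbitrary: f)
  case 0
  have "{..0::nat} = insert 0 {}" by auto
  then show ?case
    using assms by (simp add: sum_PiE_insert if_distrib if_distribR sum.delta cong: if_cong)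
  next
  case (Suc k)
  have "(\<Sum>x\<in>PiE {..Suc k} (\<lambda>_. S). (if x 0 = u then \<Prod>t<Suc k. step_prob G (x t) (x (Suc t)) else 0)
      * f (x (Suc k)))
    = (\<Sum>x\<in>PiE {..k} (\<lambda>_. S). \<Sum>y\<in>S. (if x 0 = u then
        (\<Prod>t<k. step_prob G (x t) (x (Suc t))) * step_prob G (x k) y else 0) * f y)"
  proof -
    have "(\<Prod>t<k. step_prob G ((x(Suc k := y)) t) ((x(Suc k := y)) (Suc t))) =
        (\<Prod>t<k. step_prob G (x t) (x (Suc t)))" for x y
      by (intro prod.cong) auto
    then show ?thesis
      unfolding atMost_Suc by (subst sum_PiE_insert) (simp_all cong: if_cong)
  qed
  also have "\<dots> = (\<Sum>x\<in>PiE {..k} (\<lambda>_. S).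
      (if x 0 = u then \<Prod>t<k. step_prob G (x t) (x (Suc t)) else 0) * step_on G S f (x k))"
    by (intro sum.cong refl) (auto simp: step_on_def sum_distrib_left mult.assoc)
  also have "\<dots> = (if u \<in> S then (step_on G S ^^ k) (step_on G S f) u else 0)"
    by (rule Suc)
  finally show ?case
    by (simp add: funpow_swap1)
qed

section \<open>Probabilities of staying in a set and of avoiding a vertex\<close>

lemma sets_srw: "sets (srw G u) = sets (PiM UNIV (\<lambda>_. count_space UNIV))"
proof -
  interpret IT: Ionescu_Tulcea "srw_kernel G u" "\<lambda>_. count_space UNIV"
    by (rule Ionescu_Tulcea_srw)
  show ?thesis
    unfolding srw_def by (rule IT.PF.sets_lim)
qed

text \<open>The whole space is the preimage under the projection to the empty index set, and the
  finite-dimensional law there is a probability measure.\<close>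

lemma emeasure_srw_space: "emeasure (srw G u) (space (srw G u)) = 1"
proof -
  interpret IT: Ionescu_Tulcea "srw_kernel G u" "\<lambda>_. count_space UNIV"
    by (rule Ionescu_Tulcea_srw)
  let ?X = "space (PiM {} (\<lambda>_. count_space UNIV)) :: (nat \<Rightarrow> 'a) set"
  have "space (srw G u) = IT.PF.emb UNIV {} ?X"
    using sets_eq_imp_space_eq[OF sets_srw[of G u]] by (auto simp: prod_emb_def space_PiM)
  then have "emeasure (srw G u) (space (srw G u)) = emeasure (IT.CI {}) ?X"
    using IT.lim[of "{}" ?X] by (simp add: srw_def)
  also have "\<dots> = emeasure (IT.CI {}) (space (IT.CI {}))"
    by (simp add: IT.PF.space_P)
  also have "\<dots> = 1"
    by (rule prob_space.emeasure_space_1[OF IT.PF.prob_space_P]) auto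
  finally show ?thesis .
qed

lemma space_srw: "space (srw G u) = UNIV"
  using sets_eq_imp_space_eq[OF sets_srw[of G u]] by (simp add: space_PiM)

lemma measurable_srw_component: "(\<lambda>\<omega>. \<omega> t) \<in> measurable (srw G u) (count_space UNIV)"
  unfolding measurable_cong_sets[OF sets_srw refl]
  by (rule measurable_component_singleton) simp

lemma sets_srw_confined: "{\<omega>. \<forall>t\<le>k::nat. \<omega> t \<in> A t} \<in> sets (srw G u)"
proof -
  have "{\<omega>. \<forall>t\<le>k. \<omega> t \<in> A t} = (\<Inter>t\<in>{..k}. (\<lambda>\<omega>. \<omega> t) -` A t \<inter> space (srw G u))"
    by (auto simp: space_srw)
  also have "\<dots> \<in> sets (srw G u)"
    by (intro sets.finite_INT measurable_sets[OF measurable_srw_component]) auto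
  finally show ?thesis .
qed

text \<open>The event is a disjoint union of cylinders, one for each initial segment with values in
  \<open>S\<close>; the union is finite because \<open>S\<close> is.\<close>

lemma emeasure_srw_confined:
  assumes "finite S"
  shows "emeasure (srw G u) {\<omega>. \<forall>t\<le>k. \<omega> t \<in> S} =
    ennreal (if u \<in> S then (step_on G S ^^ k) (\<lambda>_. 1) u else 0)"
proof -
  let ?C = "\<lambda>x. {\<omega>. \<forall>t\<le>k. \<omega> t = x t}"
  have eq: "{\<omega>. \<forall>t\<le>k. \<omega> t \<in> S} = (\<Union>x\<in>PiE {..k} (\<lambda>_. S). ?C x)"
  proof (intro equalityI subsetI)
    fix \<omega> assume "\<omega> \<in> {\<omega>. \<forall>t\<le>k. \<omega> t \<in> S}"
    then show "\<omega> \<in> (\<Union>x\<in>PiE {..k} (\<lambda>_. S). ?C x)"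
      by (intro UN_I[of "restrict \<omega> {..k}"]) auto
  qed (auto simp: PiE_iff)
  have "emeasure (srw G u) (\<Union>x\<in>PiE {..k} (\<lambda>_. S). ?C x) =
      (\<Sum>x\<in>PiE {..k} (\<lambda>_. S). emeasure (srw G u) (?C x))"
  proof (rule sum_emeasure[symmetric])
    show "?C ` PiE {..k} (\<lambda>_. S) \<subseteq> sets (srw G u)"
      using sets_srw_confined[of k "\<lambda>t. {x t}" for x] by auto
    show "disjoint_family_on ?C (PiE {..k} (\<lambda>_. S))"
    proof (unfold disjoint_family_on_def, intro ballI impI)
      fix x y assume xy: "x \<in> PiE {..k} (\<lambda>_. S)" "y \<in> PiE {..k} (\<lambda>_. S)" "x \<noteq> y"
      then obtain t where "t \<in> {..k}" "x t \<noteq> y t"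
        using PiE_ext[OF xy(1,2)] by blast
      then show "?C x \<inter> ?C y = {}" by auto
    qed
    show "finite (PiE {..k} (\<lambda>_. S))"
      using assms by (intro finite_PiE) auto
  qed
  also have "\<dots> = (\<Sum>x\<in>PiE {..k} (\<lambda>_. S).
      ennreal ((if x 0 = u then \<Prod>t<k. step_prob G (x t) (x (Suc t)) else 0) * 1))"
    by (intro sum.cong refl)
      (simp add: emeasure_srw_cylinder step_prob_def prod_ennreal)
  also have "\<dots> = ennreal (\<Sum>x\<in>PiE {..k} (\<lambda>_. S).
      (if x 0 = u then \<Prod>t<k. step_prob G (x t) (x (Suc t)) else 0) * 1)"
    by (rule sum_ennreal) (simp add: prod_nonneg step_prob_nonneg)
  also have "\<dots> = ennreal (if u \<in> S then (step_on G S ^^ k) (\<lambda>_. 1) u else 0)"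
    using sum_trajectories[OF assms, where f = "\<lambda>_. 1" and k = k and u = u and G = G] by simp
  finally show ?thesis using eq by simp
qed

text \<open>The first visit is counted by the times \<open>k\<close> up to which \<open>v\<close>
  has not been seen, infinitely many if it never is. The expectation thus becomes a sum of tail
  probabilities.\<close>

lemma first_hit_eq_suminf: "first_hit v \<omega> = (\<Sum>k. indicator {\<omega>. \<forall>t\<le>k. \<omega> t \<noteq> v} \<omega>)"
proof (cases "\<exists>t. \<omega> t = v")
  case False
  then have "(\<lambda>k. indicator {\<omega>. \<forall>t\<le>k. \<omega> t \<noteq> v} \<omega> :: ennreal) = (\<lambda>_. 1)"
    by (auto simp: indicator_def)
  moreover have "(\<Sum>k::nat. 1 :: ennreal) = \<top>"
  proof -
    have "of_nat n \<le> (\<Sum>k::nat. 1 :: ennreal)" for n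
      using sum_le_suminf[of "\<lambda>_. 1 :: ennreal" "{..<n}"] by simp
    then show ?thesis
      using ennreal_Ex_less_of_nat[of "\<Sum>k::nat. 1"] by (meson leD less_top)
  qed
  ultimately show ?thesis
    using False by (simp add: first_hit_def)
next
  case True
  define m where "m = (LEAST t. \<omega> t = v)"
  have m: "\<omega> m = v" "\<And>t. \<omega> t = v \<Longrightarrow> m \<le> t"
    using True LeastI_ex[of "\<lambda>t. \<omega> t = v"] Least_le[of "\<lambda>t. \<omega> t = v"] by (auto simp: m_def)
  have "(INF t \<in> {t. \<omega> t = v}. of_nat t :: ennreal) = of_nat m"
    using m by (intro INF_eqI) auto
  moreover have "(\<forall>t\<le>k. \<omega> t \<noteq> v) \<longleftrightarrow> k < m" for k
    using m(1) m(2)[of t for t] le_less_trans[of _ k m] by (metis leD leI)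
  then have "(\<Sum>k. indicator {\<omega>. \<forall>t\<le>k. \<omega> t \<noteq> v} \<omega> :: ennreal) = (\<Sum>k. if k < m then 1 else 0)"
    by (auto simp: indicator_def intro!: arg_cong[of _ _ suminf])
  moreover have "(\<Sum>k. if k < m then 1 else 0 :: ennreal) = (\<Sum>k<m. if k < m then 1 else 0)"
    by (rule suminf_finite) auto
  ultimately show ?thesis by (simp add: first_hit_def)
qed

lemma step_prob_eq:
  assumes "finite {w. (x, w) \<in> parcs G}" "{w. (x, w) \<in> parcs G} \<noteq> {}"
  shows "step_prob G x y =
    (if (x, y) \<in> parcs G then 1 / real (card {w. (x, w) \<in> parcs G}) else 0)"
  using assms by (simp add: step_prob_def pmf_of_set)

lemma sum_step_prob:
  assumes "finite S" "{w. (x, w) \<in> parcs G} \<noteq> {}" "{w. (x, w) \<in> parcs G} \<subseteq> S"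
  shows "(\<Sum>y\<in>S. step_prob G x y * f y) =
    (\<Sum>w | (x, w) \<in> parcs G. f w) / real (card {w. (x, w) \<in> parcs G})"
proof -
  have fin: "finite {w. (x, w) \<in> parcs G}"
    using assms finite_subset by blast
  have "(\<Sum>y\<in>S. step_prob G x y * f y) = (\<Sum>y\<in>{w. (x, w) \<in> parcs G}. step_prob G x y * f y)"
    using assms fin by (intro sum.mono_neutral_right) (auto simp: step_prob_eq)
  also have "\<dots> = (\<Sum>w | (x, w) \<in> parcs G. f w / real (card {w. (x, w) \<in> parcs G}))"
    using fin assms by (intro sum.cong) (auto simp: step_prob_eq)
  finally show ?thesis by (simp add: sum_divide_distrib)
qed

lemma step_on_iter_one:
  assumes "finite V" "\<And>x. x \<in> V \<Longrightarrow> {w. (x, w) \<in> parcs G} \<noteq> {} \<and> {w. (x, w) \<in> parcs G} \<subseteq> V"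
    and "x \<in> V"
  shows "(step_on G V ^^ k) (\<lambda>_. 1) x = 1"
  using assms(3)
proof (induction k arbitrary: x)
  case (Suc k)
  have nb: "{w. (x, w) \<in> parcs G} \<noteq> {}" "{w. (x, w) \<in> parcs G} \<subseteq> V"
    using assms(2)[OF Suc.prems] by blast+
  have "card {w. (x, w) \<in> parcs G} \<noteq> 0"
    using nb finite_subset[OF nb(2) assms(1)] by simp
  moreover have "step_on G V ((step_on G V ^^ k) (\<lambda>_. 1)) x = step_on G V (\<lambda>_. 1) x"
    by (rule step_on_cong) (rule Suc.IH)
  moreover have "step_on G V (\<lambda>_. 1) x = (\<Sum>w | (x, w) \<in> parcs G. 1) / real (card {w. (x, w) \<in> parcs G})"
    unfolding step_on_def by (rule sum_step_prob[OF assms(1) nb])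
  ultimately show ?case by simp
qed simp

text \<open>Trajectories may take any value of the type, so avoiding \<open>v\<close> is not
  confinement to a finite set. It becomes one almost surely, because no mass ever leaves
  \<open>V\<close>.\<close>

lemma emeasure_srw_avoid:
  assumes "finite V" "u \<in> V"
    and nb: "\<And>x. x \<in> V \<Longrightarrow> {w. (x, w) \<in> parcs G} \<noteq> {} \<and> {w. (x, w) \<in> parcs G} \<subseteq> V"
  shows "emeasure (srw G u) {\<omega>. \<forall>t\<le>k. \<omega> t \<noteq> v} =
    ennreal (if u \<noteq> v then (step_on G (V - {v}) ^^ k) (\<lambda>_. 1) u else 0)"
proof -
  let ?A = "{\<omega>. \<forall>t\<le>k. \<omega> t \<noteq> v}" and ?B = "{\<omega>. \<forall>t\<le>k. \<omega> t \<in> V}"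
    and ?C = "{\<omega>. \<forall>t\<le>k. \<omega> t \<in> V - {v}}"
  have sets: "?A \<in> sets (srw G u)" "?B \<in> sets (srw G u)" "?C \<in> sets (srw G u)"
    using sets_srw_confined[of k "\<lambda>_. - {v}" G u] sets_srw_confined[of k "\<lambda>_. V" G u]
      sets_srw_confined[of k "\<lambda>_. V - {v}" G u] by simp_all
  have "emeasure (srw G u) ?B = 1"
    using emeasure_srw_confined[OF assms(1)] step_on_iter_one[OF assms(1) nb assms(2)] assms(2)
    by simp
  then have "emeasure (srw G u) (space (srw G u) - ?B) = 0"
    using emeasure_compl[OF sets(2)] emeasure_srw_space[of G u] by simp
  then have null: "space (srw G u) - ?B \<in> null_sets (srw G u)"
    using sets by (simp add: null_sets_def)
  have "AE \<omega> in srw G u. \<omega> \<in> ?B"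
    by (rule AE_I'[OF null]) blast
  then have "AE \<omega> in srw G u. \<omega> \<in> ?A \<longleftrightarrow> \<omega> \<in> ?C"
    by (rule AE_mp) (auto intro!: AE_I2)
  then have "emeasure (srw G u) ?A = emeasure (srw G u) ?C"
    using sets(1,3) by (rule emeasure_eq_AE)
  also have "\<dots> = ennreal (if u \<in> V - {v} then (step_on G (V - {v}) ^^ k) (\<lambda>_. 1) u else 0)"
    using assms(1) by (intro emeasure_srw_confined) simp
  finally show ?thesis using assms(2) by simp
qed

text \<open>Iterating \<open>h = 1 + Q h\<close> bounds the partial sums of \<open>Q\<^sup>k 1\<close>; the remainder \<open>Q\<^sup>k h\<close> is
  at most a multiple of \<open>Q\<^sup>k 1\<close>, hence tends to \<open>0\<close>.\<close>

lemma step_on_iter_sums: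
  fixes h :: "'a \<Rightarrow> real"
  assumes S: "finite S" "u \<in> S"
    and h: "\<And>x. x \<in> S \<Longrightarrow> h x = 1 + step_on G S h x" "\<And>x. x \<in> S \<Longrightarrow> 0 \<le> h x"
  shows "(\<lambda>k. (step_on G S ^^ k) (\<lambda>_. 1) u) sums h u"
proof -
  let ?r = "\<lambda>k. (step_on G S ^^ k) (\<lambda>_. 1) u" and ?R = "\<lambda>k. (step_on G S ^^ k) h u"
  have r_nonneg: "0 \<le> ?r k" for k
    by (rule step_on_iter_nonneg) (use S in auto)
  have expand: "h u = (\<Sum>i<k. ?r i) + ?R k" for k
  proof (induction k)
    case (Suc k)
    have "?R k = (step_on G S ^^ k) (\<lambda>x. 1 + step_on G S h x) u"
      by (rule step_on_iter_cong[OF h(1) S(2)])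
    also have "\<dots> = ?r k + (step_on G S ^^ k) (step_on G S h) u"
      by (simp only: step_on_iter_add)
    finally show ?case
      using Suc by (simp add: funpow_swap1)
  qed simp
  have R_nonneg: "0 \<le> ?R k" for k
    by (rule step_on_iter_nonneg[OF h(2) S(2)])
  define M where "M = (\<Sum>x\<in>S. h x)"
  have "h x \<le> M * 1" if "x \<in> S" for x
    using member_le_sum[of x S h] that S h(2) by (simp add: M_def)
  then have "?R k \<le> (step_on G S ^^ k) (\<lambda>x. M * 1) u" for k
    using S(2) by (rule step_on_iter_mono)
  then have le: "?R k \<le> M * ?r k" for k
    by (simp only: step_on_iter_cmult)
  have "(\<Sum>i\<le>k. ?r i) \<le> h u" for k
    using expand[of "Suc k"] R_nonneg[of "Suc k"] unfolding lessThan_Suc_atMost by linarith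
  then have "summable ?r"
    by (rule bounded_imp_summable[OF r_nonneg])
  then have "(\<lambda>k. M * ?r k) \<longlonglongrightarrow> M * 0"
    by (intro tendsto_mult tendsto_const summable_LIMSEQ_zero)
  then have "?R \<longlonglongrightarrow> 0"
    by (intro tendsto_sandwich[of "\<lambda>_. 0" ?R sequentially "\<lambda>k. M * ?r k"])
      (simp_all add: R_nonneg le)
  then have "(\<lambda>k. h u - ?R k) \<longlonglongrightarrow> h u - 0"
    by (intro tendsto_diff tendsto_const)
  moreover have "h u - ?R k = (\<Sum>i<k. ?r i)" for k
    using expand[of k] by linarith
  ultimately show ?thesis
    by (simp add: sums_def)
qed

text \<open>First-step analysis. Because \<open>h\<close> is real-valued, the tail probabilities are
  summable, which includes that \<open>v\<close> is reached almost surely.\<close>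

lemma hitting_time_eqI:
  fixes h :: "'a \<Rightarrow> real"
  assumes G: "pair_graph G" and v: "v \<in> pverts G" and u: "u \<in> pverts G"
    and deg: "\<And>x. x \<in> pverts G \<Longrightarrow> {w. (x, w) \<in> parcs G} \<noteq> {}"
    and h0: "h v = 0" and h_nonneg: "\<And>x. x \<in> pverts G \<Longrightarrow> 0 \<le> h x"
    and h_step: "\<And>x. x \<in> pverts G \<Longrightarrow> x \<noteq> v \<Longrightarrow>
      h x = 1 + (\<Sum>w | (x, w) \<in> parcs G. h w) / real (card {w. (x, w) \<in> parcs G})"
  shows "hitting_time G u v = ennreal (h u)"
proof -
  interpret pair_graph G by fact
  define S where "S = pverts G - {v}"
  have nb: "{w. (x, w) \<in> parcs G} \<noteq> {} \<and> {w. (x, w) \<in> parcs G} \<subseteq> pverts G" if "x \<in> pverts G" for x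
    using deg[OF that] in_arcsD2 by blast
  have "{\<omega>. \<forall>t\<le>k. \<omega> t \<noteq> v} \<in> sets (srw G u)" for k
    using sets_srw_confined[of k "\<lambda>_. - {v}" G u] by simp
  then have "hitting_time G u v = (\<Sum>k. emeasure (srw G u) {\<omega>. \<forall>t\<le>k. \<omega> t \<noteq> v})"
    unfolding hitting_time_def first_hit_eq_suminf by (subst nn_integral_suminf) simp_all
  also have "\<dots> = (\<Sum>k. ennreal (if u \<noteq> v then (step_on G S ^^ k) (\<lambda>_. 1) u else 0))"
    unfolding S_def by (intro suminf_cong emeasure_srw_avoid pair_finite_verts u nb)
  also have "\<dots> = ennreal (h u)"
  proof (cases "u = v")
    case True
    then show ?thesis using h0 by simp
  next
    case False
    have S: "finite S" "u \<in> S"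
      using False u pair_finite_verts by (simp_all add: S_def)
    have "h x = 1 + step_on G S h x" if "x \<in> S" for x
    proof -
      have x: "x \<in> pverts G" "x \<noteq> v" using that by (simp_all add: S_def)
      have "(\<Sum>y\<in>pverts G. step_prob G x y * h y) = step_prob G x v * h v + step_on G S h x"
        unfolding step_on_def S_def by (rule sum.remove[OF pair_finite_verts v])
      moreover have "(\<Sum>y\<in>pverts G. step_prob G x y * h y) =
          (\<Sum>w | (x, w) \<in> parcs G. h w) / real (card {w. (x, w) \<in> parcs G})"
        using nb[OF x(1)] by (intro sum_step_prob[OF pair_finite_verts]) auto
      ultimately show ?thesis
        using h_step[OF x] h0 by simp
    qed
    moreover have "0 \<le> h x" if "x \<in> S" for x
      using that h_nonneg by (simp add: S_def)
    ultimately have "(\<lambda>k. (step_on G S ^^ k) (\<lambda>_. 1) u) sums h u"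
      by (rule step_on_iter_sums[OF S])
    moreover have "0 \<le> (step_on G S ^^ k) (\<lambda>_. 1) u" for k
      by (rule step_on_iter_nonneg) (use S in auto)
    ultimately have "(\<Sum>k. ennreal ((step_on G S ^^ k) (\<lambda>_. 1) u)) = ennreal (h u)"
      by (intro suminf_ennreal_eq)
    then show ?thesis
      using False by simp
  qed
  finally show ?thesis .
qed

section \<open>Meeting times in rooted trees\<close>

context rooted_tree begin

definition load :: nat where
  "load = (\<Sum>x\<in>pverts T - {c}. sz x * (sz x - 1))"

text \<open>The candidate for H(u, c): the edges on the way from \<open>u\<close> up to
  \<open>c\<close> are crossed one after the other, and \<open>x\<close> runs through their lower
  ends.\<close>

definition hit :: "'a \<Rightarrow> real" where
  "hit u = (\<Sum>x | x \<in> pverts T - {c} \<and> u \<in> desc x. 2 * real (sz x) - 1)"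

lemma hit_root: "hit c = 0"
proof -
  have none: "{x. x \<in> pverts T - {c} \<and> c \<in> desc x} = {}"
    using root_in_desc_iff by auto
  show ?thesis
    unfolding hit_def none by simp
qed

lemma hit_nonneg: "0 \<le> hit u"
  unfolding hit_def using sz_pos by (intro sum_nonneg) (fastforce simp: Suc_le_eq)

lemma hit_par:
  assumes "u \<in> pverts T" "u \<noteq> c"
  shows "hit u = hit (par u) + (2 * real (sz u) - 1)"
proof -
  have "{x. x \<in> pverts T - {c} \<and> u \<in> desc x} = insert u {x. x \<in> pverts T - {c} \<and> par u \<in> desc x}"
    using in_desc_iff[OF assms] assms in_desc_self by blast
  moreover have "u \<notin> {x. x \<in> pverts T - {c} \<and> par u \<in> desc x}"
    using desc_dep[of "par u" u] dep_par[OF assms] by auto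
  ultimately show ?thesis
    using finite_verts by (simp add: hit_def)
qed

lemma card_nbrs:
  assumes "u \<in> pverts T"
  shows "card {w. (u, w) \<in> parcs T} = (if u = c then 0 else 1) + card (children u)"
  using assms par_notin_children by (simp add: nbrs_eq)

text \<open>The sizes of the children's subtrees add up to \<open>sz u - 1\<close>, and this cancels
  the \<open>sz u\<close> brought in by the parent; what remains is the degree times
  \<open>hit u - 1\<close>.\<close>

lemma hit_step:
  assumes u: "u \<in> pverts T" "u \<noteq> c"
  shows "hit u = 1 + (\<Sum>w | (u, w) \<in> parcs T. hit w) / real (card {w. (u, w) \<in> parcs T})"
proof -
  let ?d = "card (children u)"
  have "(\<Sum>w | (u, w) \<in> parcs T. hit w) = hit (par u) + (\<Sum>w\<in>children u. hit w)"
    using u par_notin_children by (simp add: nbrs_eq)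
  also have "(\<Sum>w\<in>children u. hit w) = (\<Sum>w\<in>children u. (hit u - 1) + 2 * real (sz w))"
    using children_in hit_par by (intro sum.cong) auto
  also have "\<dots> = real ?d * (hit u - 1) + 2 * (real (sz u) - 1)"
    using sz_eq[OF u(1)] by (simp add: sum.distrib sum_distrib_left[symmetric])
  also have "hit (par u) = hit u - (2 * real (sz u) - 1)"
    using hit_par[OF u] by simp
  finally have "(\<Sum>w | (u, w) \<in> parcs T. hit w) = real (Suc ?d) * (hit u - 1)"
    by (simp add: algebra_simps)
  moreover have "card {w. (u, w) \<in> parcs T} = Suc ?d"
    using card_nbrs[OF u(1)] u by simp
  ultimately show ?thesis
    by (simp del: of_nat_Suc)
qed

lemma card_edges: "card (edges T) = card (pverts T) - 1"
proof -
  have "edges T = (\<lambda>x. {x, par x}) ` (pverts T - {c})"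
  proof (intro equalityI subsetI)
    fix e assume "e \<in> edges T"
    then obtain x y where e: "e = {x, y}" "(x, y) \<in> parcs T"
      by (auto simp: edges_def)
    from e(2) consider "x \<in> pverts T - {c}" "y = par x" | "y \<in> pverts T - {c}" "x = par y"
      using arcs_iff by blast
    then show "e \<in> (\<lambda>x. {x, par x}) ` (pverts T - {c})"
      by cases (use e in \<open>simp_all add: insert_commute\<close>)
  next
    fix e assume "e \<in> (\<lambda>x. {x, par x}) ` (pverts T - {c})"
    then obtain x where x: "x \<in> pverts T" "x \<noteq> c" "e = {x, par x}" by blast
    then have "(x, par x) \<in> parcs T"
      using arcs_iff by blast
    then show "e \<in> edges T"
      unfolding edges_def x(3) by (rule rev_image_eqI) simp
  qed
  moreover have "inj_on (\<lambda>x. {x, par x}) (pverts T - {c})"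
  proof (rule inj_onI)
    fix x y assume xy: "x \<in> pverts T - {c}" "y \<in> pverts T - {c}" "{x, par x} = {y, par y}"
    show "x = y"
    proof (rule ccontr)
      assume "x \<noteq> y"
      then have eq: "x = par y" "par x = y"
        using xy(3) unfolding doubleton_eq_iff by blast+
      have "dep y = Suc (dep x)"
        using dep_par[of y] xy(2) eq(1) by simp
      moreover have "dep x = Suc (dep y)"
        using dep_par[of x] xy(1) eq(2) by simp
      ultimately show False by simp
    qed
  qed
  ultimately have "card (edges T) = card (pverts T - {c})"
    by (simp add: card_image)
  then show ?thesis
    using root_in finite_verts by simp
qed

lemma out_degree_eq: "out_degree (with_proj T) u = card {w. (u, w) \<in> parcs T}"
proof -
  have "out_arcs (with_proj T) u = Pair u ` {w. (u, w) \<in> parcs T}"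
    by (auto simp: out_arcs_def)
  then show ?thesis
    by (simp add: out_degree_def card_image inj_on_def)
qed

lemma sum_children:
  "(\<Sum>u\<in>pverts T. \<Sum>w\<in>children u. f u w) = (\<Sum>w\<in>pverts T - {c}. f (par w) w)"
proof -
  have "(\<Sum>u\<in>pverts T. \<Sum>w\<in>children u. f u w) =
      (\<Sum>(u, w)\<in>(SIGMA u:pverts T. children u). f u w)"
    using finite_verts by (intro sum.Sigma) auto
  also have "\<dots> = (\<Sum>w\<in>pverts T - {c}. f (par w) w)"
    by (rule sum.reindex_bij_witness[where j = snd and i = "\<lambda>w. (par w, w)"])
      (auto simp: children_def par_in)
  finally show ?thesis .
qed

text \<open>Exchange of summation: the term of \<open>x\<close> is counted once for each of its
  \<open>sz x\<close> descendants.\<close>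

lemma sum_hit: "(\<Sum>u\<in>pverts T. hit u) = (\<Sum>x\<in>pverts T - {c}. real (sz x) * (2 * real (sz x) - 1))"
proof -
  have "hit u = (\<Sum>x\<in>pverts T - {c}. if u \<in> desc x then 2 * real (sz x) - 1 else 0)" for u
    unfolding hit_def using finite_verts by (subst sum.inter_filter[symmetric]) auto
  then have "(\<Sum>u\<in>pverts T. hit u) =
      (\<Sum>x\<in>pverts T - {c}. \<Sum>u\<in>pverts T. if u \<in> desc x then 2 * real (sz x) - 1 else 0)"
    by (simp add: sum.swap[of _ "pverts T"])
  also have "\<dots> = (\<Sum>x\<in>pverts T - {c}. \<Sum>u\<in>desc x. 2 * real (sz x) - 1)"
  proof (rule sum.cong[OF refl])
    fix x
    have "{u \<in> pverts T. u \<in> desc x} = desc x"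
      using desc_subset by blast
    then show "(\<Sum>u\<in>pverts T. if u \<in> desc x then 2 * real (sz x) - 1 else 0) =
        (\<Sum>u\<in>desc x. 2 * real (sz x) - 1)"
      using finite_verts by (subst sum.inter_filter[symmetric]) auto
  qed
  finally show ?thesis by (simp add: sz_def)
qed

text \<open>The degree counts the link up and the links down, so every edge contributes
  \<open>hit\<close> at both of its ends, and these two values differ by 2 s - 1. With
  \<open>sum_hit\<close> each edge yields 2 s (2 s - 1) - (2 s - 1) = (2 s - 1)^2.\<close>

lemma sum_degree_hit:
  "(\<Sum>u\<in>pverts T. real (card {w. (u, w) \<in> parcs T}) * hit u) =
     real (card (pverts T) - 1) + 4 * real load"
proof -
  let ?V = "pverts T" and ?W = "pverts T - {c}"
  have split: "(\<Sum>u\<in>?V. f u) = f c + (\<Sum>u\<in>?W. f u)" for f :: "'a \<Rightarrow> real"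
    using finite_verts root_in by (rule sum.remove)
  have "(\<Sum>u\<in>?V. real (card {w. (u, w) \<in> parcs T}) * hit u) =
      (\<Sum>u\<in>?V. (if u = c then 0 else hit u) + (\<Sum>w\<in>children u. hit u))"
    by (intro sum.cong) (auto simp: card_nbrs algebra_simps)
  also have "\<dots> = (\<Sum>w\<in>?W. hit w) + (\<Sum>w\<in>?W. hit (par w))"
    by (simp only: sum.distrib sum_children split[of "\<lambda>u. if u = c then 0 else hit u"]) simp
  also have "\<dots> = (\<Sum>w\<in>?W. 2 * hit w - (2 * real (sz w) - 1))"
    unfolding sum.distrib[symmetric] using hit_par by (intro sum.cong) auto
  also have "\<dots> = 2 * (\<Sum>u\<in>?V. hit u) - (\<Sum>w\<in>?W. 2 * real (sz w) - 1)"
    by (simp add: split[of hit] hit_root sum_subtractf sum_distrib_left)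
  also have "\<dots> = (\<Sum>x\<in>?W. 1 + 4 * real (sz x * (sz x - 1)))"
    unfolding sum_hit sum_distrib_left sum_subtractf[symmetric]
  proof (rule sum.cong[OF refl])
    fix x assume "x \<in> ?W"
    then obtain k where "sz x = Suc k"
      using sz_pos[of x] by (cases "sz x") auto
    then show "2 * (real (sz x) * (2 * real (sz x) - 1)) - (2 * real (sz x) - 1) =
        1 + 4 * real (sz x * (sz x - 1))"
      by (simp add: algebra_simps)
  qed
  also have "\<dots> = real (card ?W) + 4 * real load"
    by (simp only: load_def of_nat_sum sum_distrib_left sum.distrib) simp
  finally show ?thesis
    using finite_verts root_in by simp
qed

text \<open>With at least two vertices none is isolated, as the first-step equations require; the
  factor 1 / (2 (n - 1)) of the stationary distribution comes from the n - 1 edges.\<close>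

theorem meeting_time_root:
  assumes n: "2 \<le> card (pverts T)"
  shows "meeting_time T c = ennreal (1 / 2 + 2 * real load / (real (card (pverts T)) - 1))"
proof -
  let ?V = "pverts T" and ?n = "card (pverts T)"
  have deg: "{w. (u, w) \<in> parcs T} \<noteq> {}" if "u \<in> ?V" for u
  proof (cases "u = c")
    case True
    then show ?thesis
      using children_empty_iff[OF that] sz_root n that by (simp add: nbrs_eq)
  next
    case False
    then show ?thesis using that by (simp add: nbrs_eq)
  qed
  have hitting: "hitting_time T u c = ennreal (hit u)" if "u \<in> ?V" for u
    using that deg hit_root hit_nonneg hit_step
    by (intro hitting_time_eqI[OF pair_graph root_in]) auto
  have "meeting_time T c = (\<Sum>u\<in>?V. ennreal (stationary T u * hit u))"
    unfolding meeting_time_def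
  proof (rule sum.cong[OF refl])
    fix u assume "u \<in> ?V"
    moreover have "0 \<le> stationary T u"
      by (simp add: stationary_def)
    ultimately show "ennreal (stationary T u) * hitting_time T u c = ennreal (stationary T u * hit u)"
      by (simp add: hitting ennreal_mult hit_nonneg)
  qed
  also have "\<dots> = ennreal (\<Sum>u\<in>?V. stationary T u * hit u)"
    by (intro sum_ennreal) (simp add: hit_nonneg stationary_def)
  also have "(\<Sum>u\<in>?V. stationary T u * hit u) =
      (\<Sum>u\<in>?V. real (card {w. (u, w) \<in> parcs T}) * hit u) / (2 * real (?n - 1))"
    by (simp add: stationary_def out_degree_eq card_edges sum_divide_distrib)
  also have "\<dots> = 1 / 2 + 2 * real load / (real ?n - 1)"
    unfolding sum_degree_hit using n by (simp add: field_simps of_nat_diff)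
  finally show ?thesis .
qed

end

section \<open>Sums of cut sizes\<close>

lemma mult_pred_mono: "(a::nat) \<le> b \<Longrightarrow> a * (a - 1) \<le> b * (b - 1)"
  by (intro mult_le_mono diff_le_mono)

lemma mult_pred_strict_mono:
  assumes "1 \<le> (a::nat)" "a < b"
  shows "a * (a - 1) < b * (b - 1)"
proof -
  have "a * (a - 1) \<le> a * (b - 1)"
    using assms by (intro mult_le_mono) auto
  also have "\<dots> < b * (b - 1)"
    using assms by (intro mult_strict_right_mono) auto
  finally show ?thesis .
qed

text \<open>The value 0 is taken at 0 and at 1, hence the lower bound on \<open>b\<close>.\<close>

lemma mult_pred_eq:
  assumes "2 \<le> (b::nat)" "a * (a - 1) = b * (b - 1)"
  shows "a = b"
proof (rule ccontr)
  assume "a \<noteq> b"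
  moreover have "a \<noteq> 0"
  proof
    assume "a = 0"
    then show False using assms by simp
  qed
  ultimately show False
    using mult_pred_strict_mono[of a b] mult_pred_strict_mono[of b a] assms by linarith
qed

text \<open>Superadditivity of t (t - 1): merging all parts into one only enlarges the second
  factors.\<close>

lemma sum_mult_pred_le:
  fixes f :: "'a \<Rightarrow> nat"
  assumes "finite X" "(\<Sum>x\<in>X. f x) \<le> m"
  shows "(\<Sum>x\<in>X. f x * (f x - 1)) \<le> m * (m - 1)"
proof -
  have le: "f x \<le> m" if "x \<in> X" for x
    using member_le_sum[of x X f] that assms by simp
  have "(\<Sum>x\<in>X. f x * (f x - 1)) \<le> (\<Sum>x\<in>X. f x * (m - 1))"
    using le by (intro sum_mono mult_le_mono diff_le_mono) auto
  also have "\<dots> = (\<Sum>x\<in>X. f x) * (m - 1)"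
    by (simp add: sum_distrib_right)
  also have "\<dots> \<le> m * (m - 1)"
    using assms by (intro mult_le_mono) auto
  finally show ?thesis .
qed

text \<open>Equality in superadditivity leaves a single part that uses the whole bound
  \<open>m\<close>; parts that contribute 0 are ruled out by the lower bound 2.\<close>

lemma sum_mult_pred_eqD:
  fixes f :: "'a \<Rightarrow> nat"
  assumes X: "finite X" "(\<Sum>x\<in>X. f x) \<le> m" "\<And>x. x \<in> X \<Longrightarrow> 2 \<le> f x" "a \<in> X"
    and eq: "(\<Sum>x\<in>X. f x * (f x - 1)) = m * (m - 1)"
  shows "X = {a} \<and> f a = m"
proof -
  have sum_a: "(\<Sum>x\<in>X. f x) = f a + (\<Sum>x\<in>X - {a}. f x)"
    by (rule sum.remove[OF X(1,4)])
  have m: "2 \<le> m"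
    using sum_a X(2) X(3)[OF X(4)] by linarith
  have le: "f x \<le> m" if "x \<in> X" for x
    using member_le_sum[of x X f] that X by simp
  have fa: "f a = m"
  proof (rule ccontr)
    assume "f a \<noteq> m"
    then have lt: "f a < m" using le[OF X(4)] by simp
    have "(\<Sum>x\<in>X. f x * (f x - 1)) = f a * (f a - 1) + (\<Sum>x\<in>X - {a}. f x * (f x - 1))"
      by (rule sum.remove[OF X(1,4)])
    also have "\<dots> \<le> f a * (f a - 1) + (m - f a) * (m - f a - 1)"
      using X sum_a by (intro add_left_mono sum_mult_pred_le) auto
    also have "\<dots> < f a * (m - 1) + (m - f a) * (m - 1)"
      using lt X(3)[OF X(4)] by (intro add_less_le_mono mult_strict_left_mono mult_le_mono) auto
    also have "\<dots> = m * (m - 1)"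
      using lt by (simp add: distrib_right[symmetric] del: distrib_right_numeral)
    finally show False using eq by simp
  qed
  then have "(\<Sum>x\<in>X - {a}. f x) = 0"
    using sum_a X(2) by linarith
  then have "\<forall>x\<in>X - {a}. f x = 0"
    using X(1) by simp
  then have "x \<notin> X - {a}" for x
    using X(3)[of x] by force
  then have "X = {a}"
    using X(4) by blast
  then show ?thesis
    using fa by blast
qed

text \<open>\<open>N\<close> is 2 m or 2 m - 1, so \<open>m\<close> is half of \<open>N\<close>
  rounded up. If no part reaches the cap \<open>m\<close>, all second factors are at most m - 2, and
  N (m - 2) does not exceed the bound; for m \<ge> 2 it is strictly smaller.\<close>

lemma sum_mult_pred_le2_aux:
  fixes f :: "'a \<Rightarrow> nat"
  assumes X: "finite X" "(\<Sum>x\<in>X. f x) \<le> N" "\<And>x. x \<in> X \<Longrightarrow> f x < m"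
    and N: "N \<le> 2 * m" "2 * m \<le> N + 1"
  shows "(\<Sum>x\<in>X. f x * (f x - 1)) \<le> m * (m - 1) + (N - m) * (N - m - 1)"
    and "2 \<le> m \<Longrightarrow> (\<Sum>x\<in>X. f x * (f x - 1)) < m * (m - 1) + (N - m) * (N - m - 1)"
proof -
  have "(\<Sum>x\<in>X. f x * (f x - 1)) \<le> (\<Sum>x\<in>X. f x * (m - 2))"
  proof (intro sum_mono mult_le_mono2)
    fix x assume "x \<in> X"
    then show "f x - 1 \<le> m - 2"
      using X(3)[of x] by linarith
  qed
  also have "\<dots> \<le> N * (m - 2)"
    using X(2) by (simp add: sum_distrib_right[symmetric])
  finally have le: "(\<Sum>x\<in>X. f x * (f x - 1)) \<le> N * (m - 2)" .
  show *: "(\<Sum>x\<in>X. f x * (f x - 1)) < m * (m - 1) + (N - m) * (N - m - 1)" if "2 \<le> m"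
  proof -
    define i where "i = m - 2"
    have i: "m = i + 2"
      using that by (simp add: i_def)
    have "N = 2 * i + 4 \<or> N = 2 * i + 3"
      using N i by linarith
    then have "N * i < (i + 2) * (i + 1) + (N - m) * (N - m - 1)"
    proof
      assume N: "N = 2 * i + 4"
      then have "N - m = i + 2" "N - m - 1 = i + 1"
        using i by simp_all
      then show ?thesis
        unfolding N by (simp add: algebra_simps)
    next
      assume N: "N = 2 * i + 3"
      then have "N - m = i + 1" "N - m - 1 = i"
        using i by simp_all
      then show ?thesis
        unfolding N by (simp add: algebra_simps)
    qed
    then show ?thesis
      using le i by simp
  qed
  show "(\<Sum>x\<in>X. f x * (f x - 1)) \<le> m * (m - 1) + (N - m) * (N - m - 1)"
  proof (cases "2 \<le> m")
    case True
    then show ?thesis using * by simp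
  next
    case False
    then show ?thesis using le by simp
  qed
qed

text \<open>Once one part takes the cap \<open>m\<close>, the others share N - m and superadditivity
  applies to them; otherwise the auxiliary bound does.\<close>

lemma sum_mult_pred_le2:
  fixes f :: "'a \<Rightarrow> nat"
  assumes X: "finite X" "(\<Sum>x\<in>X. f x) \<le> N" "\<And>x. x \<in> X \<Longrightarrow> f x \<le> m"
    and N: "N \<le> 2 * m" "2 * m \<le> N + 1"
  shows "(\<Sum>x\<in>X. f x * (f x - 1)) \<le> m * (m - 1) + (N - m) * (N - m - 1)"
proof (cases "\<exists>x\<in>X. f x = m")
  case True
  then obtain x0 where x0: "x0 \<in> X" "f x0 = m" by blast
  have "(\<Sum>x\<in>X - {x0}. f x) \<le> N - m"
    using sum.remove[OF X(1) x0(1), of f] X(2) x0(2) by simp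
  then have "(\<Sum>x\<in>X - {x0}. f x * (f x - 1)) \<le> (N - m) * (N - m - 1)"
    using X(1) by (intro sum_mult_pred_le) auto
  then show ?thesis
    using sum.remove[OF X(1) x0(1), of "\<lambda>x. f x * (f x - 1)"] x0(2) by simp
next
  case False
  then have "f x < m" if "x \<in> X" for x
    using X(3)[OF that] that by (auto simp: nat_less_le)
  then show ?thesis
    using sum_mult_pred_le2_aux(1)[OF X(1,2) _ N] by blast
qed

text \<open>The two parts are \<open>m\<close> and N - m in an unknown order, hence the disjunction
  at the end.\<close>

lemma sum_mult_pred_eq2D:
  fixes f :: "'a \<Rightarrow> nat"
  assumes X: "finite X" "(\<Sum>x\<in>X. f x) \<le> N" "\<And>x. x \<in> X \<Longrightarrow> f x \<le> m" "\<And>x. x \<in> X \<Longrightarrow> 2 \<le> f x"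
    and N: "N \<le> 2 * m" "2 * m \<le> N + 1"
    and ab: "a \<in> X" "b \<in> X" "a \<noteq> b"
    and eq: "(\<Sum>x\<in>X. f x * (f x - 1)) = m * (m - 1) + (N - m) * (N - m - 1)"
  shows "X = {a, b} \<and> f a + f b = N \<and> (f a = m \<or> f b = m)"
proof -
  have m: "2 \<le> m"
    using X(3)[OF ab(1)] X(4)[OF ab(1)] by linarith
  have "\<exists>x\<in>X. f x = m"
  proof (rule ccontr)
    assume "\<not> (\<exists>x\<in>X. f x = m)"
    then have "f x < m" if "x \<in> X" for x
      using X(3)[OF that] that by (auto simp: nat_less_le)
    then show False
      using sum_mult_pred_le2_aux(2)[OF X(1,2) _ N m] eq by simp
  qed
  then obtain x0 where x0: "x0 \<in> X" "f x0 = m" by blast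
  \<comment> \<open>The part \<open>x0\<close> that reaches the cap is not yet known to be
    \<open>a\<close> or \<open>b\<close>. \<open>y\<close> is one of these two that differs from it,
    and the equality case for a single part then identifies everything else.\<close>
  define y where "y = (if x0 = a then b else a)"
  have y: "y \<in> X - {x0}"
    using ab by (auto simp: y_def)
  have "(\<Sum>x\<in>X - {x0}. f x) \<le> N - m"
    using sum.remove[OF X(1) x0(1), of f] X(2) x0(2) by simp
  moreover have "(\<Sum>x\<in>X - {x0}. f x * (f x - 1)) = (N - m) * (N - m - 1)"
    using sum.remove[OF X(1) x0(1), of "\<lambda>x. f x * (f x - 1)"] x0(2) eq by simp
  ultimately have *: "X - {x0} = {y} \<and> f y = N - m"
    using X(1,4) y by (intro sum_mult_pred_eqD) auto
  have "m \<le> N"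
    using N m by linarith
  have "X = {x0, y}"
    using * x0(1) by blast
  then have "a = x0 \<and> b = y \<or> a = y \<and> b = x0"
    using ab by blast
  then show ?thesis
  proof
    assume "a = x0 \<and> b = y"
    then show ?thesis
      using * x0(2) \<open>X = {x0, y}\<close> \<open>m \<le> N\<close> by simp
  next
    assume "a = y \<and> b = x0"
    then show ?thesis
      using * x0(2) \<open>X = {x0, y}\<close> \<open>m \<le> N\<close> by (simp add: insert_commute)
  qed
qed

text \<open>The least contribution to the load of an edge that cuts a tree on \<open>n\<close> vertices into parts of
  sizes \<open>y\<close> and \<open>n - y\<close>.\<close>

definition cut_load :: "nat \<Rightarrow> nat \<Rightarrow> nat" where
  "cut_load n y = min y (n - y) * (min y (n - y) - 1)"

text \<open>The cuts of the inner edges of the balanced double broom.\<close>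

definition broom_load :: "nat \<Rightarrow> nat \<Rightarrow> nat" where
  "broom_load n d = (\<Sum>y\<in>{(n + 1 - d) div 2 + 1..(n + 1 - d) div 2 + d - 2}. cut_load n y)"

text \<open>Among all intervals of at most \<open>d - 2\<close> cut sizes the central one has the largest sum: cuts
  outside it are at most as large as cuts inside it.\<close>

lemma interval_cut_load:
  assumes d: "2 \<le> d" "d < n" and l: "l = (n + 1 - d) div 2" and r: "r = n + 1 - d - l"
    and I: "I = {s..<s + k}" "k \<le> d - 2" "1 \<le> s"
  shows "(\<Sum>y\<in>I. cut_load n y) \<le> broom_load n d"
    and "(\<Sum>y\<in>I. cut_load n y) = broom_load n d \<Longrightarrow> k = d - 2 \<and> (3 \<le> d \<longrightarrow> s = l + 1 \<or> s = r + 1)"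
proof -
  define J where "J = {l + 1..l + d - 2}"
  have lr: "l \<le> r" "r \<le> l + 1" "l + r + d = n + 1" "1 \<le> l"
  proof -
    define q where "q = n + 1 - d"
    have "2 \<le> q" "q + d = n + 1" "l = q div 2" "r = q - l"
      using d l r by (simp_all add: q_def)
    then show "l \<le> r" "r \<le> l + 1" "l + r + d = n + 1" "1 \<le> l"
      by linarith+
  qed
  have bl: "broom_load n d = (\<Sum>y\<in>J. cut_load n y)"
    by (simp add: broom_load_def J_def l)
  have fin: "finite I" "finite J" by (simp_all add: I J_def)
  have cI: "card I = k" and cJ: "card J = d - 2"
    using d by (simp_all add: I J_def)
  let ?g = "\<lambda>a::nat. a * (a - 1)"
  have out: "cut_load n y \<le> ?g r" if "y \<notin> J" for y
  proof -
    have "min y (n - y) \<le> r"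
      using that lr unfolding J_def by auto
    then show ?thesis
      unfolding cut_load_def by (rule mult_pred_mono)
  qed
  have ins: "?g (l + 1) \<le> cut_load n y" if "y \<in> J" for y
  proof -
    have "l + 1 \<le> min y (n - y)"
      using that lr unfolding J_def by auto
    then show ?thesis
      unfolding cut_load_def by (rule mult_pred_mono)
  qed
  have gr: "?g r \<le> ?g (l + 1)"
    using lr by (intro mult_pred_mono) auto
  have gpos: "0 < ?g (l + 1)"
    using lr by simp
  have cards: "card (I - J) + card (I \<inter> J) = k" "card (J - I) + card (I \<inter> J) = d - 2"
    using card_Diff_subset_Int[of I J] card_Diff_subset_Int[of J I] fin cI cJ
      card_mono[of I "I \<inter> J"] card_mono[of J "I \<inter> J"] by (auto simp: Int_commute)
  have sI: "(\<Sum>y\<in>I. cut_load n y) = (\<Sum>y\<in>I \<inter> J. cut_load n y) + (\<Sum>y\<in>I - J. cut_load n y)"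
    using sum.Int_Diff[OF fin(1)] .
  have sJ: "(\<Sum>y\<in>J. cut_load n y) = (\<Sum>y\<in>I \<inter> J. cut_load n y) + (\<Sum>y\<in>J - I. cut_load n y)"
    using sum.Int_Diff[OF fin(2), of "cut_load n" I] by (simp add: Int_commute)
  have u1: "(\<Sum>y\<in>I - J. cut_load n y) \<le> card (I - J) * ?g r"
    using out sum_bounded_above[of "I - J" "cut_load n" "?g r"] by simp
  have u2: "card (J - I) * ?g (l + 1) \<le> (\<Sum>y\<in>J - I. cut_load n y)"
    using ins sum_bounded_below[of "J - I" "?g (l + 1)" "cut_load n"] by simp
  have u3: "card (I - J) * ?g r \<le> card (I - J) * ?g (l + 1)"
    using gr by (rule mult_le_mono2)
  have u4: "card (I - J) * ?g (l + 1) \<le> card (J - I) * ?g (l + 1)"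
    using cards I(2) by (intro mult_le_mono1) linarith
  show "(\<Sum>y\<in>I. cut_load n y) \<le> broom_load n d"
    using u1 u2 u3 u4 sI sJ bl by linarith
  assume "(\<Sum>y\<in>I. cut_load n y) = broom_load n d"
  then have e: "(\<Sum>y\<in>I - J. cut_load n y) = card (I - J) * ?g r"
      "card (I - J) * ?g r = card (I - J) * ?g (l + 1)"
      "card (I - J) * ?g (l + 1) = card (J - I) * ?g (l + 1)"
    using u1 u2 u3 u4 sI sJ bl by linarith+
  have "card (I - J) = card (J - I)"
    using e(3) gpos by (simp only: mult_cancel2) simp
  then have k: "k = d - 2"
    using cards by linarith
  \<comment> \<open>If r = l + 1, the central interval ties with its mirror image under y to n - y,
    which starts at r + 1; if r = l, the two coincide. For d = 2 the interval is empty and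
    \<open>s\<close> is arbitrary.\<close>
  have "s = l + 1 \<or> s = r + 1" if d3: "3 \<le> d"
  proof (cases "I \<subseteq> J")
    case True
    have "s \<in> I" "s + k - 1 \<in> I"
      using k d3 by (auto simp: I(1))
    then have "s \<in> J" "s + k - 1 \<in> J"
      using True by blast+
    then have "s = l + 1"
      using k d3 unfolding J_def by auto
    then show ?thesis ..
  next
    case False
    then have "card (I - J) \<noteq> 0"
      using fin by auto
    then have "?g r = ?g (l + 1)"
      using e(2) by (simp only: mult_cancel1) simp
    then have rl: "r = l + 1"
      using mult_pred_eq[of "l + 1" r] lr by simp
    \<comment> \<open>Equality makes every cut outside the central interval attain the largest value
      possible there, so its smaller side is exactly l + 1; this rules out all shifts except the one
      onto the mirror image.\<close>
    have all: "min y (n - y) = l + 1" if y: "y \<in> I - J" for y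
    proof -
      have "cut_load n y = ?g (l + 1)"
      proof (rule ccontr)
        assume "cut_load n y \<noteq> ?g (l + 1)"
        then have lt: "cut_load n y < ?g (l + 1)"
          using out[of y] y rl by simp
        have "(\<Sum>y\<in>I - J. cut_load n y) < (\<Sum>y\<in>I - J. ?g (l + 1))"
          using fin lt y out rl by (intro sum_strict_mono_ex1) auto
        then show False using e(1,2) by simp
      qed
      then show ?thesis
        using mult_pred_eq[of "l + 1" "min y (n - y)"] lr unfolding cut_load_def by simp
    qed
    consider "s < l + 1" | "s = l + 1" | "l + 1 < s" by linarith
    then show ?thesis
    proof cases
      case 1
      then have "s \<in> I - J"
        using I k d3 unfolding J_def by auto
      then show ?thesis using all[of s] 1 by simp
    next
      case 3
      then have "s + k - 1 \<in> I - J"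
        using I k d3 unfolding J_def by auto
      then have "l + 1 \<le> n - (s + k - 1)"
        using all[of "s + k - 1"] by simp
      then have "s \<le> l + 2"
        using k d3 lr rl by linarith
      then show ?thesis using 3 rl by linarith
    qed simp
  qed
  then show "k = d - 2 \<and> (3 \<le> d \<longrightarrow> s = l + 1 \<or> s = r + 1)"
    using k by blast
qed

text \<open>Here r = l + e, L + 2 = d - 2 and n = l + r + d - 1. Peeling off the two outermost cuts
  keeps \<open>n\<close> and raises \<open>l\<close> by one, which drives the inductions for the
  closed form.\<close>

lemma cut_load_shift_sum:
  assumes "1 \<le> l" "e \<le> 1"
  shows "(\<Sum>y\<in>{l + 1..<l + 1 + (L + 2)}. cut_load (2 * l + (L + 2) + 1 + e) y) =
    (l + 1) * l + (l + 1 + e) * (l + e) +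
    (\<Sum>y\<in>{(l + 1) + 1..<(l + 1) + 1 + L}. cut_load (2 * (l + 1) + L + 1 + e) y)"
proof -
  let ?n = "2 * l + (L + 2) + 1 + e"
  have "{l + 1..<l + 1 + (L + 2)} = insert (l + 1) (insert (l + L + 2) {(l + 1) + 1..<(l + 1) + 1 + L})"
    by auto
  then have "(\<Sum>y\<in>{l + 1..<l + 1 + (L + 2)}. cut_load ?n y) = cut_load ?n (l + 1) +
      (cut_load ?n (l + L + 2) + (\<Sum>y\<in>{(l + 1) + 1..<(l + 1) + 1 + L}. cut_load ?n y))"
    by simp
  moreover have "min (l + 1) (?n - (l + 1)) = l + 1"
    by simp
  then have "cut_load ?n (l + 1) = (l + 1) * l"
    unfolding cut_load_def by simp
  moreover have "min (l + L + 2) (?n - (l + L + 2)) = l + 1 + e"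
    using assms by simp
  then have "cut_load ?n (l + L + 2) = (l + 1 + e) * (l + e)"
    unfolding cut_load_def by simp
  moreover have "?n = 2 * (l + 1) + L + 1 + e"
    by simp
  ultimately show ?thesis
    by (simp only: add.assoc)
qed

section \<open>Centroids\<close>

context rooted_tree begin

text \<open>Only the edge between \<open>c\<close> and \<open>w\<close> changes its direction, so
  \<open>par\<close> is modified at \<open>c\<close> alone. Its old value at \<open>w\<close> stays
  but carries no meaning, as \<open>w\<close> is now the root.\<close>

lemma reroot:
  assumes w: "w \<in> children c"
  shows "rooted_tree T w (par(c := w)) (\<lambda>z. if z \<in> desc w then dep z - 1 else dep z + 1)"
    (is "rooted_tree T w ?par ?dep")
proof
  have w': "w \<in> pverts T" "w \<noteq> c" "par w = c" "dep w = 1"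
    using children_in[OF w] dep_root by simp_all
  have cw: "c \<notin> desc w"
    using root_in_desc_iff w' by blast
  show "finite (pverts T)" by (rule finite_verts)
  show "w \<in> pverts T" by (rule w'(1))
  show "?dep w = 0"
    using in_desc_self[OF w'(1)] w'(4) by simp
  fix x assume x: "x \<in> pverts T" "x \<noteq> w"
  show "?par x \<in> pverts T"
    using x w'(1) par_in by simp
  show "?dep x = Suc (?dep (?par x))"
  proof (cases "x = c")
    case True
    then show ?thesis
      using cw in_desc_self[OF w'(1)] w'(4) dep_root by simp
  next
    case False
    have iff: "x \<in> desc w \<longleftrightarrow> par x \<in> desc w"
      using in_desc_iff[OF x(1) False w'(1)] x(2) by blast
    have dx: "dep x = Suc (dep (par x))"
      by (rule dep_par[OF x(1) False])
    show ?thesis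
    proof (cases "x \<in> desc w")
      case True
      then have "1 \<le> dep (par x)"
        using iff desc_dep[of "par x" w] w'(4) by simp
      then show ?thesis
        using True iff False dx by simp
    next
      case not: False
      then show ?thesis
        using iff False dx by simp
    qed
  qed
next
  fix x y
  have w': "w \<in> pverts T" "w \<noteq> c" "par w = c"
    using children_in[OF w] by simp_all
  have *: "x \<in> pverts T \<and> x \<noteq> c \<and> y = par x \<longleftrightarrow>
      x \<in> pverts T \<and> x \<noteq> w \<and> x \<noteq> c \<and> y = par x \<or> x = w \<and> y = c" for x y
    using w' by blast
  have **: "x \<in> pverts T \<and> x \<noteq> w \<and> y = ?par x \<longleftrightarrow>
      x \<in> pverts T \<and> x \<noteq> w \<and> x \<noteq> c \<and> y = par x \<or> x = c \<and> y = w" for x y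
    using w' root_in by auto
  show "(x, y) \<in> parcs T \<longleftrightarrow>
      x \<in> pverts T \<and> x \<noteq> w \<and> y = ?par x \<or> y \<in> pverts T \<and> y \<noteq> w \<and> x = ?par y"
    unfolding arcs_iff[of x y] *[of x y] *[of y x] **[of x y] **[of y x] by blast
qed

text \<open>Deleting an edge leaves the same components under both rootings, so all subtrees agree
  except at the edge between \<open>c\<close> and \<open>w\<close>, whose lower side changes from
  \<open>sz w\<close> to n - \<open>sz w\<close> vertices. Adding on both sides avoids
  subtraction.\<close>

lemma reroot_load:
  assumes w: "w \<in> children c"
    and R: "rooted_tree T w (par(c := w)) dep'"
  shows "rooted_tree.load T w (par(c := w)) dep' + sz w * (sz w - 1) =
    load + (card (pverts T) - sz w) * (card (pverts T) - sz w - 1)"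
proof -
  interpret R: rooted_tree T w "par(c := w)" dep' by (rule R)
  have w': "w \<in> pverts T" "w \<noteq> c" "par w = c"
    using children_in[OF w] by simp_all
  have same: "R.sz x = sz x" if "x \<in> pverts T" "x \<noteq> c" "x \<noteq> w" for x
    using R.desc_eq_component[OF that(1,3)] desc_eq_component[OF that(1,2)] that(2)
    by (simp add: R.sz_def sz_def)
  have ch: "R.children w = insert c (children w)"
    using w' root_in by (auto simp: R.children_def children_def)
  have cn: "c \<notin> children w"
    by (simp add: children_def)
  have wn: "w \<notin> children w"
    using w' by (simp add: children_def)
  have "card (pverts T) = Suc (\<Sum>x\<in>insert c (children w). R.sz x)"
    using R.sz_eq[OF w'(1)] R.sz_root ch by simp
  also have "\<dots> = R.sz c + Suc (\<Sum>x\<in>children w. R.sz x)"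
    using cn by simp
  also have "(\<Sum>x\<in>children w. R.sz x) = (\<Sum>x\<in>children w. sz x)"
  proof (rule sum.cong[OF refl])
    fix x assume x: "x \<in> children w"
    then show "R.sz x = sz x"
      using children_in[OF x] wn by (intro same) auto
  qed
  also have "Suc (\<Sum>x\<in>children w. sz x) = sz w"
    using sz_eq[OF w'(1)] by simp
  finally have szc: "R.sz c = card (pverts T) - sz w"
    by linarith
  have "R.load = R.sz c * (R.sz c - 1) + (\<Sum>x\<in>pverts T - {w} - {c}. R.sz x * (R.sz x - 1))"
    unfolding R.load_def using finite_verts root_in w' by (intro sum.remove) auto
  also have "(\<Sum>x\<in>pverts T - {w} - {c}. R.sz x * (R.sz x - 1)) =
      (\<Sum>x\<in>pverts T - {c} - {w}. sz x * (sz x - 1))"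
    by (rule sum.cong) (auto simp: same)
  finally have 1: "R.load = (card (pverts T) - sz w) * (card (pverts T) - sz w - 1) +
      (\<Sum>x\<in>pverts T - {c} - {w}. sz x * (sz x - 1))"
    by (simp only: szc)
  have "load = sz w * (sz w - 1) + (\<Sum>x\<in>pverts T - {c} - {w}. sz x * (sz x - 1))"
    unfolding load_def using finite_verts w' by (intro sum.remove) auto
  then show ?thesis
    unfolding 1 by linarith
qed

end

text \<open>A condition on the children of the root is enough, since sizes decrease further
  down.\<close>

locale centroid_rooted_tree = rooted_tree +
  assumes half: "\<And>w. w \<in> children c \<Longrightarrow> 2 * sz w \<le> card (pverts T)"

text \<open>At a vertex that minimises the meeting time no branch exceeds half of the vertices:
  moving the root into such a branch would replace s (s - 1) by the smaller (n - s) (n - s -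
  1).\<close>

lemma centroid_exists:
  assumes tree: "is_tree T" and n: "2 \<le> card (pverts T)"
  obtains c par dep where "centroid_rooted_tree T c par dep"
    and "bestmeet T = ennreal (1 / 2 + 2 * real (rooted_tree.load T c par dep) / (real (card (pverts T)) - 1))"
proof -
  let ?n = "card (pverts T)"
  have fin: "finite (pverts T)" and ne: "pverts T \<noteq> {}"
    using n card.infinite by fastforce+
  have "bestmeet T \<in> meeting_time T ` pverts T"
    unfolding bestmeet_def using fin ne by (intro Min_in) auto
  then obtain c where c: "c \<in> pverts T" "bestmeet T = meeting_time T c"
    by blast
  have min: "meeting_time T c \<le> meeting_time T w" if "w \<in> pverts T" for w
    using that fin unfolding c(2)[symmetric] bestmeet_def by simp
  obtain par dep where "rooted_tree T c par dep"
    using rooting_exists[OF tree c(1)] .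
  then interpret rooted_tree T c par dep .
  have "2 * sz w \<le> ?n" if w: "w \<in> children c" for w
  proof (rule ccontr)
    assume neg: "\<not> 2 * sz w \<le> ?n"
    have w': "w \<in> pverts T" "w \<noteq> c" "par w = c"
      using children_in[OF w] by simp_all
    have lt: "sz w < ?n"
      using sz_par_less[OF w'(1,2)] w'(3) sz_root by simp
    obtain dep' where R: "rooted_tree T w (par(c := w)) dep'"
      using reroot[OF w] by blast
    have "(?n - sz w) * (?n - sz w - 1) < sz w * (sz w - 1)"
      using neg lt by (intro mult_pred_strict_mono) auto
    then have less: "rooted_tree.load T w (par(c := w)) dep' < load"
      using reroot_load[OF w R] by linarith
    have "meeting_time T w < meeting_time T c"
      unfolding rooted_tree.meeting_time_root[OF R n] meeting_time_root[OF n]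
      using less n by (intro ennreal_lessI) (auto simp: divide_strict_right_mono add_pos_nonneg)
    then show False
      using min[OF w'(1)] by simp
  qed
  then have "centroid_rooted_tree T c par dep"
    by unfold_locales
  then show ?thesis
    using c(2) meeting_time_root[OF n] that by metis
qed

text \<open>A bound that holds for every root spares locating the best vertex.\<close>

lemma bestmeet_ge:
  assumes tree: "is_tree T" and n: "2 \<le> card (pverts T)"
    and ge: "\<And>c par dep. rooted_tree T c par dep \<Longrightarrow> k \<le> rooted_tree.load T c par dep"
  shows "ennreal (1 / 2 + 2 * real k / (real (card (pverts T)) - 1)) \<le> bestmeet T"
proof -
  obtain c par dep where C: "centroid_rooted_tree T c par dep"
    and eq: "bestmeet T = ennreal (1 / 2 + 2 * real (rooted_tree.load T c par dep) / (real (card (pverts T)) - 1))"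
    using centroid_exists[OF tree n] .
  have "rooted_tree T c par dep"
    using C by (simp add: centroid_rooted_tree_def)
  then have "real k \<le> real (rooted_tree.load T c par dep)"
    using ge by simp
  then show ?thesis
    unfolding eq using n by (intro ennreal_leI add_left_mono divide_right_mono) auto
qed

section \<open>Level sums at a centroid\<close>

context rooted_tree begin

text \<open>The ancestor of \<open>z\<close> on level \<open>j\<close>. By truncated subtraction it
  is \<open>z\<close> itself once \<open>j\<close> exceeds the depth.\<close>

definition up :: "nat \<Rightarrow> 'a \<Rightarrow> 'a" where
  "up j z = (par ^^ (dep z - j)) z"

lemma up_in:
  assumes "z \<in> pverts T" "j \<le> dep z"
  shows "up j z \<in> pverts T" "dep (up j z) = j"
  using funpow_par[OF assms(1), of "dep z - j"] assms(2) by (simp_all add: up_def)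

lemma in_desc_up: "z \<in> pverts T \<Longrightarrow> j \<le> dep z \<Longrightarrow> z \<in> desc (up j z)"
  using up_in by (simp add: desc_def) (simp add: up_def)

lemma desc_eq_up: "z \<in> desc x \<Longrightarrow> x = up (dep x) z"
  by (simp add: desc_def up_def)

lemma up_0: "z \<in> pverts T \<Longrightarrow> up 0 z = c"
  using up_in[of z 0] dep_eq_0_iff by simp

lemma par_up: "j < dep z \<Longrightarrow> par (up (Suc j) z) = up j z"
proof -
  assume "j < dep z"
  then have "dep z - j = Suc (dep z - Suc j)"
    by simp
  then show ?thesis
    by (simp add: up_def)
qed

lemma up_up:
  assumes "i \<le> j" "j \<le> dep z" "z \<in> pverts T"
  shows "up i (up j z) = up i z"
proof -
  have "(par ^^ (j - i)) ((par ^^ (dep z - j)) z) = (par ^^ ((j - i) + (dep z - j))) z"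
    by (simp add: funpow_add)
  moreover have "(j - i) + (dep z - j) = dep z - i"
    using assms by simp
  moreover have "dep (up j z) = j"
    using up_in[OF assms(3,2)] by simp
  ultimately show ?thesis
    by (simp add: up_def)
qed

lemma up_in_desc_up: "i \<le> j \<Longrightarrow> j \<le> dep z \<Longrightarrow> z \<in> pverts T \<Longrightarrow> up j z \<in> desc (up i z)"
  using in_desc_up[of "up j z" i] up_in[of z j] up_up[of i j z] by simp

lemma sum_sz_level:
  assumes "u \<in> pverts T" "dep u \<le> j"
  shows "(\<Sum>x | x \<in> desc u \<and> dep x = j. sz x) = card {z \<in> desc u. j \<le> dep z}"
proof -
  have "{z \<in> desc u. j \<le> dep z} = (\<Union>x\<in>{x. x \<in> desc u \<and> dep x = j}. desc x)"
  proof (intro equalityI subsetI)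
    fix z assume z: "z \<in> {z \<in> desc u. j \<le> dep z}"
    then have zV: "z \<in> pverts T" using desc_subset by blast
    have "up j z \<in> desc (up (dep u) z)"
      using z zV assms by (intro up_in_desc_up) auto
    then have "up j z \<in> desc u"
      using z desc_eq_up[of z u] by simp
    moreover have "dep (up j z) = j" "z \<in> desc (up j z)"
      using z zV up_in in_desc_up by simp_all
    ultimately show "z \<in> (\<Union>x\<in>{x. x \<in> desc u \<and> dep x = j}. desc x)"
      by blast
  next
    fix z assume "z \<in> (\<Union>x\<in>{x. x \<in> desc u \<and> dep x = j}. desc x)"
    then obtain x where "x \<in> desc u" "dep x = j" "z \<in> desc x" by blast
    then show "z \<in> {z \<in> desc u. j \<le> dep z}"
      using desc_trans[OF _ assms(1)] desc_dep by blast
  qed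
  moreover have "card (\<Union>x\<in>{x. x \<in> desc u \<and> dep x = j}. desc x) =
      (\<Sum>x | x \<in> desc u \<and> dep x = j. sz x)"
    unfolding sz_def
  proof (rule card_UN_disjoint)
    show "\<forall>x\<in>{x. x \<in> desc u \<and> dep x = j}. \<forall>y\<in>{x. x \<in> desc u \<and> dep x = j}.
        x \<noteq> y \<longrightarrow> desc x \<inter> desc y = {}"
      using desc_disjoint by simp
  qed auto
  ultimately show ?thesis by simp
qed

text \<open>The subtrees on level \<open>j\<close> are disjoint and miss every vertex above that
  level, so a set \<open>Y\<close> exhibited there reduces what they can share. The budgets of the
  levels come from choices of \<open>Y\<close> on the arms.\<close>

lemma sum_sz_level_le:
  assumes "u \<in> pverts T" "dep u \<le> j" "X \<subseteq> {x. x \<in> desc u \<and> dep x = j}"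
    and "Y \<subseteq> {z \<in> desc u. dep z < j}"
  shows "(\<Sum>x\<in>X. sz x) + card Y \<le> sz u"
proof -
  have "(\<Sum>x\<in>X. sz x) \<le> card {z \<in> desc u. j \<le> dep z}"
    unfolding sum_sz_level[OF assms(1,2), symmetric] using assms(3) by (intro sum_mono2) auto
  moreover have "card Y \<le> card {z \<in> desc u. dep z < j}"
    using assms(4) by (intro card_mono) auto
  moreover have "card {z \<in> desc u. j \<le> dep z} + card {z \<in> desc u. dep z < j} = sz u"
  proof -
    have "desc u = {z \<in> desc u. j \<le> dep z} \<union> {z \<in> desc u. dep z < j}"
      by auto
    moreover have "{z \<in> desc u. j \<le> dep z} \<inter> {z \<in> desc u. dep z < j} = {}"
      by auto
    ultimately show ?thesis
      unfolding sz_def by (metis (no_types, lifting) card_Un_disjoint finite_Un finite_desc)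
  qed
  ultimately show ?thesis by linarith
qed

text \<open>Leaves have size 1 and add nothing to the load. Without them an extremal level consists
  of one or two vertices.\<close>

definition inner :: "nat \<Rightarrow> 'a set" where
  "inner j = {x \<in> pverts T. dep x = j \<and> 2 \<le> sz x}"

lemma inner_subset: "inner j \<subseteq> {x \<in> pverts T. dep x = j}"
  by (auto simp: inner_def)

lemma finite_inner [simp]: "finite (inner j)"
  using finite_verts by (simp add: inner_def)

lemma innerE:
  assumes "x \<in> inner j"
  obtains w where "w \<in> children x"
  using assms children_empty_iff[of x] by (auto simp: inner_def)

lemma innerI: "w \<in> children x \<Longrightarrow> x \<in> inner (dep x)"
proof -
  assume w: "w \<in> children x"
  then have "x \<in> pverts T" by (rule parent_in)
  then show ?thesis
    using children_empty_iff[of x] sz_pos[of x] w by (auto simp: inner_def)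
qed

end

text \<open>\<open>up 1 a\<close> is the root of the branch that contains \<open>a\<close>;
  \<open>dep a\<close> and \<open>dep b\<close> are the depths k and m of the overview.\<close>

locale two_arms = centroid_rooted_tree +
  fixes a b
  assumes a: "a \<in> pverts T" "a \<noteq> c" and a_deepest: "\<And>z. z \<in> pverts T \<Longrightarrow> dep z \<le> dep a"
    and b: "b \<in> pverts T" "b \<noteq> c" "b \<notin> desc (up 1 a)"
    and b_deepest: "\<And>z. z \<in> pverts T \<Longrightarrow> z \<notin> desc (up 1 a) \<Longrightarrow> dep z \<le> dep b"
begin

abbreviation (input) n where "n \<equiv> card (pverts T)"
abbreviation (input) M where "M \<equiv> card (pverts T) div 2"
abbreviation (input) A where "A j \<equiv> up j a"
abbreviation (input) B where "B j \<equiv> up j b"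

lemma dep_pos: "1 \<le> dep a" "1 \<le> dep b" "dep b \<le> dep a"
  using a b a_deepest[of b] dep_eq_0_iff[of a] dep_eq_0_iff[of b] by auto

text \<open>A branch at the centroid has at most \<open>M\<close> vertices, and every further level
  costs at least one.\<close>

lemma sz_dep_le: "x \<in> pverts T \<Longrightarrow> x \<noteq> c \<Longrightarrow> sz x + dep x \<le> M + 1"
proof (induction "dep x" arbitrary: x rule: less_induct)
  case less
  show ?case
  proof (cases "par x = c")
    case True
    then have "x \<in> children c"
      using less by (simp add: children_def)
    then have "2 * sz x \<le> n" "dep x = 1"
      using half dep_par[of x] less True dep_root by auto
    then show ?thesis by simp
  next
    case False
    have "sz (par x) + dep (par x) \<le> M + 1"
      using less False dep_par[of x] par_in[of x] by simp
    then show ?thesis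
      using sz_par_less[of x] dep_par[of x] less by simp
  qed
qed

lemma A1: "A 1 \<in> pverts T" "dep (A 1) = 1" "A 1 \<noteq> c" "sz (A 1) \<le> M"
proof -
  show *: "A 1 \<in> pverts T" "dep (A 1) = 1"
    using up_in[OF a(1)] dep_pos by simp_all
  then show "A 1 \<noteq> c" using dep_root by auto
  then show "sz (A 1) \<le> M" using sz_dep_le[of "A 1"] * by simp
qed

lemma A_in: "j \<le> dep a \<Longrightarrow> A j \<in> pverts T" "j \<le> dep a \<Longrightarrow> dep (A j) = j"
  and B_in: "j \<le> dep b \<Longrightarrow> B j \<in> pverts T" "j \<le> dep b \<Longrightarrow> dep (B j) = j"
  using up_in a b by simp_all

lemma A_in_branch: "1 \<le> j \<Longrightarrow> j \<le> dep a \<Longrightarrow> A j \<in> desc (A 1)"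
  using up_in_desc_up a(1) by simp

lemma B_notin_branch:
  assumes "j \<le> dep b"
  shows "B j \<notin> desc (A 1)"
proof
  assume "B j \<in> desc (A 1)"
  then have "b \<in> desc (A 1)"
    using desc_trans[OF _ A1(1)] in_desc_up[OF b(1) assms] by blast
  then show False using b by simp
qed

lemma A_neq_B: "1 \<le> i \<Longrightarrow> i \<le> dep a \<Longrightarrow> j \<le> dep b \<Longrightarrow> A i \<noteq> B j"
  using A_in_branch B_notin_branch by metis

lemma A_inner:
  assumes "1 \<le> j" "j < dep a"
  shows "A j \<in> inner j"
proof -
  have "A (Suc j) \<noteq> c"
    using A_in[of "Suc j"] assms dep_root by auto
  then have "A (Suc j) \<in> children (A j)"
    using A_in[of "Suc j"] par_up[of j a] assms by (simp add: children_def)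
  then show ?thesis
    using innerI A_in[of j] assms by fastforce
qed

lemma B_inner:
  assumes "1 \<le> j" "j < dep b"
  shows "B j \<in> inner j"
proof -
  have "B (Suc j) \<noteq> c"
    using B_in[of "Suc j"] assms dep_root by auto
  then have "B (Suc j) \<in> children (B j)"
    using B_in[of "Suc j"] par_up[of j b] assms by (simp add: children_def)
  then show ?thesis
    using innerI B_in[of j] assms by fastforce
qed

lemma inj_on_arms: "inj_on A {..dep a}" "inj_on B {..dep b}"
  by (auto intro!: inj_onI dest: arg_cong[of _ _ dep] simp: A_in B_in)

text \<open>Above level \<open>j\<close> lie the root and two arm vertices on each of the levels 1
  to j - 1, altogether 2 j - 1.\<close>

lemma level_two_sum:
  assumes "1 \<le> j" "j \<le> dep b" "X \<subseteq> {x \<in> pverts T. dep x = j}"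
  shows "(\<Sum>x\<in>X. sz x) + 2 * j \<le> n + 1"
proof -
  have inj: "inj_on A {..<j}"
    by (rule inj_on_subset[OF inj_on_arms(1)]) (use assms dep_pos in auto)
  \<comment> \<open>The second arm is counted from level 1 on because \<open>A 0\<close> and
    \<open>B 0\<close> are both the root.\<close>
  have inj': "inj_on B {1..<j}"
    by (rule inj_on_subset[OF inj_on_arms(2)]) (use assms in auto)
  have disj: "A ` {..<j} \<inter> B ` {1..<j} = {}"
  proof (rule ccontr)
    assume "A ` {..<j} \<inter> B ` {1..<j} \<noteq> {}"
    then obtain i i' where ii: "i < j" "1 \<le> i'" "i' < j" "A i = B i'"
      by auto
    then have "i = i'"
      using A_in(2)[of i] B_in(2)[of i'] assms dep_pos by simp
    then show False
      using ii A_neq_B[of i i'] assms dep_pos by simp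
  qed
  have "card (A ` {..<j} \<union> B ` {1..<j}) = card (A ` {..<j}) + card (B ` {1..<j})"
    using disj by (intro card_Un_disjoint) auto
  also have "\<dots> = j + (j - 1)"
    using inj inj' by (simp add: card_image)
  finally have cY: "card (A ` {..<j} \<union> B ` {1..<j}) = j + (j - 1)" .
  have "(\<Sum>x\<in>X. sz x) + card (A ` {..<j} \<union> B ` {1..<j}) \<le> sz c"
  proof (rule sum_sz_level_le[of c j])
    show "X \<subseteq> {x. x \<in> desc c \<and> dep x = j}"
      using assms by (auto simp: desc_root)
    show "A ` {..<j} \<union> B ` {1..<j} \<subseteq> {z \<in> desc c. dep z < j}"
      using A_in B_in assms dep_pos by (auto simp: desc_root)
  qed (use root_in dep_root in auto)
  then show ?thesis
    using cY sz_root assms by simp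
qed

text \<open>The branch of \<open>a\<close> has at most \<open>M\<close> vertices, and the arm uses j
  - 1 of them above level \<open>j\<close>.\<close>

lemma level_one_sum:
  assumes "1 \<le> j" "j \<le> dep a" "X \<subseteq> {x \<in> desc (A 1). dep x = j}"
  shows "(\<Sum>x\<in>X. sz x) + j \<le> M + 1"
proof -
  have inj: "inj_on A {1..<j}"
    by (rule inj_on_subset[OF inj_on_arms(1)]) (use assms in auto)
  have "(\<Sum>x\<in>X. sz x) + card (A ` {1..<j}) \<le> sz (A 1)"
  proof (rule sum_sz_level_le[of "A 1" j])
    show "A ` {1..<j} \<subseteq> {z \<in> desc (A 1). dep z < j}"
      using A_in A_in_branch assms by auto
  qed (use A1 assms in auto)
  then show ?thesis
    using card_image[OF inj] A1(4) assms(1) by simp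
qed

text \<open>A child of an inner vertex on such a level is deeper than \<open>b\<close>, hence in the
  branch of \<open>a\<close>.\<close>

lemma inner_in_branch:
  assumes "dep b \<le> j" "1 \<le> j"
  shows "inner j \<subseteq> {x \<in> desc (A 1). dep x = j}"
proof
  fix x assume x: "x \<in> inner j"
  then obtain w where w: "w \<in> children x" by (rule innerE)
  have x': "x \<in> pverts T" "dep x = j"
    using x by (simp_all add: inner_def)
  have w': "w \<in> pverts T" "w \<noteq> c" "par w = x" "dep w = Suc j"
    using children_in[OF w] x' by simp_all
  have "w \<in> desc (A 1)"
    using b_deepest[OF w'(1)] w'(4) assms by fastforce
  moreover have "w \<noteq> A 1"
    using w'(4) A1(2) assms by auto
  ultimately have "x \<in> desc (A 1)"
    using in_desc_iff[OF w'(1,2) A1(1)] w'(3) by simp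
  then show "x \<in> {x \<in> desc (A 1). dep x = j}"
    using x' by simp
qed

text \<open>One vertex at the cap M + 1 - j and, while the second arm lasts, another one that takes
  the remaining n + 1 - 2 j - (M + 1 - j) = n - M - j.\<close>

definition level_bound :: "nat \<Rightarrow> nat" where
  "level_bound j = (M + 1 - j) * (M + 1 - j - 1) +
     (if j < dep b then (n - M - j) * (n - M - j - 1) else 0)"

lemma inner_sz_le: "x \<in> inner j \<Longrightarrow> 1 \<le> j \<Longrightarrow> sz x \<le> M + 1 - j"
  using sz_dep_le[of x] dep_root by (fastforce simp: inner_def)

text \<open>The cap M + 1 - j is half of the budget n + 1 - 2 j rounded up, as the bound for two
  parts demands.\<close>

lemma two_level_arith:
  assumes "1 \<le> j" "j < dep b"
  shows "n + 1 - 2 * j - (M + 1 - j) = n - M - j" "n + 1 - 2 * j \<le> 2 * (M + 1 - j)"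
    "2 * (M + 1 - j) \<le> n + 1 - 2 * j + 1"
proof -
  have "j \<le> M"
    using sz_dep_le[OF b(1,2)] assms by simp
  then show "n + 1 - 2 * j - (M + 1 - j) = n - M - j" "n + 1 - 2 * j \<le> 2 * (M + 1 - j)"
    "2 * (M + 1 - j) \<le> n + 1 - 2 * j + 1"
    by linarith+
qed

lemma level_le:
  assumes j: "1 \<le> j" "j < dep a"
  shows "(\<Sum>x\<in>inner j. sz x * (sz x - 1)) \<le> level_bound j"
proof (cases "j < dep b")
  case True
  have "(\<Sum>x\<in>inner j. sz x) \<le> n + 1 - 2 * j"
    using level_two_sum[OF j(1) less_imp_le[OF True] inner_subset] by linarith
  then have "(\<Sum>x\<in>inner j. sz x * (sz x - 1)) \<le> (M + 1 - j) * (M + 1 - j - 1) +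
      (n + 1 - 2 * j - (M + 1 - j)) * (n + 1 - 2 * j - (M + 1 - j) - 1)"
    using inner_sz_le[OF _ j(1)] two_level_arith(2,3)[OF j(1) True]
    by (intro sum_mult_pred_le2 finite_inner)
  then show ?thesis
    unfolding two_level_arith(1)[OF j(1) True] level_bound_def using True by simp
next
  case False
  have "(\<Sum>x\<in>inner j. sz x) \<le> M + 1 - j"
    using level_one_sum[of j "inner j"] inner_in_branch[of j] False j by simp
  then show ?thesis
    using sum_mult_pred_le[of "inner j" sz "M + 1 - j"] False by (simp add: level_bound_def)
qed

section \<open>Levels that attain their bound, and their sum\<close>

lemma inner_two:
  assumes j: "1 \<le> j" "j < dep b" and eq: "(\<Sum>x\<in>inner j. sz x * (sz x - 1)) = level_bound j"
  shows "inner j = {A j, B j}" "sz (A j) + sz (B j) = n + 1 - 2 * j"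
    "sz (A j) = M + 1 - j \<or> sz (B j) = M + 1 - j"
proof -
  have "j < dep a" using j dep_pos by simp
  have "inner j = {A j, B j} \<and> sz (A j) + sz (B j) = n + 1 - 2 * j \<and>
      (sz (A j) = M + 1 - j \<or> sz (B j) = M + 1 - j)"
  proof (rule sum_mult_pred_eq2D)
    show "(\<Sum>x\<in>inner j. sz x) \<le> n + 1 - 2 * j"
      using level_two_sum[OF j(1) less_imp_le[OF j(2)] inner_subset] by linarith
    show "sz x \<le> M + 1 - j" if "x \<in> inner j" for x
      using inner_sz_le[OF that j(1)] .
    show "2 \<le> sz x" if "x \<in> inner j" for x
      using that by (simp add: inner_def)
    show "n + 1 - 2 * j \<le> 2 * (M + 1 - j)" "2 * (M + 1 - j) \<le> n + 1 - 2 * j + 1"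
      using two_level_arith[OF j] by simp_all
    show "A j \<in> inner j" "B j \<in> inner j" "A j \<noteq> B j"
      using A_inner[OF j(1) \<open>j < dep a\<close>] B_inner[OF j] A_neq_B[of j j] j \<open>j < dep a\<close> by simp_all
    show "(\<Sum>x\<in>inner j. sz x * (sz x - 1)) = (M + 1 - j) * (M + 1 - j - 1) +
        (n + 1 - 2 * j - (M + 1 - j)) * (n + 1 - 2 * j - (M + 1 - j) - 1)"
      unfolding eq two_level_arith(1)[OF j] level_bound_def using j by simp
  qed simp
  then show "inner j = {A j, B j}" "sz (A j) + sz (B j) = n + 1 - 2 * j"
    "sz (A j) = M + 1 - j \<or> sz (B j) = M + 1 - j"
    by blast+
qed

lemma inner_one:
  assumes j: "dep b \<le> j" "j < dep a" and eq: "(\<Sum>x\<in>inner j. sz x * (sz x - 1)) = level_bound j"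
  shows "inner j = {A j}" "sz (A j) = M + 1 - j"
proof -
  have j1: "1 \<le> j" using j dep_pos by simp
  have "inner j = {A j} \<and> sz (A j) = M + 1 - j"
  proof (rule sum_mult_pred_eqD)
    show "(\<Sum>x\<in>inner j. sz x) \<le> M + 1 - j"
      using level_one_sum[of j "inner j"] inner_in_branch[of j] j j1 by simp
    show "2 \<le> sz x" if "x \<in> inner j" for x
      using that by (simp add: inner_def)
    show "A j \<in> inner j"
      by (rule A_inner[OF j1 j(2)])
    show "(\<Sum>x\<in>inner j. sz x * (sz x - 1)) = (M + 1 - j) * (M + 1 - j - 1)"
      unfolding eq level_bound_def using j by simp
  qed simp
  then show "inner j = {A j}" "sz (A j) = M + 1 - j"
    by blast+
qed

text \<open>The summation stops before level \<open>dep a\<close>, where all vertices are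
  leaves.\<close>

lemma load_eq_levels: "load = (\<Sum>j\<in>{1..<dep a}. \<Sum>x\<in>inner j. sz x * (sz x - 1))"
proof -
  let ?X = "{x \<in> pverts T. x \<noteq> c \<and> 2 \<le> sz x}"
  have "load = (\<Sum>x\<in>?X. sz x * (sz x - 1))"
    unfolding load_def
  proof (rule sum.mono_neutral_right)
    show "\<forall>x\<in>pverts T - {c} - ?X. sz x * (sz x - 1) = 0"
    proof
      fix x assume "x \<in> pverts T - {c} - ?X"
      then have "sz x \<le> 1" by auto
      then show "sz x * (sz x - 1) = 0" by (cases "sz x") auto
    qed
  qed (use finite_verts in auto)
  also have "?X = (\<Union>j\<in>{1..<dep a}. inner j)"
  proof (intro equalityI subsetI)
    fix x assume x: "x \<in> ?X"
    then have xi: "x \<in> inner (dep x)" by (simp add: inner_def)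
    then obtain w where "w \<in> children x" by (rule innerE)
    then have "dep x < dep a"
      using children_in[of w x] a_deepest[of w] by simp
    moreover have "1 \<le> dep x"
      using x dep_eq_0_iff[of x] by auto
    ultimately show "x \<in> (\<Union>j\<in>{1..<dep a}. inner j)"
      using xi by auto
  qed (auto simp: inner_def dep_root)
  also have "(\<Sum>x\<in>(\<Union>j\<in>{1..<dep a}. inner j). sz x * (sz x - 1)) =
      (\<Sum>j\<in>{1..<dep a}. \<Sum>x\<in>inner j. sz x * (sz x - 1))"
  proof (rule sum.UNION_disjoint)
    show "\<forall>i\<in>{1..<dep a}. \<forall>j\<in>{1..<dep a}. i \<noteq> j \<longrightarrow> inner i \<inter> inner j = {}"
      by (auto simp: inner_def)
  qed simp_all
  finally show ?thesis .
qed

lemma dep_a_le: "dep a \<le> M"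
  using sz_dep_le[OF a] sz_pos[OF a(1)] by simp

text \<open>For 1 \<le> j < dep a the cuts M + 1 - j fill an interval that ends at \<open>M\<close>.
  The number n - M - j is the smaller side of the cut M + j, and these cuts continue the interval
  from M + 1 to M + dep b - 1.\<close>

lemma sum_level_bound:
  "(\<Sum>j\<in>{1..<dep a}. level_bound j) =
    (\<Sum>y\<in>{M + 2 - dep a..<M + 2 - dep a + (dep a + dep b - 2)}. cut_load n y)"
proof -
  let ?k = "dep a" and ?m = "dep b"
  have k: "1 \<le> ?k" "1 \<le> ?m" "?m \<le> ?k" "?k \<le> M"
    using dep_pos dep_a_le by simp_all
  have "(\<Sum>j\<in>{1..<?k}. if j < ?m then (n - M - j) * (n - M - j - 1) else 0) =
      (\<Sum>j\<in>{1..<?m}. (n - M - j) * (n - M - j - 1))"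
    using k by (intro sum.mono_neutral_cong_right) auto
  also have "\<dots> = (\<Sum>y\<in>{M + 1..<M + ?m}. cut_load n y)"
  proof (rule sum.reindex_bij_witness[where i = "\<lambda>y. y - M" and j = "\<lambda>j. M + j"])
    fix j assume j: "j \<in> {1..<?m}"
    have "min (M + j) (n - (M + j)) = n - M - j"
      using j by auto
    then show "cut_load n (M + j) = (n - M - j) * (n - M - j - 1)"
      by (simp only: cut_load_def)
  qed auto
  finally have 1: "(\<Sum>j\<in>{1..<?k}. if j < ?m then (n - M - j) * (n - M - j - 1) else 0) =
      (\<Sum>y\<in>{M + 1..<M + ?m}. cut_load n y)" .
  have 2: "(\<Sum>j\<in>{1..<?k}. (M + 1 - j) * (M + 1 - j - 1)) = (\<Sum>y\<in>{M + 2 - ?k..<M + 1}. cut_load n y)"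
  proof (rule sum.reindex_bij_witness[where i = "\<lambda>y. M + 1 - y" and j = "\<lambda>j. M + 1 - j"])
    fix j assume j: "j \<in> {1..<?k}"
    have "min (M + 1 - j) (n - (M + 1 - j)) = M + 1 - j"
      using j by auto
    then show "cut_load n (M + 1 - j) = (M + 1 - j) * (M + 1 - j - 1)"
      by (simp only: cut_load_def)
  qed (use k in auto)
  have "M + 2 - ?k + (?k + ?m - 2) = M + ?m"
    using k by linarith
  moreover have "(\<Sum>y\<in>{M + 2 - ?k..<M + 1}. cut_load n y) + (\<Sum>y\<in>{M + 1..<M + ?m}. cut_load n y) =
      (\<Sum>y\<in>{M + 2 - ?k..<M + ?m}. cut_load n y)"
    using k by (intro sum.atLeastLessThan_concat) auto
  ultimately show ?thesis
    unfolding level_bound_def sum.distrib 1 2 by simp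
qed

lemma load_le:
  "load \<le> (\<Sum>y\<in>{M + 2 - dep a..<M + 2 - dep a + (dep a + dep b - 2)}. cut_load n y)"
  unfolding load_eq_levels sum_level_bound[symmetric] using level_le by (intro sum_mono) auto

lemma level_eq:
  assumes "load = (\<Sum>y\<in>{M + 2 - dep a..<M + 2 - dep a + (dep a + dep b - 2)}. cut_load n y)"
    and j: "1 \<le> j" "j < dep a"
  shows "(\<Sum>x\<in>inner j. sz x * (sz x - 1)) = level_bound j"
proof (rule sum_mono_inv[where I = "{1..<dep a}"
      and f = "\<lambda>j. \<Sum>x\<in>inner j. sz x * (sz x - 1)" and g = level_bound])
  show "(\<Sum>j\<in>{1..<dep a}. \<Sum>x\<in>inner j. sz x * (sz x - 1)) = (\<Sum>j\<in>{1..<dep a}. level_bound j)"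
    using assms(1) unfolding load_eq_levels sum_level_bound .
qed (use level_le j in auto)

text \<open>Leaves do not enter the load, but they do enter the size budgets of the levels. Where a
  level attains its bound, the arm vertices exhaust the budget, so leaves can hang only at the ends
  of the arms.\<close>

lemma vertex_cases:
  assumes eq: "\<And>j. 1 \<le> j \<Longrightarrow> j < dep a \<Longrightarrow> (\<Sum>x\<in>inner j. sz x * (sz x - 1)) = level_bound j"
    and z: "z \<in> pverts T" "z \<noteq> c"
  obtains (A) j where "1 \<le> j" "j < dep a" "z = A j"
    | (B) j where "1 \<le> j" "j < dep b" "z = B j"
    | (leaf_A) "sz z = 1" "par z = A (dep a - 1)"
    | (leaf_B) "sz z = 1" "par z = B (dep b - 1)"
proof -
  have inner_cases: "x = A j \<or> j < dep b \<and> x = B j" if "x \<in> inner j" "1 \<le> j" for x j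
  proof -
    obtain w where "w \<in> children x" using \<open>x \<in> inner j\<close> by (rule innerE)
    then have "j < dep a"
      using children_in[of w x] a_deepest[of w] that by (simp add: inner_def)
    show ?thesis
    proof (cases "j < dep b")
      case True
      then show ?thesis
        using inner_two(1)[OF \<open>1 \<le> j\<close> True eq] that \<open>j < dep a\<close> by blast
    next
      case False
      then show ?thesis
        using inner_one(1)[of j] eq[of j] that \<open>j < dep a\<close> by simp
    qed
  qed
  define j where "j = dep z"
  have j: "1 \<le> j" "j \<le> dep a"
    using z dep_eq_0_iff[of z] a_deepest[of z] by (auto simp: j_def)
  have p: "par z \<in> pverts T" "dep (par z) = j - 1" "z \<in> children (par z)"
    using par_in[OF z] dep_par[OF z] z by (simp_all add: j_def children_def)
  show thesis
  proof (cases "2 \<le> sz z")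
    case True
    then have "z \<in> inner j"
      using z by (simp add: inner_def j_def)
    moreover have "j < dep a"
      using innerE[OF \<open>z \<in> inner j\<close>] children_in a_deepest by (metis Suc_le_lessD j_def)
    ultimately show ?thesis
      using inner_cases[of z j] j A B by blast
  next
    case False
    then have sz1: "sz z = 1"
      using sz_pos[OF z(1)] by simp
    have not_inner: "z \<notin> inner i" for i
      using sz1 by (simp add: inner_def)
    \<comment> \<open>While the second arm lasts, \<open>A j\<close> and \<open>B j\<close> together
      already use the budget n + 1 - 2 j, and \<open>z\<close> would exceed it.\<close>
    have "dep b \<le> j"
    proof (rule ccontr)
      assume "\<not> dep b \<le> j"
      then have jb: "j < dep b" by simp
      then have ja: "j < dep a" using dep_pos by simp
      have two: "inner j = {A j, B j}" "sz (A j) + sz (B j) = n + 1 - 2 * j"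
        using inner_two[OF j(1) jb eq[OF j(1) ja]] by blast+
      have "A j \<noteq> B j" using A_neq_B[of j j] j jb by simp
      moreover have "z \<noteq> A j" "z \<noteq> B j"
        using not_inner two(1) by blast+
      ultimately have "(\<Sum>x\<in>{z, A j, B j}. sz x) = sz z + (sz (A j) + sz (B j))"
        by simp
      moreover have "{z, A j, B j} \<subseteq> {x \<in> pverts T. dep x = j}"
        using z inner_subset[of j] two(1) by (simp add: j_def)
      ultimately have "sz z + (sz (A j) + sz (B j)) + 2 * j \<le> n + 1"
        using level_two_sum[OF j(1) less_imp_le[OF jb]] by metis
      then show False
        using two(2) sz1 by linarith
    qed
    have par_cases: "par z = A (j - 1) \<or> j - 1 < dep b \<and> par z = B (j - 1)"
    proof (cases "j = 1")
      case True
      then have "par z = c"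
        using p dep_eq_0_iff by simp
      then show ?thesis
        using up_0[OF a(1)] True by simp
    next
      case False
      have "par z \<in> inner (j - 1)"
        using innerI[OF p(3)] p(2) by simp
      then show ?thesis
        using inner_cases False j by simp
    qed
    show ?thesis
    proof (cases "j = dep b \<and> par z = B (j - 1)")
      case True
      then show ?thesis using leaf_B sz1 by simp
    next
      case not_B: False
      then have pA: "par z = A (j - 1)"
      proof -
        have "j = dep b" if "j - 1 < dep b"
          using that \<open>dep b \<le> j\<close> j(1) by linarith
        then show ?thesis
          using par_cases not_B by blast
      qed
      \<comment> \<open>Between the two arm ends the same argument works inside the branch of
        \<open>a\<close>: there \<open>A j\<close> alone uses the budget M + 1 - j.\<close>
      have "j = dep a"
      proof (rule ccontr)
        assume "j \<noteq> dep a"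
        then have ja: "j < dep a" using j by simp
        \<comment> \<open>On level 1 the parent is the root, which is \<open>A 0\<close> and
          \<open>B 0\<close> alike; such a leaf has been settled by the case of
          \<open>B\<close>.\<close>
        have j2: "2 \<le> j"
        proof (rule ccontr)
          assume "\<not> 2 \<le> j"
          then have j1: "j = 1" using j by simp
          then have "dep b = 1" using \<open>dep b \<le> j\<close> dep_pos by simp
          moreover have "par z = B 0"
            using pA j1 up_0[OF a(1)] up_0[OF b(1)] by simp
          ultimately show False using not_B j1 by simp
        qed
        have one: "inner j = {A j}" "sz (A j) = M + 1 - j"
          using inner_one[OF \<open>dep b \<le> j\<close> ja eq[OF j(1) ja]] by blast+
        have zA: "z \<noteq> A j" using not_inner one(1) by blast
        have "z \<in> desc (A 1)"
          using in_desc_iff[OF z A1(1)] pA A_in_branch[of "j - 1"] j2 j by simp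
        then have "{z, A j} \<subseteq> {x \<in> desc (A 1). dep x = j}"
          using A_in_branch[of j] A_in(2)[of j] j by (simp add: j_def)
        then have "(\<Sum>x\<in>{z, A j}. sz x) + j \<le> M + 1"
          by (rule level_one_sum[OF j])
        then have "sz z + sz (A j) + j \<le> M + 1"
          using zA by simp
        then show False
          using one(2) sz1 ja dep_a_le by linarith
      qed
      then show ?thesis
        using leaf_A sz1 pA by simp
    qed
  qed
qed

end

section \<open>Brooms\<close>

definition broom_arc :: "nat \<Rightarrow> (nat \<Rightarrow> 'a) \<Rightarrow> 'a set \<Rightarrow> 'a set \<Rightarrow> 'a \<Rightarrow> 'a \<Rightarrow> bool" where
  "broom_arc d q L R x y \<longleftrightarrow>
     (\<exists>i. 1 \<le> i \<and> i + 1 \<le> d - 1 \<and> x = q i \<and> y = q (i + 1)) \<or> x = q 1 \<and> y \<in> L \<or> x = q (d - 1) \<and> y \<in> R"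

text \<open>The double broom up to renaming, inside an arbitrary vertex type: \<open>q\<close>
  enumerates the spine, \<open>L\<close> and \<open>R\<close> are the leaves at its two ends. For d
  = 2 both ends are the same vertex.\<close>

definition broom_shape ::
  "'a pair_pre_digraph \<Rightarrow> nat \<Rightarrow> (nat \<Rightarrow> 'a) \<Rightarrow> 'a set \<Rightarrow> 'a set \<Rightarrow> bool" where
  "broom_shape T d q L R \<longleftrightarrow> inj_on q {1..d - 1} \<and> finite L \<and> finite R \<and> L \<inter> R = {} \<and>
     q ` {1..d - 1} \<inter> (L \<union> R) = {} \<and> pverts T = q ` {1..d - 1} \<union> L \<union> R \<and>
     (\<forall>x y. (x, y) \<in> parcs T \<longleftrightarrow> broom_arc d q L R x y \<or> broom_arc d q L R y x)"

lemma broom_shapeD: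
  assumes "broom_shape T d q L R"
  shows "inj_on q {1..d - 1}" "finite L" "finite R" "L \<inter> R = {}" "q ` {1..d - 1} \<inter> (L \<union> R) = {}"
    "pverts T = q ` {1..d - 1} \<union> L \<union> R"
    "\<And>x y. (x, y) \<in> parcs T \<longleftrightarrow> broom_arc d q L R x y \<or> broom_arc d q L R y x"
  using assms unfolding broom_shape_def by blast+

lemma broom_shape_card:
  assumes "broom_shape T d q L R"
  shows "card (pverts T) = d - 1 + card L + card R"
proof -
  note D = broom_shapeD[OF assms]
  have "card (q ` {1..d - 1} \<union> (L \<union> R)) = card (q ` {1..d - 1}) + card (L \<union> R)"
    using D by (intro card_Un_disjoint) auto
  moreover have "card (L \<union> R) = card L + card R"
    using D by (intro card_Un_disjoint) auto
  moreover have "card (q ` {1..d - 1}) = d - 1"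
    using card_image[OF D(1)] by simp
  ultimately show ?thesis
    unfolding D(6) by (simp add: Un_assoc)
qed

lemma double_broom_shape:
  "broom_shape (double_broom d l r) d Spine (Left_Leaf ` {1..l}) (Right_Leaf ` {1..r})"
  unfolding broom_shape_def
proof (intro conjI allI)
  fix x y
  show "(x, y) \<in> parcs (double_broom d l r) \<longleftrightarrow>
      broom_arc d Spine (Left_Leaf ` {1..l}) (Right_Leaf ` {1..r}) x y \<or>
      broom_arc d Spine (Left_Leaf ` {1..l}) (Right_Leaf ` {1..r}) y x"
    unfolding double_broom_def Let_def broom_arc_def by auto
qed (auto simp: double_broom_def Let_def inj_on_def)

text \<open>Spine and leaf sets are pulled back along the inverse of the isomorphism; this lets the
  meeting time of a tree isomorphic to the broom be computed from its own shape.\<close>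

lemma broom_shape_transfer:
  assumes T: "pair_graph T" and bij: "bij_betw f (pverts T) (pverts T')"
    and arcs: "\<And>x y. x \<in> pverts T \<Longrightarrow> y \<in> pverts T \<Longrightarrow> (x, y) \<in> parcs T \<longleftrightarrow> (f x, f y) \<in> parcs T'"
    and shape: "broom_shape T' d q L R" and d: "2 \<le> d"
  shows "\<exists>q' L' R'. broom_shape T d q' L' R' \<and> card L' = card L \<and> card R' = card R"
proof -
  interpret pair_graph T by fact
  note D = broom_shapeD[OF shape]
  define g where "g = the_inv_into (pverts T) f"
  have f_inj: "inj_on f (pverts T)" and f_im: "f ` pverts T = pverts T'"
    using bij by (simp_all add: bij_betw_def)
  have gf: "g (f x) = x" if "x \<in> pverts T" for x
    using the_inv_into_f_f[OF f_inj that] by (simp add: g_def)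
  have fg: "f (g y) = y" "g y \<in> pverts T" if "y \<in> pverts T'" for y
    using f_the_inv_into_f[OF f_inj] the_inv_into_into[OF f_inj] that f_im by (simp_all add: g_def)
  have g_inj: "inj_on g (pverts T')"
    using fg by (metis inj_onI)
  have iff: "f x = y \<longleftrightarrow> x = g y" if "x \<in> pverts T" "y \<in> pverts T'" for x y
    using that fg gf by metis
  have mem: "f x \<in> S \<longleftrightarrow> x \<in> g ` S" if "x \<in> pverts T" "S \<subseteq> pverts T'" for x S
    using that fg gf by (metis image_iff subsetD)
  have sub: "q ` {1..d - 1} \<subseteq> pverts T'" "L \<subseteq> pverts T'" "R \<subseteq> pverts T'"
    using D(6) by auto
  have qi: "q i \<in> pverts T'" if "1 \<le> i" "i \<le> d - 1" for i
    using that sub(1) by auto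
  have arc: "broom_arc d q L R (f x) (f y) \<longleftrightarrow> broom_arc d (g \<circ> q) (g ` L) (g ` R) x y"
    if xy: "x \<in> pverts T" "y \<in> pverts T" for x y
  proof -
    have "f x = q 1 \<longleftrightarrow> x = g (q 1)" "f x = q (d - 1) \<longleftrightarrow> x = g (q (d - 1))"
      using d xy by (intro iff qi; simp)+
    moreover have "f y \<in> L \<longleftrightarrow> y \<in> g ` L" "f y \<in> R \<longleftrightarrow> y \<in> g ` R"
      using mem xy sub by simp_all
    moreover have "1 \<le> i \<and> i + 1 \<le> d - 1 \<and> f x = q i \<and> f y = q (i + 1) \<longleftrightarrow>
        1 \<le> i \<and> i + 1 \<le> d - 1 \<and> x = g (q i) \<and> y = g (q (i + 1))" for i
    proof (cases "1 \<le> i \<and> i + 1 \<le> d - 1")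
      case True
      then have "q i \<in> pverts T'" "q (i + 1) \<in> pverts T'"
        using qi[of i] qi[of "i + 1"] by simp_all
      then show ?thesis
        using iff xy by simp
    qed blast
    ultimately show ?thesis
      unfolding broom_arc_def comp_def by simp
  qed
  have arc_in: "x \<in> pverts T \<and> y \<in> pverts T" if "broom_arc d (g \<circ> q) (g ` L) (g ` R) x y" for x y
  proof -
    have "g (q i) \<in> pverts T" if "1 \<le> i" "i \<le> d - 1" for i
      using fg(2)[OF qi[OF that]] .
    moreover have "g ` L \<subseteq> pverts T" "g ` R \<subseteq> pverts T"
      using fg(2) sub by blast+
    ultimately show ?thesis
      using that d unfolding broom_arc_def comp_def by auto
  qed
  have "broom_shape T d (g \<circ> q) (g ` L) (g ` R)"
    unfolding broom_shape_def
  proof (intro conjI allI)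
    show "inj_on (g \<circ> q) {1..d - 1}"
      using D(1) inj_on_subset[OF g_inj sub(1)] by (rule comp_inj_on)
    show "finite (g ` L)" "finite (g ` R)" using D by simp_all
    show "g ` L \<inter> g ` R = {}"
      using inj_on_image_Int[OF g_inj sub(2,3)] D(4) by simp
    have "g ` (q ` {1..d - 1}) \<inter> g ` (L \<union> R) = {}"
      using inj_on_image_Int[OF g_inj sub(1), of "L \<union> R"] sub D(5) by simp
    then show "(g \<circ> q) ` {1..d - 1} \<inter> (g ` L \<union> g ` R) = {}"
      by (simp only: image_comp image_Un)
    have "g ` pverts T' = pverts T"
      unfolding f_im[symmetric] image_image using gf by simp
    then show "pverts T = (g \<circ> q) ` {1..d - 1} \<union> g ` L \<union> g ` R"
      unfolding D(6) image_Un image_comp by simp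
    fix x y
    show "(x, y) \<in> parcs T \<longleftrightarrow> broom_arc d (g \<circ> q) (g ` L) (g ` R) x y \<or>
        broom_arc d (g \<circ> q) (g ` L) (g ` R) y x"
    proof (cases "x \<in> pverts T \<and> y \<in> pverts T")
      case True
      then show ?thesis
        using arcs D(7) arc by simp
    next
      case False
      then show ?thesis
        using arc_in[of x y] arc_in[of y x] in_arcsD1[of x y] in_arcsD2[of x y] by blast
    qed
  qed
  moreover have "card (g ` L) = card L" "card (g ` R) = card R"
    using inj_on_subset[OF g_inj sub(2)] inj_on_subset[OF g_inj sub(3)] by (simp_all add: card_image)
  ultimately show ?thesis by blast
qed

text \<open>The map is glued from the bijection of the spines by index and arbitrary bijections of
  the leaf sets: leaves at the same end are interchangeable.\<close>

lemma broom_shape_iso: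
  assumes S: "broom_shape T d q L R" and S': "broom_shape T' d q' L' R'" and d: "2 \<le> d"
    and card: "card L = card L'" "card R = card R'"
  shows "\<exists>f. bij_betw f (pverts T) (pverts T') \<and>
    (\<forall>x\<in>pverts T. \<forall>y\<in>pverts T. (x, y) \<in> parcs T \<longleftrightarrow> (f x, f y) \<in> parcs T')"
proof -
  note D = broom_shapeD[OF S] and D' = broom_shapeD[OF S']
  obtain eL where eL: "bij_betw eL L L'"
    using finite_same_card_bij D(2) D'(2) card(1) by blast
  obtain eR where eR: "bij_betw eR R R'"
    using finite_same_card_bij D(3) D'(3) card(2) by blast
  define Q where "Q = q ` {1..d - 1}"
  define Q' where "Q' = q' ` {1..d - 1}"
  define eQ where "eQ = q' \<circ> the_inv_into {1..d - 1} q"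
  have eQ_q: "eQ (q i) = q' i" if "1 \<le> i" "i \<le> d - 1" for i
    using that the_inv_into_f_f[OF D(1), of i] by (simp add: eQ_def)
  have eQ: "bij_betw eQ Q Q'"
    unfolding eQ_def
  proof (rule bij_betw_trans)
    show "bij_betw (the_inv_into {1..d - 1} q) Q {1..d - 1}"
      unfolding Q_def by (rule bij_betw_the_inv_into) (rule inj_on_imp_bij_betw[OF D(1)])
    show "bij_betw q' {1..d - 1} Q'"
      unfolding Q'_def by (rule inj_on_imp_bij_betw[OF D'(1)])
  qed
  define f where "f x = (if x \<in> L then eL x else if x \<in> R then eR x else eQ x)" for x
  have fL: "bij_betw f L L'"
    using eL by (subst bij_betw_cong[of _ f eL]) (simp_all add: f_def)
  have fR: "bij_betw f R R'"
    using eR D(4) by (subst bij_betw_cong[of _ f eR]) (auto simp: f_def)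
  have Qn: "x \<notin> L" "x \<notin> R" if "x \<in> Q" for x
    using that D(5) by (auto simp: Q_def)
  have fQ: "bij_betw f Q Q'"
    using eQ Qn by (subst bij_betw_cong[of _ f eQ]) (auto simp: f_def)
  have "bij_betw f (Q \<union> L) (Q' \<union> L')"
    by (rule bij_betw_combine[OF fQ fL]) (use D'(5) in \<open>auto simp: Q'_def\<close>)
  then have "bij_betw f (Q \<union> L \<union> R) (Q' \<union> L' \<union> R')"
    by (rule bij_betw_combine[OF _ fR]) (use D'(4,5) in \<open>auto simp: Q'_def\<close>)
  then have bij: "bij_betw f (pverts T) (pverts T')"
    unfolding D(6) D'(6) Q_def Q'_def .
  have fq: "f (q i) = q' i" if "1 \<le> i" "i \<le> d - 1" for i
  proof -
    have "q i \<in> Q" using that by (simp add: Q_def)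
    then show ?thesis using Qn eQ_q[OF that] by (simp add: f_def)
  qed
  have f_inj: "inj_on f (pverts T)"
    using bij by (simp add: bij_betw_def)
  have qV: "q i \<in> pverts T" if "1 \<le> i" "i \<le> d - 1" for i
    using that unfolding D(6) by auto
  have f_q: "f x = q' i \<longleftrightarrow> x = q i" if "x \<in> pverts T" "1 \<le> i" "i \<le> d - 1" for x i
    using fq[OF that(2,3)] inj_on_eq_iff[OF f_inj that(1) qV[OF that(2,3)]] by simp
  have f_L: "f x \<in> L' \<longleftrightarrow> x \<in> L" if "x \<in> pverts T" for x
    using inj_on_image_mem_iff[OF f_inj that, of L] fL D(6) by (auto simp: bij_betw_def)
  have f_R: "f x \<in> R' \<longleftrightarrow> x \<in> R" if "x \<in> pverts T" for x
    using inj_on_image_mem_iff[OF f_inj that, of R] fR D(6) by (auto simp: bij_betw_def)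
  have arc: "broom_arc d q' L' R' (f x) (f y) \<longleftrightarrow> broom_arc d q L R x y"
    if xy: "x \<in> pverts T" "y \<in> pverts T" for x y
  proof -
    have "1 \<le> i \<and> i + 1 \<le> d - 1 \<and> f x = q' i \<and> f y = q' (i + 1) \<longleftrightarrow>
        1 \<le> i \<and> i + 1 \<le> d - 1 \<and> x = q i \<and> y = q (i + 1)" for i
      using f_q[OF xy(1), of i] f_q[OF xy(2), of "i + 1"] by auto
    moreover have "f x = q' 1 \<longleftrightarrow> x = q 1" "f x = q' (d - 1) \<longleftrightarrow> x = q (d - 1)"
      using d xy by (intro f_q; simp)+
    ultimately show ?thesis
      unfolding broom_arc_def using f_L[OF xy(2)] f_R[OF xy(2)] by simp
  qed
  have "(x, y) \<in> parcs T \<longleftrightarrow> (f x, f y) \<in> parcs T'" if "x \<in> pverts T" "y \<in> pverts T" for x y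
    unfolding D(7) D'(7) arc[OF that] arc[OF that(2,1)] ..
  then show ?thesis
    using bij by blast
qed

section \<open>Lower bound for the load of a balanced broom at every root\<close>

context rooted_tree begin

text \<open>After deletion of the edge between \<open>q i\<close> and \<open>q (i + 1)\<close>, the
  spine vertices and leaves on either side remain connected to its end of the edge. Which end is the
  child depends on the root.\<close>

lemma broom_side:
  assumes shape: "broom_shape T d q L R" and i: "1 \<le> i" "i + 1 \<le> d - 1"
  shows "q i \<noteq> c \<Longrightarrow> par (q i) = q (i + 1) \<Longrightarrow> card L + i \<le> sz (q i)"
    and "q (i + 1) \<noteq> c \<Longrightarrow> par (q (i + 1)) = q i \<Longrightarrow> card R + (d - 1 - i) \<le> sz (q (i + 1))"
proof -
  note D = broom_shapeD[OF shape]
  have q_eq: "q j = q k \<longleftrightarrow> j = k" if "1 \<le> j" "j \<le> d - 1" "1 \<le> k" "k \<le> d - 1" for j k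
    using inj_on_eq_iff[OF D(1)] that by simp
  have qV: "q j \<in> pverts T" if "1 \<le> j" "j \<le> d - 1" for j
    using that unfolding D(6) by auto
  have qLR: "q j \<notin> L" "q j \<notin> R" if "1 \<le> j" "j \<le> d - 1" for j
  proof -
    have "q j \<in> q ` {1..d - 1}" using that by simp
    then show "q j \<notin> L" "q j \<notin> R" using D(5) by blast+
  qed
  let ?E = "parcs T - {(q i, q (i + 1)), (q (i + 1), q i)}"
  {
    assume c: "q i \<noteq> c" "par (q i) = q (i + 1)"
    have desc: "desc (q i) = {z. (q i, z) \<in> ?E\<^sup>*}"
      using desc_eq_component[OF qV c(1)] c(2) i by simp
    have spine: "(q i, q (i - k)) \<in> ?E\<^sup>*" if "k < i" for k
      using that
    proof (induction k)
      case (Suc k)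
      have "i - k = i - Suc k + 1"
        using Suc.prems by simp
      then have "broom_arc d q L R (q (i - Suc k)) (q (i - k))"
        unfolding broom_arc_def using Suc.prems i by (intro disjI1 exI[of _ "i - Suc k"]) auto
      then have "(q (i - k), q (i - Suc k)) \<in> parcs T"
        unfolding D(7) by blast
      moreover have "(q (i - k), q (i - Suc k)) \<notin> {(q i, q (i + 1)), (q (i + 1), q i)}"
        using Suc.prems i q_eq[of "i - k" i] q_eq[of "i - Suc k" "i + 1"] q_eq[of "i - k" "i + 1"]
        by auto
      ultimately show ?case
        using Suc by (auto intro: rtrancl_into_rtrancl)
    qed simp
    have spine': "q j \<in> desc (q i)" if "1 \<le> j" "j \<le> i" for j
      using spine[of "i - j"] that unfolding desc by simp
    have "z \<in> desc (q i)" if "z \<in> L" for z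
    proof -
      have "(q 1, z) \<in> parcs T"
        unfolding D(7) broom_arc_def using that by blast
      moreover have "z \<noteq> q i" "z \<noteq> q (i + 1)"
        using qLR(1)[of i] qLR(1)[of "i + 1"] i that by auto
      ultimately have "(q 1, z) \<in> ?E" by blast
      then show ?thesis
        using spine'[of 1] i unfolding desc by (auto intro: rtrancl_into_rtrancl)
    qed
    then have "q ` {1..i} \<union> L \<subseteq> desc (q i)"
      using spine' by auto
    then have "card (q ` {1..i} \<union> L) \<le> sz (q i)"
      unfolding sz_def by (rule card_mono[OF finite_desc])
    moreover have "card (q ` {1..i} \<union> L) = card (q ` {1..i}) + card L"
      using D(2) qLR(1) i by (intro card_Un_disjoint) auto
    moreover have "card (q ` {1..i}) = i"
      using card_image[OF inj_on_subset[OF D(1)], of "{1..i}"] i by simp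
    ultimately show "card L + i \<le> sz (q i)" by simp
  }
  {
    assume c: "q (i + 1) \<noteq> c" "par (q (i + 1)) = q i"
    have desc: "desc (q (i + 1)) = {z. (q (i + 1), z) \<in> ?E\<^sup>*}"
      using desc_eq_component[OF qV c(1)] c(2) i by (simp add: insert_commute)
    have spine: "(q (i + 1), q (i + 1 + k)) \<in> ?E\<^sup>*" if "i + 1 + k \<le> d - 1" for k
      using that
    proof (induction k)
      case (Suc k)
      have "(q (i + 1 + k), q (i + 1 + Suc k)) \<in> parcs T"
        unfolding D(7) broom_arc_def using Suc.prems i by (intro disjI1 exI[of _ "i + 1 + k"]) auto
      moreover have "(q (i + 1 + k), q (i + 1 + Suc k)) \<notin> {(q i, q (i + 1)), (q (i + 1), q i)}"
        using Suc.prems i q_eq[of "i + 1 + k" i] q_eq[of "i + 1 + Suc k" i] by auto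
      ultimately show ?case
        using Suc by (auto intro: rtrancl_into_rtrancl)
    qed simp
    have spine': "q j \<in> desc (q (i + 1))" if "i + 1 \<le> j" "j \<le> d - 1" for j
      using spine[of "j - (i + 1)"] that unfolding desc by simp
    have "z \<in> desc (q (i + 1))" if "z \<in> R" for z
    proof -
      have "(q (d - 1), z) \<in> parcs T"
        unfolding D(7) broom_arc_def using that by blast
      moreover have "z \<noteq> q i" "z \<noteq> q (i + 1)"
        using qLR(2)[of i] qLR(2)[of "i + 1"] i that by auto
      ultimately have "(q (d - 1), z) \<in> ?E" by blast
      then show ?thesis
        using spine'[of "d - 1"] i unfolding desc by (auto intro: rtrancl_into_rtrancl)
    qed
    then have "q ` {i + 1..d - 1} \<union> R \<subseteq> desc (q (i + 1))"
      using spine' by auto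
    then have "card (q ` {i + 1..d - 1} \<union> R) \<le> sz (q (i + 1))"
      unfolding sz_def by (rule card_mono[OF finite_desc])
    moreover have "card (q ` {i + 1..d - 1} \<union> R) = card (q ` {i + 1..d - 1}) + card R"
      using D(3) qLR(2) i by (intro card_Un_disjoint) auto
    moreover have "card (q ` {i + 1..d - 1}) = d - 1 - i"
      using card_image[OF inj_on_subset[OF D(1)], of "{i + 1..d - 1}"] i by simp
    ultimately show "card R + (d - 1 - i) \<le> sz (q (i + 1))" by simp
  }
qed

text \<open>Wherever the root lies, each of the d - 2 spine edges has a child end whose subtree
  contains one full side of the edge, hence at least as many vertices as the smaller side.\<close>

lemma broom_load_le:
  assumes shape: "broom_shape T d q L R" and d: "2 \<le> d"
    and L: "card L = (card (pverts T) + 1 - d) div 2"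
  shows "broom_load (card (pverts T)) d \<le> load"
proof -
  note D = broom_shapeD[OF shape]
  let ?n = "card (pverts T)" and ?l = "card L"
  have n: "?n = d - 1 + ?l + card R"
    by (rule broom_shape_card[OF shape])
  have q_eq: "q j = q k \<longleftrightarrow> j = k" if "1 \<le> j" "j \<le> d - 1" "1 \<le> k" "k \<le> d - 1" for j k
    using inj_on_eq_iff[OF D(1)] that by simp
  have qV: "q j \<in> pverts T" if "1 \<le> j" "j \<le> d - 1" for j
    using that unfolding D(6) by auto
  have ex: "q i \<noteq> c \<and> par (q i) = q (i + 1) \<or> q (i + 1) \<noteq> c \<and> par (q (i + 1)) = q i"
    if "i \<in> {1..d - 2}" for i
  proof -
    have "(q i, q (i + 1)) \<in> parcs T"
      unfolding D(7) broom_arc_def using that by (intro disjI1 exI[of _ i]) auto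
    then show ?thesis
      unfolding arcs_iff by metis
  qed
  \<comment> \<open>The child end of the i-th spine edge. The edge is recovered from it as
    \<open>{x i, par (x i)}\<close>, so different edges have different child ends.\<close>
  define x where "x i = (if q i \<noteq> c \<and> par (q i) = q (i + 1) then q i else q (i + 1))" for i
  have x1: "x i = q i \<and> q i \<noteq> c \<and> par (q i) = q (i + 1) \<or>
      x i = q (i + 1) \<and> q (i + 1) \<noteq> c \<and> par (q (i + 1)) = q i" if "i \<in> {1..d - 2}" for i
    using ex[OF that] by (auto simp: x_def)
  have x_in: "x i \<in> pverts T - {c}" if "i \<in> {1..d - 2}" for i
    using x1[OF that] that d qV[of i] qV[of "i + 1"] by auto
  have inj: "inj_on x {1..d - 2}"
  proof (rule inj_onI)
    fix i j assume ij: "i \<in> {1..d - 2}" "j \<in> {1..d - 2}" "x i = x j"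
    have sets: "{x i, par (x i)} = {q i, q (i + 1)}" if "i \<in> {1..d - 2}" for i
      using x1[OF that] by auto
    have "{q i, q (i + 1)} = {q j, q (j + 1)}"
      using sets[OF ij(1)] sets[OF ij(2)] ij(3) by simp
    then have "q i = q j \<or> q i = q (j + 1) \<and> q (i + 1) = q j"
      unfolding doubleton_eq_iff by blast
    moreover have "1 \<le> i" "i + 1 \<le> d - 1" "1 \<le> j" "j + 1 \<le> d - 1"
      using ij d by auto
    ultimately show "i = j"
      using q_eq[of i j] q_eq[of i "j + 1"] q_eq[of "i + 1" j] by linarith
  qed
  have cut: "cut_load ?n (?l + i) \<le> sz (x i) * (sz (x i) - 1)" if i: "i \<in> {1..d - 2}" for i
  proof -
    have i': "1 \<le> i" "i + 1 \<le> d - 1" using i d by auto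
    have R: "?n - (?l + i) = card R + (d - 1 - i)"
      using n i' by linarith
    have "min (?l + i) (?n - (?l + i)) \<le> sz (x i)"
      using x1[OF i] broom_side[OF shape i'] unfolding R by (elim disjE) auto
    then show ?thesis
      unfolding cut_load_def by (rule mult_pred_mono)
  qed
  have "broom_load ?n d = (\<Sum>i\<in>{1..d - 2}. cut_load ?n (?l + i))"
    unfolding broom_load_def L[symmetric]
    by (rule sum.reindex_bij_witness[where i = "\<lambda>i. ?l + i" and j = "\<lambda>y. y - ?l"]) auto
  also have "\<dots> \<le> (\<Sum>i\<in>{1..d - 2}. sz (x i) * (sz (x i) - 1))"
    by (rule sum_mono) (rule cut)
  also have "\<dots> = (\<Sum>y\<in>x ` {1..d - 2}. sz y * (sz y - 1))"
    using inj by (simp add: sum.reindex)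
  also have "\<dots> \<le> load"
    unfolding load_def
  proof (rule sum_mono2)
    show "x ` {1..d - 2} \<subseteq> pverts T - {c}" using x_in by blast
  qed (use finite_verts in auto)
  finally show ?thesis .
qed

end

text \<open>The extremal analysis finds the two leaf numbers in either order; reading the spine
  backwards exchanges them.\<close>

lemma broom_shape_reverse:
  assumes shape: "broom_shape T d q L R" and d: "2 \<le> d"
  shows "broom_shape T d (\<lambda>i. q (d - i)) R L"
proof -
  note D = broom_shapeD[OF shape]
  have im: "(\<lambda>i. q (d - i)) ` {1..d - 1} = q ` {1..d - 1}"
  proof -
    have "(\<lambda>i. d - i) ` {1..d - 1} = {1..d - 1}"
    proof (intro equalityI subsetI)
      fix j assume "j \<in> {1..d - 1}"
      then show "j \<in> (\<lambda>i. d - i) ` {1..d - 1}"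
        by (intro image_eqI[of _ _ "d - j"]) auto
    qed auto
    then show ?thesis
      by (metis image_image)
  qed
  have inj: "inj_on (\<lambda>i. q (d - i)) {1..d - 1}"
  proof (rule inj_onI)
    fix i j assume ij: "i \<in> {1..d - 1}" "j \<in> {1..d - 1}" "q (d - i) = q (d - j)"
    then have "d - i = d - j"
      by (intro inj_onD[OF D(1)]) auto
    then show "i = j" using ij by auto
  qed
  have spine: "(\<exists>i. 1 \<le> i \<and> i + 1 \<le> d - 1 \<and> x = q (d - i) \<and> y = q (d - (i + 1))) \<longleftrightarrow>
      (\<exists>i. 1 \<le> i \<and> i + 1 \<le> d - 1 \<and> y = q i \<and> x = q (i + 1))" for x y
  proof
    assume "\<exists>i. 1 \<le> i \<and> i + 1 \<le> d - 1 \<and> x = q (d - i) \<and> y = q (d - (i + 1))"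
    then obtain i where i: "1 \<le> i" "i + 1 \<le> d - 1" "x = q (d - i)" "y = q (d - (i + 1))"
      by blast
    then have "d - i = d - (i + 1) + 1" by simp
    then show "\<exists>i. 1 \<le> i \<and> i + 1 \<le> d - 1 \<and> y = q i \<and> x = q (i + 1)"
      using i by (intro exI[of _ "d - (i + 1)"]) auto
  next
    assume "\<exists>i. 1 \<le> i \<and> i + 1 \<le> d - 1 \<and> y = q i \<and> x = q (i + 1)"
    then obtain i where i: "1 \<le> i" "i + 1 \<le> d - 1" "y = q i" "x = q (i + 1)"
      by blast
    then have "d - (d - (i + 1)) = i + 1" "d - (d - (i + 1) + 1) = i" by simp_all
    then show "\<exists>i. 1 \<le> i \<and> i + 1 \<le> d - 1 \<and> x = q (d - i) \<and> y = q (d - (i + 1))"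
      using i by (intro exI[of _ "d - (i + 1)"]) auto
  qed
  have "d - (d - 1) = 1" using d by simp
  then have "broom_arc d (\<lambda>i. q (d - i)) R L x y \<or> broom_arc d (\<lambda>i. q (d - i)) R L y x \<longleftrightarrow>
      broom_arc d q L R x y \<or> broom_arc d q L R y x" for x y
    unfolding broom_arc_def spine by auto
  then show ?thesis
    unfolding broom_shape_def im using D inj by (simp add: Int_commute Un_commute Un_left_commute)
qed

section \<open>Diameter and shape in the equality case\<close>

context two_arms begin

lemma dep_sum_le_diam: "dep a + dep b \<le> diam T"
proof -
  interpret G: pair_graph T by (rule pair_graph)
  \<comment> \<open>Signed depth, positive in the branch of \<open>a\<close>. It passes through 0 at
    the root, so it changes by 1 along every edge, and it separates \<open>a\<close> from
    \<open>b\<close> by dep a + dep b.\<close>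
  define F where "F z = (if z \<in> desc (A 1) then int (dep z) else - int (dep z))" for z
  have edge: "\<bar>F x - F (par x)\<bar> \<le> 1" if x: "x \<in> pverts T" "x \<noteq> c" for x
  proof (cases "x = A 1")
    case True
    then have "dep x = 1" using A1 by simp
    then have "dep (par x) = 0" using dep_par[OF x] by simp
    then show ?thesis using \<open>dep x = 1\<close> by (simp add: F_def)
  next
    case False
    then have "x \<in> desc (A 1) \<longleftrightarrow> par x \<in> desc (A 1)"
      using in_desc_iff[OF x A1(1)] by blast
    then show ?thesis using dep_par[OF x] by (simp add: F_def)
  qed
  have lip: "F y - F x \<le> 1" if "(x, y) \<in> parcs T" for x y
    using that edge[of x] edge[of y] unfolding arcs_iff by auto
  have "(b, a) \<in> (parcs T)\<^sup>*"
    using is_tree a(1) b(1) by (simp add: is_tree_iff)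
  then have "(b, a) \<in> parcs T ^^ distance T b a"
    by (rule relpow_distance[OF G.pair_wf_digraph b(1)])
  then have "F a - F b \<le> int (distance T b a)"
    using lip by (intro relpow_Lipschitz[where E = "parcs T"])
  moreover have "a \<in> desc (A 1)"
    using in_desc_up[OF a(1)] dep_pos by simp
  ultimately have "dep a + dep b \<le> distance T b a"
    using b(3) by (simp add: F_def)
  also have "\<dots> \<le> diam T"
    unfolding diam_def using a(1) b(1) finite_verts by (intro Max_ge) (auto intro!: rev_image_eqI[of "(b, a)"])
  finally show ?thesis .
qed

text \<open>The spine runs from the parent of \<open>a\<close> up to the root, which has index
  \<open>dep a\<close>, and down the second arm to the parent of \<open>b\<close>; \<open>a\<close>
  and \<open>b\<close> themselves are leaves.\<close>

lemma extremal_shape: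
  assumes eq: "\<And>j. 1 \<le> j \<Longrightarrow> j < dep a \<Longrightarrow> (\<Sum>x\<in>inner j. sz x * (sz x - 1)) = level_bound j"
    and a2: "2 \<le> dep a"
  shows "\<exists>q L R. broom_shape T (dep a + dep b) q L R \<and> card L = sz (A (dep a - 1)) - 1"
proof -
  let ?k = "dep a" and ?m = "dep b"
  have km: "1 \<le> ?m" "?m \<le> ?k" using dep_pos by simp_all
  define q where "q i = (if i \<le> ?k then A (?k - i) else B (i - ?k))" for i
  define L where "L = children (A (?k - 1))"
  \<comment> \<open>If \<open>dep b\<close> is 1, then \<open>B (?m - 1)\<close> is the root, whose
    children include the spine vertex \<open>A 1\<close>; the condition \<open>sz z = 1\<close>
    keeps it out.\<close>
  define R where "R = {z \<in> pverts T. z \<noteq> c \<and> sz z = 1 \<and> par z = B (?m - 1)}"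
  have qA: "q i = A (?k - i)" if "i \<le> ?k" for i
    using that by (simp add: q_def)
  have qB: "q i = B (i - ?k)" if "?k \<le> i" for i
    using that up_0[OF a(1)] up_0[OF b(1)] by (cases "i = ?k") (simp_all add: q_def)
  have q1: "q 1 = A (?k - 1)"
    using qA[of 1] a2 by simp
  have qlast: "q (?k + ?m - 1) = B (?m - 1)"
    using qB[of "?k + ?m - 1"] km by simp
  have V: "A j \<in> pverts T" if "j \<le> ?k" for j
    using A_in(1)[OF that] .
  have V': "B j \<in> pverts T" if "j \<le> ?m" for j
    using B_in(1)[OF that] .
  have ne: "A (?k - 1) \<noteq> B (?m - 1)"
    using A_neq_B[of "?k - 1" "?m - 1"] a2 by simp
  have Lx: "z \<in> pverts T \<and> z \<noteq> c \<and> par z = A (?k - 1) \<and> sz z = 1" if "z \<in> L" for z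
  proof -
    have z: "z \<in> pverts T" "z \<noteq> c" "par z = A (?k - 1)" "dep z = ?k"
      using children_in[of z "A (?k - 1)"] A_in(2)[of "?k - 1"] that a2 by (simp_all add: L_def)
    have "children z = {}"
      using children_in[of _ z] a_deepest z(4) by fastforce
    then show ?thesis
      using z children_empty_iff by simp
  qed
  have q_sz: "q i = c \<or> 2 \<le> sz (q i)" if "1 \<le> i" "i \<le> ?k + ?m - 1" for i
  proof (cases "i < ?k")
    case True
    then have "A (?k - i) \<in> inner (?k - i)"
      using that by (intro A_inner) auto
    then show ?thesis
      using qA[of i] True by (simp add: inner_def)
  next
    case False
    show ?thesis
    proof (cases "i = ?k")
      case True
      then show ?thesis using qA[of i] up_0[OF a(1)] by simp
    next
      case neq: False
      then have "B (i - ?k) \<in> inner (i - ?k)"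
        using that False by (intro B_inner) auto
      then show ?thesis
        using qB[of i] False by (simp add: inner_def)
    qed
  qed
  have q_dep: "dep (q i) = (if i \<le> ?k then ?k - i else i - ?k)" if "i \<le> ?k + ?m" for i
    using that A_in(2)[of "?k - i"] B_in(2)[of "i - ?k"] by (simp add: q_def)
  have q_in: "q i \<in> pverts T" if "i \<le> ?k + ?m - 1" for i
    using that V[of "?k - i"] V'[of "i - ?k"] by (simp add: q_def)
  have cases: "(\<exists>j. 1 \<le> j \<and> j < ?k \<and> z = A j) \<or> (\<exists>j. 1 \<le> j \<and> j < ?m \<and> z = B j) \<or>
      sz z = 1 \<and> par z = A (?k - 1) \<or> sz z = 1 \<and> par z = B (?m - 1)"
    if "z \<in> pverts T" "z \<noteq> c" for z
  proof (rule vertex_cases[OF _ that])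
    fix j assume "1 \<le> j" "j < ?k"
    then show "(\<Sum>x\<in>inner j. sz x * (sz x - 1)) = level_bound j" by (rule eq)
  qed blast+
  have "broom_shape T (?k + ?m) q L R"
    unfolding broom_shape_def
  proof (intro conjI allI)
    show "inj_on q {1..?k + ?m - 1}"
    proof (rule inj_onI)
      fix i j assume ij: "i \<in> {1..?k + ?m - 1}" "j \<in> {1..?k + ?m - 1}" "q i = q j"
      have *: False if "i < ?k" "?k < j" "1 \<le> i" "j \<le> ?k + ?m - 1" "q i = q j" for i j
      proof -
        have "1 \<le> ?k - i" "?k - i \<le> ?k" "j - ?k \<le> ?m" "i \<le> ?k" "?k \<le> j"
          using that by linarith+
        then show False
          using A_neq_B[of "?k - i" "j - ?k"] qA[of i] qB[of j] that(5) by simp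
      qed
      have dd: "dep (q i) = dep (q j)" using ij by simp
      show "i = j"
      proof (rule ccontr)
        assume neq: "i \<noteq> j"
        have "i \<le> ?k + ?m" "j \<le> ?k + ?m" "1 \<le> i" "1 \<le> j" using ij by auto
        then have "(if i \<le> ?k then ?k - i else i - ?k) = (if j \<le> ?k then ?k - j else j - ?k)"
          using dd q_dep by simp
        then have "i < ?k \<and> ?k < j \<or> j < ?k \<and> ?k < i"
          using neq by (simp split: if_splits)
        then show False
          using *[of i j] *[of j i] ij by auto
      qed
    qed
    show "finite L" by (simp add: L_def)
    show "finite R" using finite_verts by (simp add: R_def)
    show "L \<inter> R = {}" using Lx ne by (auto simp: R_def)
    show "q ` {1..?k + ?m - 1} \<inter> (L \<union> R) = {}"
      using q_sz Lx by (fastforce simp: R_def)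
    show "pverts T = q ` {1..?k + ?m - 1} \<union> L \<union> R"
    proof (intro equalityI subsetI)
      fix z assume z: "z \<in> pverts T"
      show "z \<in> q ` {1..?k + ?m - 1} \<union> L \<union> R"
      proof (cases "z = c")
        case True
        then have "z = q ?k" using qA[of ?k] up_0[OF a(1)] by simp
        then show ?thesis using km by auto
      next
        case False
        consider (A) j where "1 \<le> j" "j < ?k" "z = A j" | (B) j where "1 \<le> j" "j < ?m" "z = B j"
          | (leaf_A) "sz z = 1" "par z = A (?k - 1)" | (leaf_B) "sz z = 1" "par z = B (?m - 1)"
          using cases[OF z False] by blast
        then show ?thesis
        proof cases
          case (A j)
          then have "z = q (?k - j)" using qA[of "?k - j"] by simp
          moreover have "?k - j \<in> {1..?k + ?m - 1}" using A km by auto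
          ultimately show ?thesis by blast
        next
          case (B j)
          then have "z = q (?k + j)" using qB[of "?k + j"] by simp
          moreover have "?k + j \<in> {1..?k + ?m - 1}" using B km by auto
          ultimately show ?thesis by blast
        next
          case leaf_A
          then show ?thesis using z False by (simp add: L_def children_def)
        next
          case leaf_B
          then show ?thesis using z False by (simp add: R_def)
        qed
      qed
    next
      fix z assume "z \<in> q ` {1..?k + ?m - 1} \<union> L \<union> R"
      then show "z \<in> pverts T" using q_in Lx by (auto simp: R_def)
    qed
    fix x y
    have to_arc: "(x, y) \<in> parcs T" if "broom_arc (?k + ?m) q L R x y" for x y
      using that unfolding broom_arc_def
    proof (elim disjE)
      assume "\<exists>i. 1 \<le> i \<and> i + 1 \<le> ?k + ?m - 1 \<and> x = q i \<and> y = q (i + 1)"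
      then obtain i where i: "1 \<le> i" "i + 1 \<le> ?k + ?m - 1" "x = q i" "y = q (i + 1)" by blast
      show "(x, y) \<in> parcs T"
      proof (cases "i < ?k")
        case True
        then have "?k - i = Suc (?k - (i + 1))" by simp
        then have "par x = y"
          using par_up[of "?k - (i + 1)" a] qA[of i] qA[of "i + 1"] True i by simp
        moreover have "x \<noteq> c"
          using q_dep[of i] i True dep_root by auto
        ultimately show ?thesis
          using q_in[of i] i unfolding arcs_iff by auto
      next
        case False
        then have "i + 1 - ?k = Suc (i - ?k)" by simp
        then have "par y = x"
          using par_up[of "i - ?k" b] qB[of i] qB[of "i + 1"] False i by simp
        moreover have "i + 1 \<le> ?k + ?m"
          using i by linarith
        then have "dep y \<noteq> 0"
          using q_dep[of "i + 1"] i False by simp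
        then have "y \<noteq> c"
          using dep_root by auto
        ultimately show ?thesis
          using q_in[of "i + 1"] i unfolding arcs_iff by auto
      qed
    next
      assume "x = q 1 \<and> y \<in> L"
      then show "(x, y) \<in> parcs T"
        using Lx[of y] q1 unfolding arcs_iff by auto
    next
      assume "x = q (?k + ?m - 1) \<and> y \<in> R"
      then show "(x, y) \<in> parcs T"
        using qlast unfolding arcs_iff by (auto simp: R_def)
    qed
    have from_par: "broom_arc (?k + ?m) q L R z (par z) \<or> broom_arc (?k + ?m) q L R (par z) z"
      if z: "z \<in> pverts T" "z \<noteq> c" for z
    proof -
      consider (A) j where "1 \<le> j" "j < ?k" "z = A j" | (B) j where "1 \<le> j" "j < ?m" "z = B j"
        | (leaf_A) "sz z = 1" "par z = A (?k - 1)" | (leaf_B) "sz z = 1" "par z = B (?m - 1)"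
        using cases[OF z] by blast
      then show ?thesis
      proof cases
        case (A j)
        then have "par z = A (j - 1)"
          using par_up[of "j - 1" a] by simp
        then have "z = q (?k - j)" "par z = q (?k - j + 1)"
          using qA[of "?k - j"] qA[of "?k - j + 1"] A by simp_all
        then have "broom_arc (?k + ?m) q L R z (par z)"
          unfolding broom_arc_def using A km by (intro disjI1 exI[of _ "?k - j"]) auto
        then show ?thesis ..
      next
        case (B j)
        then have "par z = B (j - 1)"
          using par_up[of "j - 1" b] by simp
        then have "par z = q (?k + j - 1)" "z = q (?k + j - 1 + 1)"
          using qB[of "?k + j - 1"] qB[of "?k + j - 1 + 1"] B by simp_all
        then have "broom_arc (?k + ?m) q L R (par z) z"
          unfolding broom_arc_def using B a2 by (intro disjI1 exI[of _ "?k + j - 1"]) auto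
        then show ?thesis ..
      next
        case leaf_A
        then have "z \<in> L" using z by (simp add: L_def children_def)
        then show ?thesis
          using leaf_A q1 unfolding broom_arc_def by simp
      next
        case leaf_B
        then have "z \<in> R" using z by (simp add: R_def)
        then show ?thesis
          using leaf_B qlast unfolding broom_arc_def by simp
      qed
    qed
    have "sym (parcs T)"
      by (auto simp: sym_def arcs_iff)
    then have "(x, y) \<in> parcs T" if "broom_arc (?k + ?m) q L R y x"
      using to_arc[OF that] by (rule symD)
    then show "(x, y) \<in> parcs T \<longleftrightarrow>
        broom_arc (?k + ?m) q L R x y \<or> broom_arc (?k + ?m) q L R y x"
      using to_arc[of x y] from_par[of x] from_par[of y] unfolding arcs_iff[of x y] by blast
  qed
  moreover have "sz (A (?k - 1)) = Suc (card L)"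
  proof -
    have "(\<Sum>w\<in>children (A (?k - 1)). sz w) = (\<Sum>w\<in>L. 1)"
      unfolding L_def[symmetric] using Lx by (intro sum.cong) auto
    then show ?thesis
      using sz_eq[OF V[of "?k - 1"]] by simp
  qed
  ultimately show ?thesis
    by (metis diff_Suc_1)
qed

end

text \<open>The branch of a deepest vertex has at most half of the vertices, so for n \<ge> 3 a
  vertex other than the root lies outside it.\<close>

lemma (in centroid_rooted_tree) two_arms_exist:
  assumes n: "3 \<le> card (pverts T)"
  obtains a b where "two_arms T c par dep a b"
proof -
  let ?V = "pverts T"
  obtain a where a: "a \<in> ?V" "\<And>z. z \<in> ?V \<Longrightarrow> dep z \<le> dep a"
  proof -
    have "Max (dep ` ?V) \<in> dep ` ?V"
      using finite_verts root_in by (intro Max_in) auto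
    then obtain a where "a \<in> ?V" "dep a = Max (dep ` ?V)" by auto
    then show ?thesis
      using that finite_verts by simp
  qed
  have ch: "children c \<noteq> {}"
    using children_empty_iff[OF root_in] sz_root n by simp
  then obtain w where "w \<in> children c" by blast
  then have "1 \<le> dep a"
    using children_in[of w c] a(2)[of w] by simp
  then have ac: "a \<noteq> c" using dep_root by auto
  let ?u = "up 1 a"
  have u: "?u \<in> ?V" "dep ?u = 1"
    using up_in[OF a(1) \<open>1 \<le> dep a\<close>] by simp_all
  have "?u \<noteq> c" using u dep_root by auto
  then have "par ?u = c"
    using dep_par[OF u(1)] u dep_eq_0_iff par_in[OF u(1)] by simp
  then have "?u \<in> children c"
    using u \<open>?u \<noteq> c\<close> by (simp add: children_def)
  then have "2 * sz ?u \<le> card ?V" by (rule half)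
  then have "card (insert c (desc ?u)) < card ?V"
    using n card_insert_le_m1[of "card ?V - 1" "desc ?u" c] by (simp add: sz_def card_insert_if)
  then have "?V - insert c (desc ?u) \<noteq> {}"
    using card_mono[of "insert c (desc ?u)" ?V] finite_desc by (metis Diff_eq_empty_iff finite_insert not_le)
  let ?X = "?V - insert c (desc ?u)"
  obtain b where b: "b \<in> ?X" "\<And>z. z \<in> ?X \<Longrightarrow> dep z \<le> dep b"
  proof -
    have "Max (dep ` ?X) \<in> dep ` ?X"
      using finite_verts \<open>?X \<noteq> {}\<close> by (intro Max_in) auto
    then obtain b where "Max (dep ` ?X) = dep b" "b \<in> ?X" by (rule imageE)
    moreover have "dep z \<le> Max (dep ` ?X)" if "z \<in> ?X" for z
      using that finite_verts by (intro Max_ge) auto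
    ultimately show ?thesis
      using that by metis
  qed
  have "dep z \<le> dep b" if "z \<in> ?V" "z \<notin> desc ?u" for z
    using b(2)[of z] that dep_root by (cases "z = c") auto
  then have "two_arms T c par dep a b"
    using a ac b(1) by unfold_locales auto
  then show ?thesis by (rule that)
qed

text \<open>For d = 2 both leaf sets hang at the same vertex, so the leaves may be divided
  arbitrarily.\<close>

lemma (in two_arms) star_shape:
  assumes a1: "dep a = 1" and l: "l \<le> n - 1"
  shows "\<exists>q L R. broom_shape T 2 q L R \<and> card L = l \<and> card R = n - 1 - l"
proof -
  have par_c: "par z = c" if "z \<in> pverts T" "z \<noteq> c" for z
    using a_deepest[OF that(1)] dep_par[OF that] a1 dep_eq_0_iff[OF par_in[OF that]] by simp
  have card: "card (pverts T - {c}) = n - 1"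
    using finite_verts root_in by simp
  obtain L where L: "L \<subseteq> pverts T - {c}" "card L = l" "finite L"
    using obtain_subset_with_card_n[of l "pverts T - {c}"] l card by auto
  define R where "R = pverts T - {c} - L"
  have R: "finite R" "card R = n - 1 - l"
    using L card finite_verts by (simp_all add: R_def card_Diff_subset)
  have LR: "L \<union> R = pverts T - {c}" "L \<inter> R = {}"
    using L(1) by (auto simp: R_def)
  have arc: "broom_arc 2 (\<lambda>_. c) L R x y \<longleftrightarrow> x = c \<and> y \<in> pverts T \<and> y \<noteq> c" for x y
    unfolding broom_arc_def using LR(1) by auto
  have im: "(\<lambda>_. c) ` {1..2 - 1 :: nat} = {c}"
    by auto
  have "broom_shape T 2 (\<lambda>_. c) L R"
    unfolding broom_shape_def im
  proof (intro conjI allI)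
    show "pverts T = {c} \<union> L \<union> R"
      using LR root_in by auto
    show "{c} \<inter> (L \<union> R) = {}"
      using LR by auto
    fix x y
    show "(x, y) \<in> parcs T \<longleftrightarrow> broom_arc 2 (\<lambda>_. c) L R x y \<or> broom_arc 2 (\<lambda>_. c) L R y x"
      unfolding arc arcs_iff using par_c by metis
  qed (use L R LR in \<open>auto simp: inj_on_def\<close>)
  then show ?thesis
    using L(2) R(2) by blast
qed

section \<open>The upper bound for all trees and its equality case\<close>

lemma ennreal_load_le_iff:
  assumes "2 \<le> n"
  shows "ennreal (1 / 2 + 2 * real k / (real n - 1)) \<le> ennreal (1 / 2 + 2 * real m / (real n - 1)) \<longleftrightarrow> k \<le> m"
proof -
  have "0 \<le> 1 / 2 + 2 * real m / (real n - 1)"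
    using assms by simp
  then have "ennreal (1 / 2 + 2 * real k / (real n - 1)) \<le> ennreal (1 / 2 + 2 * real m / (real n - 1)) \<longleftrightarrow>
      2 * real k / (real n - 1) \<le> 2 * real m / (real n - 1)"
    by (simp add: ennreal_le_iff)
  also have "\<dots> \<longleftrightarrow> k \<le> m"
    using assms by (simp add: divide_le_cancel)
  finally show ?thesis .
qed

lemma bestmeet_le_broom_load:
  assumes tree: "is_tree T" and n: "card (pverts T) = n" and diam: "diam T = d" and d: "2 \<le> d" "d < n"
  shows "bestmeet T \<le> ennreal (1 / 2 + 2 * real (broom_load n d) / (real n - 1))"
    and "bestmeet T = ennreal (1 / 2 + 2 * real (broom_load n d) / (real n - 1)) \<Longrightarrow>
      \<exists>q L R. broom_shape T d q L R \<and> card L = (n + 1 - d) div 2 \<and> card R = n + 1 - d - (n + 1 - d) div 2"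
proof -
  define l where "l = (n + 1 - d) div 2"
  define r where "r = n + 1 - d - l"
  have n2: "2 \<le> card (pverts T)" "3 \<le> card (pverts T)" "2 \<le> n"
    using n d by simp_all
  obtain c par dep where C: "centroid_rooted_tree T c par dep"
    and best: "bestmeet T = ennreal (1 / 2 + 2 * real (rooted_tree.load T c par dep) / (real (card (pverts T)) - 1))"
    using centroid_exists[OF tree n2(1)] .
  interpret centroid_rooted_tree T c par dep by (rule C)
  obtain a b where "two_arms T c par dep a b"
    using two_arms_exist[OF n2(2)] .
  then interpret two_arms T c par dep a b .
  let ?s = "n div 2 + 2 - dep a" and ?k = "dep a + dep b - 2"
  have kd: "dep a + dep b \<le> d"
    using dep_sum_le_diam diam by simp
  have deps: "1 \<le> dep a" "1 \<le> dep b" "dep b \<le> dep a" "dep a \<le> n div 2"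
    using dep_pos dep_a_le n by simp_all
  have load1: "load \<le> (\<Sum>y\<in>{?s..<?s + ?k}. cut_load n y)"
    using load_le n by simp
  have k: "?k \<le> d - 2" "1 \<le> ?s"
    using kd deps by linarith+
  note int = interval_cut_load[OF d l_def r_def refl k]
  have le: "load \<le> broom_load n d"
    using load1 int(1) by (rule order_trans)
  show "bestmeet T \<le> ennreal (1 / 2 + 2 * real (broom_load n d) / (real n - 1))"
    unfolding best n ennreal_load_le_iff[OF n2(3)] by (rule le)
  assume "bestmeet T = ennreal (1 / 2 + 2 * real (broom_load n d) / (real n - 1))"
  then have "broom_load n d \<le> load"
    unfolding best n using ennreal_load_le_iff[OF n2(3), of "broom_load n d" load] by simp
  then have eq: "load = (\<Sum>y\<in>{?s..<?s + ?k}. cut_load n y)"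
    "(\<Sum>y\<in>{?s..<?s + ?k}. cut_load n y) = broom_load n d"
    using load1 int(1) by linarith+
  \<comment> \<open>Equality of the interval sums makes the arms together as long as the diameter
    and fixes where the interval starts; for d = 2 it is empty and its start remains
    unknown.\<close>
  have sum_d: "dep a + dep b = d" and s: "3 \<le> d \<Longrightarrow> ?s = l + 1 \<or> ?s = r + 1"
    using int(2)[OF eq(2)] deps d kd by auto
  have levels: "(\<Sum>x\<in>inner j. sz x * (sz x - 1)) = level_bound j" if "1 \<le> j" "j < dep a" for j
    using level_eq[OF _ that] eq(1) n by simp
  have lr: "l + r + d = n + 1"
    using d by (simp add: l_def r_def)
  have "\<exists>q L R. broom_shape T d q L R \<and> card L = l \<and> card R = r"
  proof (cases "3 \<le> d")
    case False
    then have d2: "d = 2" using d by simp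
    then have a1: "dep a = 1" using sum_d deps by linarith
    have l: "l \<le> card (pverts T) - 1" "card (pverts T) - 1 - l = r"
      using lr d2 n by linarith+
    show ?thesis
      using star_shape[OF a1 l(1)] unfolding l(2) d2 .
  next
    case True
    then have a2: "2 \<le> dep a" using sum_d deps by linarith
    have "\<exists>q L R. broom_shape T (dep a + dep b) q L R \<and> card L = sz (up (dep a - 1) a) - 1"
      using levels a2 by (rule extremal_shape)
    then obtain q L R where shape: "broom_shape T d q L R" and cL: "card L = sz (up (dep a - 1) a) - 1"
      unfolding sum_d by blast
    have cLR: "card L + card R = l + r"
      using broom_shape_card[OF shape] n lr d by linarith
    \<comment> \<open>The start \<open>?s\<close> is the size cap on the level dep a - 1, the last
      one with inner vertices. The subtree at an end of the spine away from the root consists of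
      that end and its leaves, so \<open>?s - 1\<close> turns out to be a number of leaves.\<close>
    have s': "n div 2 + 1 - (dep a - 1) = ?s"
      using deps by simp
    have "card L = ?s - 1 \<or> card R = ?s - 1"
    proof (cases "dep b < dep a")
      case True
      then have "sz (up (dep a - 1) a) = ?s"
        using inner_one(2)[of "dep a - 1"] levels[of "dep a - 1"] a2 n s' by simp
      then show ?thesis
        using cL by simp
    next
      case False
      \<comment> \<open>With arms of equal length the cap may be attained on either side; the common
        budget n + 1 - 2 j then expresses the size on the side of \<open>b\<close> through
        \<open>card R\<close>.\<close>
      then have ab: "dep b = dep a" using deps by simp
      let ?j = "dep a - 1"
      have j: "1 \<le> ?j" "?j < dep b" "?j < dep a" using a2 ab by simp_all
      have sum: "sz (up ?j a) + sz (up ?j b) = n + 1 - 2 * ?j"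
        and alt: "sz (up ?j a) = ?s \<or> sz (up ?j b) = ?s"
        using inner_two(2,3)[OF j(1,2) levels[OF j(1,3)]] unfolding n s' by simp_all
      have two: "2 \<le> sz (up ?j a)"
        using A_inner[OF j(1,3)] by (simp add: inner_def)
      have "sz (up ?j a) + sz (up ?j b) + d = n + 3"
        using sum two sum_d ab a2 by linarith
      moreover have "card L + 1 = sz (up ?j a)"
        using cL two by simp
      ultimately have "card R + 1 = sz (up ?j b)"
        using cLR lr by linarith
      then show ?thesis
        using alt cL by auto
    qed
    moreover have "?s - 1 = l \<or> ?s - 1 = r"
      using s[OF True] by (metis add_diff_cancel_right')
    ultimately have "card L = l \<or> card L = r \<or> card R = l \<or> card R = r"
      by metis
    then have "card L = l \<and> card R = r \<or> card L = r \<and> card R = l"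
      using cLR by auto
    then show ?thesis
    proof
      assume "card L = r \<and> card R = l"
      then show ?thesis
        using broom_shape_reverse[OF shape d(1)] by blast
    qed (use shape in blast)
  qed
  then show "\<exists>q L R. broom_shape T d q L R \<and> card L = (n + 1 - d) div 2 \<and> card R = n + 1 - d - (n + 1 - d) div 2"
    by (simp add: l_def r_def)
qed

section \<open>The double broom as a rooted tree, and its diameter\<close>

lemma double_broom_rooted:
  assumes d: "2 \<le> d"
  shows "rooted_tree (double_broom d l r) (Spine 1)
    (case_broom_vertex (\<lambda>i. Spine (i - 1)) (\<lambda>_. Spine 1) (\<lambda>_. Spine (d - 1)))
    (case_broom_vertex (\<lambda>i. i - 1) (\<lambda>_. 1) (\<lambda>_. d - 1))"
    (is "rooted_tree ?D _ ?par ?dep")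
proof
  have V: "pverts ?D = Spine ` {1..d - 1} \<union> Left_Leaf ` {1..l} \<union> Right_Leaf ` {1..r}"
    by (simp add: double_broom_def Let_def)
  show "finite (pverts ?D)" unfolding V by simp
  show "Spine 1 \<in> pverts ?D" unfolding V using d by simp
  show "?dep (Spine 1) = 0" by simp
  show "?par x \<in> pverts ?D" if x: "x \<in> pverts ?D" "x \<noteq> Spine 1" for x
  proof (cases x)
    case (Spine i)
    then have "i - 1 \<in> {1..d - 1}"
      using x unfolding V by auto
    then show ?thesis
      using Spine unfolding V by simp
  qed (use d in \<open>simp_all add: V\<close>)
  show "?dep x = Suc (?dep (?par x))" if "x \<in> pverts ?D" "x \<noteq> Spine 1" for x
    using that d unfolding V by auto
  fix x y
  have E: "(x, y) \<in> parcs ?D \<longleftrightarrow> x \<in> pverts ?D \<and> x \<noteq> Spine 1 \<and> y = ?par x \<or>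
      y \<in> pverts ?D \<and> y \<noteq> Spine 1 \<and> x = ?par y"
  proof -
    have up: "(\<exists>i. 1 \<le> i \<and> i + 1 \<le> d - 1 \<and> x = Spine i \<and> y = Spine (i + 1)) \<or>
        x = Spine 1 \<and> y \<in> Left_Leaf ` {1..l} \<or> x = Spine (d - 1) \<and> y \<in> Right_Leaf ` {1..r} \<longleftrightarrow>
        y \<in> pverts ?D \<and> y \<noteq> Spine 1 \<and> x = ?par y" for x y
    proof (cases y)
      case (Spine j)
      show ?thesis
      proof
        assume "y \<in> pverts ?D \<and> y \<noteq> Spine 1 \<and> x = ?par y"
        then have "2 \<le> j" "j \<le> d - 1" "x = Spine (j - 1)"
          using Spine unfolding V by auto
        then show "(\<exists>i. 1 \<le> i \<and> i + 1 \<le> d - 1 \<and> x = Spine i \<and> y = Spine (i + 1)) \<or>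
          x = Spine 1 \<and> y \<in> Left_Leaf ` {1..l} \<or> x = Spine (d - 1) \<and> y \<in> Right_Leaf ` {1..r}"
          using Spine by (intro disjI1 exI[of _ "j - 1"]) auto
      qed (use Spine in \<open>auto simp: V\<close>)
    qed (auto simp: V)
    show ?thesis
      unfolding broom_shapeD(7)[OF double_broom_shape] broom_arc_def up by blast
  qed
  then show "(x, y) \<in> parcs ?D \<longleftrightarrow> x \<in> pverts ?D \<and> x \<noteq> Spine 1 \<and> y = ?par x \<or>
      y \<in> pverts ?D \<and> y \<noteq> Spine 1 \<and> x = ?par y" .
qed

lemma double_broom_spine_walk:
  assumes "1 \<le> i" "i \<le> j" "j \<le> d - 1"
  shows "(Spine i, Spine j) \<in> parcs (double_broom d l r) ^^ (j - i)"
  using assms(2,3)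
proof (induction j rule: dec_induct)
  case (step j)
  have "(Spine j, Spine (Suc j)) \<in> parcs (double_broom d l r)"
    unfolding broom_shapeD(7)[OF double_broom_shape] broom_arc_def
    using step assms(1) by (intro disjI1 exI[of _ j]) auto
  moreover have "Suc j - i = Suc (j - i)"
    using step by simp
  ultimately show ?case
    using step by (auto intro: relpow_Suc_I)
qed simp

text \<open>Every vertex is within one step of the spine, whose ends are d - 2 apart. Conversely,
  the position along the broom is a potential with value 0 at left and d at right leaves that
  changes by at most 1 along an arc.\<close>

lemma double_broom_diam:
  assumes d: "2 \<le> d" and lr: "1 \<le> l" "1 \<le> r"
  shows "diam (double_broom d l r) = d"
proof -
  let ?D = "double_broom d l r" and ?E = "parcs (double_broom d l r)"
  interpret D: rooted_tree ?D "Spine 1"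
    "case_broom_vertex (\<lambda>i. Spine (i - 1)) (\<lambda>_. Spine 1) (\<lambda>_. Spine (d - 1))"
    "case_broom_vertex (\<lambda>i. i - 1) (\<lambda>_. 1) (\<lambda>_. d - 1)"
    by (rule double_broom_rooted[OF d])
  interpret G: pair_graph ?D by (rule D.pair_graph)
  have V: "pverts ?D = Spine ` {1..d - 1} \<union> Left_Leaf ` {1..l} \<union> Right_Leaf ` {1..r}"
    by (simp add: double_broom_def Let_def)
  have arcs: "(x, y) \<in> ?E \<longleftrightarrow> broom_arc d Spine (Left_Leaf ` {1..l}) (Right_Leaf ` {1..r}) x y \<or>
      broom_arc d Spine (Left_Leaf ` {1..l}) (Right_Leaf ` {1..r}) y x" for x y
    by (rule broom_shapeD(7)[OF double_broom_shape])
  have sym: "(y, x) \<in> ?E ^^ k" if "(x, y) \<in> ?E ^^ k" for x y k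
    using that
  proof (induction k arbitrary: y)
    case (Suc k)
    then obtain z where "(x, z) \<in> ?E ^^ k" "(z, y) \<in> ?E" by auto
    then show ?case
      using Suc.IH G.arcs_symmetric by (blast intro: relpow_Suc_I2)
  qed simp
  have anchor: "\<exists>i e. 1 \<le> i \<and> i \<le> d - 1 \<and> e \<le> 1 \<and> (x, Spine i) \<in> ?E ^^ e" if "x \<in> pverts ?D" for x
    using that unfolding V
  proof (elim UnE)
    assume "x \<in> Spine ` {1..d - 1}"
    then obtain i where "x = Spine i" "1 \<le> i" "i \<le> d - 1" by auto
    then show ?thesis by (intro exI[of _ i] exI[of _ 0]) auto
  next
    assume "x \<in> Left_Leaf ` {1..l}"
    then have "(x, Spine 1) \<in> ?E"
      unfolding arcs broom_arc_def by blast
    then show ?thesis using d by (intro exI[of _ 1]) auto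
  next
    assume "x \<in> Right_Leaf ` {1..r}"
    then have "(x, Spine (d - 1)) \<in> ?E"
      unfolding arcs broom_arc_def by blast
    then show ?thesis using d by (intro exI[of _ "d - 1"] exI[of _ 1]) auto
  qed
  have upper: "distance ?D x y \<le> d" if xy: "x \<in> pverts ?D" "y \<in> pverts ?D" for x y
  proof -
    obtain i e where i: "1 \<le> i" "i \<le> d - 1" "e \<le> 1" "(x, Spine i) \<in> ?E ^^ e"
      using anchor[OF xy(1)] by blast
    obtain j f where j: "1 \<le> j" "j \<le> d - 1" "f \<le> 1" "(y, Spine j) \<in> ?E ^^ f"
      using anchor[OF xy(2)] by blast
    obtain k where k: "k \<le> d - 2" "(Spine i, Spine j) \<in> ?E ^^ k"
    proof (cases "i \<le> j")
      case True
      then show ?thesis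
        using that[of "j - i"] double_broom_spine_walk[OF i(1) True j(2)] i j by simp
    next
      case False
      then show ?thesis
        using that[of "i - j"] sym[OF double_broom_spine_walk[OF j(1) _ i(2)]] i j by simp
    qed
    have "(x, y) \<in> ?E ^^ (e + k + f)"
      unfolding relpow_add using i(4) k(2) sym[OF j(4)] by blast
    then have "distance ?D x y \<le> e + k + f"
      by (rule distance_le[OF G.pair_wf_digraph xy(1)])
    then show ?thesis
      using i(3) j(3) k(1) d by linarith
  qed
  let ?x = "Left_Leaf 1" and ?y = "Right_Leaf 1"
  have xy: "?x \<in> pverts ?D" "?y \<in> pverts ?D"
    unfolding V using lr by auto
  define F where "F = case_broom_vertex int (\<lambda>_. 0) (\<lambda>_. int d)"
  have "F y - F x \<le> 1" if "(x, y) \<in> ?E" for x y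
    using that d unfolding arcs broom_arc_def F_def by (auto simp: of_nat_diff)
  moreover have "(?x, ?y) \<in> ?E ^^ distance ?D ?x ?y"
    using relpow_distance[OF G.pair_wf_digraph xy(1)] D.is_tree xy by (simp add: is_tree_iff)
  ultimately have "F ?y - F ?x \<le> int (distance ?D ?x ?y)"
    by (intro relpow_Lipschitz[where E = ?E])
  then have lower: "d \<le> distance ?D ?x ?y"
    by (simp add: F_def)
  have fin: "finite (pverts ?D)" by (rule D.finite_verts)
  show ?thesis
    unfolding diam_def
  proof (rule antisym)
    show "Max ((\<lambda>(u, v). distance ?D u v) ` (pverts ?D \<times> pverts ?D)) \<le> d"
      using fin xy upper by (intro Max.boundedI) auto
    have "distance ?D ?x ?y \<le> Max ((\<lambda>(u, v). distance ?D u v) ` (pverts ?D \<times> pverts ?D))"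
      using fin xy by (intro Max_ge) (auto intro!: rev_image_eqI[of "(?x, ?y)"])
    then show "d \<le> Max ((\<lambda>(u, v). distance ?D u v) ` (pverts ?D \<times> pverts ?D))"
      using lower by (rule order_trans[rotated])
  qed
qed

lemma balanced_double_broom_eq:
  assumes "2 \<le> d" "d \<le> n - 1"
  shows "balanced_double_broom n d =
    double_broom d ((n + 1 - d) div 2) (n + 1 - d - (n + 1 - d) div 2)"
proof -
  have k: "n - d + 1 = n + 1 - d"
    using assms by simp
  have fl: "nat \<lfloor>real k / 2\<rfloor> = k div 2" for k
    by (simp add: floor_divide_of_nat_eq[of k 2, simplified])
  have ce: "nat \<lceil>real k / 2\<rceil> = k - k div 2" for k
  proof -
    have "real k / 2 = real (k - k div 2) - (if even k then 0 else 1 / 2)"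
      by (auto elim!: evenE oddE simp: of_nat_diff field_simps)
    then have "\<lceil>real k / 2\<rceil> = int (k - k div 2)"
      by (intro ceiling_unique) auto
    then show ?thesis by simp
  qed
  show ?thesis
    unfolding balanced_double_broom_def k fl ce ..
qed

section \<open>The closed form\<close>

text \<open>The cubes come from 3 y (y - 1) = (y^3 - y) - ((y - 1)^3 - (y - 1)): each half of the
  cuts telescopes, one starting from l and the other from l + e. The induction removes the outermost
  cuts and therefore varies \<open>l\<close>.\<close>

lemma sum_cut_load_even:
  assumes "1 \<le> l" "e \<le> 1"
  shows "3 * real (\<Sum>y\<in>{l + 1..<l + 1 + 2 * t}. cut_load (2 * l + 2 * t + 1 + e) y) =
    (real l + t) ^ 3 - (real l + t) - (real l ^ 3 - l) +
    ((real l + t + e) ^ 3 - (real l + t + e)) - ((real l + e) ^ 3 - (real l + e))"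
  using assms
proof (induction t arbitrary: l)
  case 0
  then show ?case by simp
next
  case (Suc t)
  have "(\<Sum>y\<in>{l + 1..<l + 1 + 2 * Suc t}. cut_load (2 * l + 2 * Suc t + 1 + e) y) =
      (l + 1) * l + (l + 1 + e) * (l + e) +
      (\<Sum>y\<in>{(l + 1) + 1..<(l + 1) + 1 + 2 * t}. cut_load (2 * (l + 1) + 2 * t + 1 + e) y)"
    using cut_load_shift_sum[of l e "2 * t"] Suc.prems by simp
  then have "3 * real (\<Sum>y\<in>{l + 1..<l + 1 + 2 * Suc t}. cut_load (2 * l + 2 * Suc t + 1 + e) y) =
      3 * real ((l + 1) * l + (l + 1 + e) * (l + e)) +
      3 * real (\<Sum>y\<in>{(l + 1) + 1..<(l + 1) + 1 + 2 * t}. cut_load (2 * (l + 1) + 2 * t + 1 + e) y)"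
    by simp
  also have "\<dots> = 3 * real ((l + 1) * l + (l + 1 + e) * (l + e)) +
      ((real (l + 1) + t) ^ 3 - (real (l + 1) + t) - (real (l + 1) ^ 3 - real (l + 1)) +
      ((real (l + 1) + t + e) ^ 3 - (real (l + 1) + t + e)) - ((real (l + 1) + e) ^ 3 - (real (l + 1) + e)))"
    using Suc.IH[of "l + 1"] Suc.prems by simp
  also have "\<dots> = (real l + Suc t) ^ 3 - (real l + Suc t) - (real l ^ 3 - l) +
      ((real l + Suc t + e) ^ 3 - (real l + Suc t + e)) - ((real l + e) ^ 3 - (real l + e))"
    by (simp add: power3_eq_cube algebra_simps)
  finally show ?case .
qed

text \<open>The additional last summand is the cut in the middle, y = l + t + 1.\<close>

lemma sum_cut_load_odd:
  assumes "1 \<le> l" "e \<le> 1"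
  shows "3 * real (\<Sum>y\<in>{l + 1..<l + 1 + (2 * t + 1)}. cut_load (2 * l + (2 * t + 1) + 1 + e) y) =
    (real l + t) ^ 3 - (real l + t) - (real l ^ 3 - l) +
    ((real l + t + e) ^ 3 - (real l + t + e)) - ((real l + e) ^ 3 - (real l + e)) +
    3 * (real l + t + 1) * (real l + t)"
  using assms
proof (induction t arbitrary: l)
  case 0
  have "min (l + 1) (2 * l + 1 + 1 + e - (l + 1)) = l + 1"
    by simp
  then have "cut_load (2 * l + 1 + 1 + e) (l + 1) = (l + 1) * l"
    unfolding cut_load_def by simp
  then show ?case by (simp add: algebra_simps)
next
  case (Suc t)
  have "(\<Sum>y\<in>{l + 1..<l + 1 + (2 * Suc t + 1)}. cut_load (2 * l + (2 * Suc t + 1) + 1 + e) y) =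
      (l + 1) * l + (l + 1 + e) * (l + e) +
      (\<Sum>y\<in>{(l + 1) + 1..<(l + 1) + 1 + (2 * t + 1)}. cut_load (2 * (l + 1) + (2 * t + 1) + 1 + e) y)"
    using cut_load_shift_sum[of l e "2 * t + 1"] Suc.prems by simp
  then have "3 * real (\<Sum>y\<in>{l + 1..<l + 1 + (2 * Suc t + 1)}. cut_load (2 * l + (2 * Suc t + 1) + 1 + e) y) =
      3 * real ((l + 1) * l + (l + 1 + e) * (l + e)) +
      3 * real (\<Sum>y\<in>{(l + 1) + 1..<(l + 1) + 1 + (2 * t + 1)}. cut_load (2 * (l + 1) + (2 * t + 1) + 1 + e) y)"
    by (simp only: of_nat_add distrib_left)
  also have "\<dots> = 3 * real ((l + 1) * l + (l + 1 + e) * (l + e)) +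
      ((real (l + 1) + t) ^ 3 - (real (l + 1) + t) - (real (l + 1) ^ 3 - real (l + 1)) +
      ((real (l + 1) + t + e) ^ 3 - (real (l + 1) + t + e)) - ((real (l + 1) + e) ^ 3 - (real (l + 1) + e)) +
      3 * (real (l + 1) + t + 1) * (real (l + 1) + t))"
    by (subst Suc.IH) (use Suc.prems in simp_all)
  also have "\<dots> = (real l + Suc t) ^ 3 - (real l + Suc t) - (real l ^ 3 - l) +
      ((real l + Suc t + e) ^ 3 - (real l + Suc t + e)) - ((real l + e) ^ 3 - (real l + e)) +
      3 * (real l + Suc t + 1) * (real l + Suc t)"
    by (simp add: power3_eq_cube algebra_simps)
  finally show ?case .
qed

text \<open>The four-case expression of the final statement, named so that it can be folded
  there.\<close>

definition broom_value :: "nat \<Rightarrow> nat \<Rightarrow> real" where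
  "broom_value n d =
    (if odd n \<and> odd d then
       1 / 2 * ((real d - 2) * real n - real d ^ 2 + 3 * real d - 2)
         + (real d ^ 3 - 6 * real d ^ 2 + 11 * real d - 6) / (6 * (real n - 1))
     else if odd n \<and> even d then
       1 / 2 * ((real d - 2) * real n - real d ^ 2 + 3 * real d - 1)
         + (real d ^ 3 - 6 * real d ^ 2 + 8 * real d) / (6 * (real n - 1))
     else if even n \<and> odd d then
       1 / 2 * ((real d - 2) * real n - real d ^ 2 + 3 * real d)
         + (real d ^ 3 - 6 * real d ^ 2 + 8 * real d) / (6 * (real n - 1))
     else
       1 / 2 * ((real d - 2) * real n - real d ^ 2 + 3 * real d - 1)
         + (real d ^ 3 - 6 * real d ^ 2 + 11 * real d - 6) / (6 * (real n - 1)))"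

text \<open>Multiplication by 6 N reduces each parity case to a polynomial identity;
  \<open>W\<close> stands for the closed form of three times the load.\<close>

lemma eq_divide_shift:
  fixes N :: real
  assumes "0 < N" "3 * w = W" "3 * N + 4 * W = 6 * N * p + P"
  shows "1 / 2 + 2 * w / N = p + P / (6 * N)"
proof -
  have w: "w = W / 3" using assms(2) by simp
  have "1 / 2 + 2 * w / N = (3 * N + 4 * W) / (6 * N)"
    unfolding w using assms(1) by (simp add: field_simps)
  also have "\<dots> = p + P / (6 * N)"
    unfolding assms(3) using assms(1) by (simp add: field_simps)
  finally show ?thesis .
qed

text \<open>With \<open>e\<close> the parity of n + 1 - d and m = d - 2, the equation n = 2 l + m +
  1 + e translates the parities of \<open>m\<close> and \<open>e\<close> into the four
  cases.\<close>

lemma broom_value_eq: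
  assumes d: "2 \<le> d" "d < n"
  shows "1 / 2 + 2 * real (broom_load n d) / (real n - 1) = broom_value n d"
proof -
  define l where "l = (n + 1 - d) div 2"
  define e where "e = (n + 1 - d) mod 2"
  define m where "m = d - 2"
  have le: "n + 1 - d = 2 * l + e" "e \<le> 1"
    by (simp_all add: l_def e_def)
  have l1: "1 \<le> l"
    using d by (simp add: l_def)
  have dm: "d = m + 2" using d by (simp add: m_def)
  have nm: "n = 2 * l + m + 1 + e"
    using le d dm by linarith
  have load: "broom_load n d = (\<Sum>y\<in>{l + 1..<l + 1 + m}. cut_load n y)"
  proof -
    have "{l + 1..l + d - 2} = {l + 1..<l + 1 + m}"
      using dm by auto
    then show ?thesis by (simp add: broom_load_def l_def)
  qed
  have pos: "0 < real n - 1"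
    using d by simp
  consider t where "m = 2 * t" | t where "m = 2 * t + 1"
    by (metis evenE oddE)
  then show ?thesis
  proof cases
    case 1
    have n: "n = 2 * l + 2 * t + 1 + e" using nm 1 by simp
    have W: "3 * real (broom_load n d) = (real l + t) ^ 3 - (real l + t) - (real l ^ 3 - l) +
        ((real l + t + e) ^ 3 - (real l + t + e)) - ((real l + e) ^ 3 - (real l + e))"
    proof -
      have "broom_load n d = (\<Sum>y\<in>{l + 1..<l + 1 + 2 * t}. cut_load (2 * l + 2 * t + 1 + e) y)"
        unfolding load 1 by (simp only: n[symmetric])
      then show ?thesis
        by (simp only: sum_cut_load_even[OF l1 le(2)])
    qed
    have rd: "real d = 2 * real t + 2" using dm 1 by simp
    have ed: "even d" using dm 1 by simp
    consider "e = 0" | "e = 1" using le(2) by linarith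
    then show ?thesis
    proof cases
      case e: 1
      have rn: "real n = 2 * real l + 2 * real t + 1" using n e by simp
      have "odd n" using n e by simp
      then have v: "broom_value n d = 1 / 2 * ((real d - 2) * real n - real d ^ 2 + 3 * real d - 1)
          + (real d ^ 3 - 6 * real d ^ 2 + 8 * real d) / (6 * (real n - 1))"
        using ed by (simp add: broom_value_def)
      show ?thesis
        unfolding v
        by (rule eq_divide_shift[OF pos W])
          (simp add: rn rd e power2_eq_square power3_eq_cube algebra_simps)
    next
      case e: 2
      have rn: "real n = 2 * real l + 2 * real t + 2" using n e by simp
      have "even n" using n e by simp
      then have v: "broom_value n d = 1 / 2 * ((real d - 2) * real n - real d ^ 2 + 3 * real d - 1)
          + (real d ^ 3 - 6 * real d ^ 2 + 11 * real d - 6) / (6 * (real n - 1))"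
        using ed by (simp add: broom_value_def)
      show ?thesis
        unfolding v
        by (rule eq_divide_shift[OF pos W])
          (simp add: rn rd e power2_eq_square power3_eq_cube algebra_simps)
    qed
  next
    case 2
    have n: "n = 2 * l + (2 * t + 1) + 1 + e" using nm 2 by simp
    have W: "3 * real (broom_load n d) = (real l + t) ^ 3 - (real l + t) - (real l ^ 3 - l) +
        ((real l + t + e) ^ 3 - (real l + t + e)) - ((real l + e) ^ 3 - (real l + e)) +
        3 * (real l + t + 1) * (real l + t)"
    proof -
      have "broom_load n d =
          (\<Sum>y\<in>{l + 1..<l + 1 + (2 * t + 1)}. cut_load (2 * l + (2 * t + 1) + 1 + e) y)"
        unfolding load 2 by (simp only: n[symmetric])
      then show ?thesis
        by (simp only: sum_cut_load_odd[OF l1 le(2)])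
    qed
    have rd: "real d = 2 * real t + 3" using dm 2 by simp
    have od: "odd d" using dm 2 by simp
    consider "e = 0" | "e = 1" using le(2) by linarith
    then show ?thesis
    proof cases
      case e: 1
      have rn: "real n = 2 * real l + 2 * real t + 2" using n e by simp
      have "even n" using n e by simp
      then have v: "broom_value n d = 1 / 2 * ((real d - 2) * real n - real d ^ 2 + 3 * real d)
          + (real d ^ 3 - 6 * real d ^ 2 + 8 * real d) / (6 * (real n - 1))"
        using od by (simp add: broom_value_def)
      show ?thesis
        unfolding v
        by (rule eq_divide_shift[OF pos W])
          (simp add: rn rd e power2_eq_square power3_eq_cube algebra_simps)
    next
      case e: 2
      have rn: "real n = 2 * real l + 2 * real t + 3" using n e by simp
      have "odd n" using n e by simp
      then have v: "broom_value n d = 1 / 2 * ((real d - 2) * real n - real d ^ 2 + 3 * real d - 2)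
          + (real d ^ 3 - 6 * real d ^ 2 + 11 * real d - 6) / (6 * (real n - 1))"
        using od by (simp add: broom_value_def)
      show ?thesis
        unfolding v
        by (rule eq_divide_shift[OF pos W])
          (simp add: rn rd e power2_eq_square power3_eq_cube algebra_simps)
    qed
  qed
qed

text \<open>The broom attains the general upper bound, and the lower bound holds at every root, so
  the optimal vertex of the broom is never determined.\<close>

lemma bestmeet_broom_shape:
  assumes tree: "is_tree T" and n: "card (pverts T) = n" and diam: "diam T = d" and d: "2 \<le> d" "d < n"
    and shape: "broom_shape T d q L R" and L: "card L = (n + 1 - d) div 2"
  shows "bestmeet T = ennreal (1 / 2 + 2 * real (broom_load n d) / (real n - 1))"
proof (rule antisym)
  show "bestmeet T \<le> ennreal (1 / 2 + 2 * real (broom_load n d) / (real n - 1))"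
    by (rule bestmeet_le_broom_load(1)[OF tree n diam d])
  have n2: "2 \<le> card (pverts T)" using n d by simp
  show "ennreal (1 / 2 + 2 * real (broom_load n d) / (real n - 1)) \<le> bestmeet T"
    using bestmeet_ge[OF tree n2, of "broom_load n d"] rooted_tree.broom_load_le[OF _ shape d(1)] L n
    by simp
qed

theorem theorem1p7:
  fixes n d :: nat
  assumes "2 \<le> d" and "d \<le> n - 1"
  shows "is_tree (balanced_double_broom n d)
    \<and> card (pverts (balanced_double_broom n d)) = n
    \<and> diam (balanced_double_broom n d) = d
    \<and> (\<forall>T :: 'a pair_pre_digraph. is_tree T \<and> card (pverts T) = n \<and> diam T = d \<longrightarrow>
         bestmeet T \<le> bestmeet (balanced_double_broom n d) \<and>
         (bestmeet T = bestmeet (balanced_double_broom n d)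
            \<longleftrightarrow> isomorphic T (balanced_double_broom n d)))
    \<and> bestmeet (balanced_double_broom n d) = ennreal
        (if odd n \<and> odd d then
           1 / 2 * ((real d - 2) * real n - real d ^ 2 + 3 * real d - 2)
             + (real d ^ 3 - 6 * real d ^ 2 + 11 * real d - 6) / (6 * (real n - 1))
         else if odd n \<and> even d then
           1 / 2 * ((real d - 2) * real n - real d ^ 2 + 3 * real d - 1)
             + (real d ^ 3 - 6 * real d ^ 2 + 8 * real d) / (6 * (real n - 1))
         else if even n \<and> odd d then
           1 / 2 * ((real d - 2) * real n - real d ^ 2 + 3 * real d)
             + (real d ^ 3 - 6 * real d ^ 2 + 8 * real d) / (6 * (real n - 1))
         else
           1 / 2 * ((real d - 2) * real n - real d ^ 2 + 3 * real d - 1)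
             + (real d ^ 3 - 6 * real d ^ 2 + 11 * real d - 6) / (6 * (real n - 1)))"
proof -
  define l where "l = (n + 1 - d) div 2"
  define r where "r = n + 1 - d - l"
  define D where "D = balanced_double_broom n d"
  have d: "2 \<le> d" "d < n" using assms by auto
  have lr: "1 \<le> l" "1 \<le> r" "l + r + d = n + 1"
    using d by (auto simp: l_def r_def)
  have D: "D = double_broom d l r"
    unfolding D_def l_def r_def by (rule balanced_double_broom_eq[OF assms])
  let ?LD = "Left_Leaf ` {1..l}" and ?RD = "Right_Leaf ` {1..r}"
  have shape: "broom_shape D d Spine ?LD ?RD"
    unfolding D by (rule double_broom_shape)
  have cards: "card ?LD = l" "card ?RD = r"
    by (simp_all add: card_image inj_on_def)
  have tree: "is_tree D"
    unfolding D by (rule rooted_tree.is_tree[OF double_broom_rooted[OF d(1)]])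
  have card: "card (pverts D) = n"
    using broom_shape_card[OF shape] cards lr d by linarith
  have diam: "diam D = d"
    unfolding D by (rule double_broom_diam[OF d(1) lr(1,2)])
  have best: "bestmeet D = ennreal (1 / 2 + 2 * real (broom_load n d) / (real n - 1))"
    using bestmeet_broom_shape[OF tree card diam d shape] cards(1) by (simp add: l_def)
  have DG: "pair_graph D"
    using tree by (simp add: is_tree_def)
  have T: "bestmeet T \<le> bestmeet D \<and> (bestmeet T = bestmeet D \<longleftrightarrow> isomorphic T D)"
    if "is_tree T" "card (pverts T) = n" "diam T = d" for T :: "'a pair_pre_digraph"
  proof (intro conjI iffI)
    have TG: "pair_graph T"
      using that(1) by (simp add: is_tree_def)
    show "bestmeet T \<le> bestmeet D"
      unfolding best by (rule bestmeet_le_broom_load(1)[OF that d])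
    show "isomorphic T D" if eq: "bestmeet T = bestmeet D"
    proof -
      obtain q L R where S: "broom_shape T d q L R" "card L = l" "card R = r"
        using bestmeet_le_broom_load(2)[OF \<open>is_tree T\<close> \<open>card (pverts T) = n\<close> \<open>diam T = d\<close> d] eq
        unfolding best l_def r_def by blast
      show ?thesis
        unfolding isomorphic_iff[OF TG DG] using S cards
        by (intro broom_shape_iso[OF S(1) shape d(1)]) simp_all
    qed
    \<comment> \<open>The value is computed afresh from the shape pulled back along the isomorphism;
      this takes the place of invariance of \<open>bestmeet\<close>.\<close>
    show "bestmeet T = bestmeet D" if iso: "isomorphic T D"
    proof -
      obtain f where f: "bij_betw f (pverts T) (pverts D)"
        "\<And>x y. x \<in> pverts T \<Longrightarrow> y \<in> pverts T \<Longrightarrow> (x, y) \<in> parcs T \<longleftrightarrow> (f x, f y) \<in> parcs D"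
        using iso unfolding isomorphic_iff[OF TG DG] by blast
      obtain q L R where S: "broom_shape T d q L R" "card L = card ?LD"
        using broom_shape_transfer[OF TG f shape d(1)] by blast
      show ?thesis
        unfolding best
        by (rule bestmeet_broom_shape[OF \<open>is_tree T\<close> \<open>card (pverts T) = n\<close> \<open>diam T = d\<close> d S(1)])
          (simp only: S(2) cards(1) l_def[symmetric])
    qed
  qed
  have val: "bestmeet D = ennreal (broom_value n d)"
    unfolding best broom_value_eq[OF d] ..
  show ?thesis
    unfolding D_def[symmetric] broom_value_def[symmetric]
    using tree card diam T val by blast
qed

end
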